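(* Let $\mathcal{A}$ be a finite alphabet with $\#\mathcal{A}\ge2$ and $\mathbf{p}$ an irreducible pair on $\mathcal{A}$. Then the labeled Rauzy class of $\mathbf{p}$ contains a piece-wise order reversing pair which is of one of the Types $\langle1\rangle,\langle2\rangle,\langle3\rangle,\langle4\rangle,\langle5\rangle$.
   Context: Let $n=\#\mathcal{A}$. A pair on $\mathcal{A}$ is $\mathbf{p}=(p_0,p_1)$ with $p_0,p_1:\mathcal{A}\to\{1,\dots,n\}$ bijections (row $\varepsilon$ lists $p_\varepsilon^{-1}(1),\dots,p_\varepsilon^{-1}(n)$). $\mathbf{p}$ is irreducible if $p_0^{-1}\{1,\dots,k\}\neq p_1^{-1}\{1,\dots,k\}$ for all $1\le k<n$. Rauzy move of type $\varepsilon\in\{0,1\}$: $\varepsilon\mathbf{p}=(p_0',p_1')$ with $p'_\varepsilon=p_\varepsilon$ and, for $z=p_\varepsilon^{-1}(n)$, $p'_{1-\varepsilon}(b)=p_{1-\varepsilon}(b)$ if $p_{1-\varepsilon}(b)\le p_{1-\varepsilon}(z)$, $=p_{1-\varepsilon}(b)+1$ if $p_{1-\varepsilon}(z)<p_{1-\varepsilon}(b)<n$, $=p_{1-\varepsilon}(z)+1$ if $p_{1-\varepsilon}(b)=n$. The labeled Rauzy class of $\mathbf{p}$ is the set of pairs reachable from $\mathbf{p}$ by sequences of Rauzy moves. $\mathbf{p}$ is standard if $p_0^{-1}(1)=p_1^{-1}(n)$ and $p_1^{-1}(1)=p_0^{-1}(n)$. A standard pair is piece-wise order reversing if there are $2=k_0<k_1<\dots<k_\ell=n$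 such that for each $i$, the set $B_i=p_0^{-1}\{k_{i-1},\dots,k_i-1\}$ equals $p_1^{-1}\{k_{i-1},\dots,k_i-1\}$ and $p_0(b)+p_1(b)=k_{i-1}+k_i-1$ for $b\in B_i$. The sets $B_i$ are the (order reversing) blocks; a block with $k$ letters is a $k$-block. Chains: list the $1$-blocks from left to right as $S_1,\dots,S_{k-1}$; the chain $C_i$ ($1\le i\le k$) is the (possibly empty) sequence of consecutive blocks lying strictly between $S_{i-1}$ and $S_i$ (with $C_1$ the blocks before $S_1$ and $C_k$ the blocks after $S_{k-1}$). Types of a piece-wise order reversing pair: Type $\langle1\rangle$: at most one chain is nonempty, and a nonempty chain (if any) consists of exactly one block. Types $\langle2\rangle$–$\langle5\rangle$ all additionally require that the pair has more than one block of size $\ge2$. Type $\langle2\rangle$: every nonempty chain consists only of $2$-blocks. Type $\langle3\rangle$: every nonempty chain is either (i) $m$ consecutive $2$-blocks, then one $3$-block, then $\ell$ consecutive $2$-blocks ($m,\ell\ge0$), or (ii) $m\ge1$ consecutive $2$-blocks; and at least one chain is of form (i). Type $\langle4\rangle$: exactly one chain consists of a $4$-block followed by $m\ge0$ consecutive $2$-blocks, and all other nonempty chains consist of $2$-blocks. Type $\langle5\rangle$: exactly one chain consists of a single $5$-block and every other nonempty chain consists of exactly one $2$-block. *)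

theory Defs
  imports Main "HOL-Library.Cardinality"
begin

type_synonym 'a lpair = "('a \<Rightarrow> nat) \<times> ('a \<Rightarrow> nat)"

definition is_pair :: "('a::finite) lpair \<Rightarrow> bool" where
  "is_pair p \<longleftrightarrow> bij_betw (fst p) UNIV {1 .. CARD('a)} \<and> bij_betw (snd p) UNIV {1 .. CARD('a)}"

definition irreducible_pair :: "('a::finite) lpair \<Rightarrow> bool" where
  "irreducible_pair p \<longleftrightarrow> is_pair p \<and>
     (\<forall>k. 1 \<le> k \<and> k < CARD('a) \<longrightarrow> fst p -` {1..k} \<noteq> snd p -` {1..k})"

definition letter_at :: "('a \<Rightarrow> nat) \<Rightarrow> nat \<Rightarrow> 'a" where
  "letter_at q i = (THE a. q a = i)"

text \<open>Update of the row r (= p_{1-eps}) given the fixed row q (= p_eps).\<close>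
definition rauzy_aux :: "('a::finite \<Rightarrow> nat) \<Rightarrow> ('a \<Rightarrow> nat) \<Rightarrow> ('a \<Rightarrow> nat)" where
  "rauzy_aux q r = (let n = CARD('a); z = letter_at q n in
     (\<lambda>b. if r b \<le> r z then r b else if r b < n then r b + 1 else r z + 1))"

definition rauzy_move :: "nat \<Rightarrow> ('a::finite) lpair \<Rightarrow> 'a lpair" where
  "rauzy_move e p = (if e = 0 then (fst p, rauzy_aux (fst p) (snd p))
                     else (rauzy_aux (snd p) (fst p), snd p))"

definition in_rauzy_class :: "('a::finite) lpair \<Rightarrow> 'a lpair \<Rightarrow> bool" where
  "in_rauzy_class p q \<longleftrightarrow> (\<lambda>x y. \<exists>e\<in>{0::nat,1}. y = rauzy_move e x)\<^sup>*\<^sup>* p q"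

definition standard_pair :: "('a::finite) lpair \<Rightarrow> bool" where
  "standard_pair p \<longleftrightarrow> letter_at (fst p) 1 = letter_at (snd p) CARD('a) \<and>
                        letter_at (snd p) 1 = letter_at (fst p) CARD('a)"

definition por_decomp :: "('a::finite) lpair \<Rightarrow> (nat \<Rightarrow> nat) \<Rightarrow> nat \<Rightarrow> bool" where
  "por_decomp p k l \<longleftrightarrow> standard_pair p \<and> k 0 = 2 \<and> k l = CARD('a) \<and>
     (\<forall>i<l. k i < k (Suc i)) \<and>
     (\<forall>i\<in>{1..l}. fst p -` {k (i - 1)..<k i} = snd p -` {k (i - 1)..<k i} \<and>
        (\<forall>b\<in>fst p -` {k (i - 1)..<k i}. fst p b + snd p b = k (i - 1) + k i - 1))"

definition block_sizes :: "(nat \<Rightarrow> nat) \<Rightarrow> nat \<Rightarrow> nat list" where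
  "block_sizes k l = map (\<lambda>i. k (Suc i) - k i) [0..<l]"

fun chains :: "nat list \<Rightarrow> nat list list" where
  "chains [] = [[]]"
| "chains (x # xs) = (let cs = chains xs in
     if x = 1 then [] # cs else (x # hd cs) # tl cs)"

definition multi_big :: "nat list \<Rightarrow> bool" where
  "multi_big s \<longleftrightarrow> length (filter (\<lambda>x. 2 \<le> x) s) > 1"

definition type1 :: "nat list \<Rightarrow> bool" where
  "type1 s \<longleftrightarrow> length (filter (\<lambda>c. c \<noteq> []) (chains s)) \<le> 1 \<and>
               (\<forall>c\<in>set (chains s). c \<noteq> [] \<longrightarrow> length c = 1)"

definition type2 :: "nat list \<Rightarrow> bool" where
  "type2 s \<longleftrightarrow> multi_big s \<and> (\<forall>c\<in>set (chains s). \<forall>x\<in>set c. x = 2)"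

definition formI :: "nat list \<Rightarrow> bool" where
  "formI c \<longleftrightarrow> (\<exists>m l. c = replicate m 2 @ [3] @ replicate l 2)"

definition formII :: "nat list \<Rightarrow> bool" where
  "formII c \<longleftrightarrow> (\<exists>m\<ge>1. c = replicate m 2)"

definition type3 :: "nat list \<Rightarrow> bool" where
  "type3 s \<longleftrightarrow> multi_big s \<and>
     (\<forall>c\<in>set (chains s). c \<noteq> [] \<longrightarrow> formI c \<or> formII c) \<and>
     (\<exists>c\<in>set (chains s). formI c)"

definition type4 :: "nat list \<Rightarrow> bool" where
  "type4 s \<longleftrightarrow> multi_big s \<and>
     (\<exists>i<length (chains s). (\<exists>m. chains s ! i = 4 # replicate m 2) \<and>
        (\<forall>j<length (chains s). j \<noteq> i \<longrightarrow> (\<forall>x\<in>set (chains s ! j). x = 2)))"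

definition type5 :: "nat list \<Rightarrow> bool" where
  "type5 s \<longleftrightarrow> multi_big s \<and>
     (\<exists>i<length (chains s). chains s ! i = [5] \<and>
        (\<forall>j<length (chains s). j \<noteq> i \<longrightarrow> chains s ! j = [] \<or> chains s ! j = [2]))"

end

(*
  A standard pair with rows a X z and z Y a is recorded by its core (X, Y). Removing a suffix of the
  core leaves the core of a standard pair on fewer letters, and every Rauzy path of the smaller pair
  lifts to the larger one because the suffix stays in front of z in the top row and in front of a in
  the bottom row; hence equivalent cores stay equivalent after appending a common suffix.

  Every nonempty core is equivalent to one that ends in an order reversing block: if the last letters
  s (top) and t (bottom) differ, write X = X1 t X2 s and Y = Y1 s Y2 t; unless X2 and Y2 are reverses
  of each other, a short path makes X2 and Y2 shorter. If the block has at least four letters and the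
  letters before it are not in the same order in both rows, one further path produces a core that
  ends in a block of two letters. By induction the part before the last block can be brought to one
  of the five types, so it remains to append a block of size 1, 2 or 3 to a list of blocks of known
  type. This is done by a rewriting system on lists of block sizes, whose rules come from explicit
  paths in which whole subwords are carried along passively.
*)
theory Submission
  imports Defs "HOL-Library.Multiset"
begin

text \<open>The obstacle is the left context. Common suffixes are harmless, but an explicit path
  also rotates the letters in front of the core, so a rule need not survive a prefix. Hence two
  strengths of equivalence: \<open>gconv\<close> (on lists \<open>\<approx>\<close>) allows every
  prefix, \<open>conv\<close> (on lists \<open>\<sim>\<close>) only those that end in a 1-block.
  This singles out the chains: a chain with the 1-block behind it can be exchanged with another one,
  and rules valid only at the left end apply again after each 1-block.

  The number 4 enters because a block of at least four letters is a double frame around a smaller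
  block, and one rule strips both frames. So block sizes matter modulo 4. 4-blocks commute with
  2-blocks and cancel in pairs, which leaves at most one in a word of 2- and 4-blocks; a 3-block
  behind them dissolves even that one, and two 3-blocks in one chain can be separated by a 1-block.
  The small lists \<open>[4, 2]\<close> and \<open>[5, 1, 2]\<close> are left as they are and
  account for Types 4 and 5.\<close>

section \<open>Rotations of words\<close>

text \<open>
  The rows of a pair are words \<open>(T, B)\<close>. An \<open>rz\<close> step is a power of a Rauzy move: the winner \<open>e\<close> ends one
  row and the letters to its right in the other row are rotated. Since arbitrary rotations are
  allowed, the relation is symmetric.
\<close>

inductive rz :: "'a list \<times> 'a list \<Rightarrow> 'a list \<times> 'a list \<Rightarrow> bool" where
  rz_top: "rz (P @ e # U @ V, Q @ [e]) (P @ e # V @ U, Q @ [e])"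
| rz_bot: "rz (Q @ [e], P @ e # U @ V) (Q @ [e], P @ e # V @ U)"

lemma rz_topI:
  assumes "T = P @ e # U @ V" and "B = Q @ [e]" and "rz\<^sup>*\<^sup>* (P @ e # V @ U, B) r"
  shows "rz\<^sup>*\<^sup>* (T, B) r"
  using assms rz_top converse_rtranclp_into_rtranclp by metis

lemma rz_botI:
  assumes "B = P @ e # U @ V" and "T = Q @ [e]" and "rz\<^sup>*\<^sup>* (T, P @ e # V @ U) r"
  shows "rz\<^sup>*\<^sup>* (T, B) r"
  using assms rz_bot converse_rtranclp_into_rtranclp by metis

lemma rz_sym: "rz p q \<Longrightarrow> rz q p"
  by (erule rz.cases) (auto intro: rz.intros)

lemma rz_rtranclp_sym: "rz\<^sup>*\<^sup>* p q \<Longrightarrow> rz\<^sup>*\<^sup>* q p"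
  by (metis rz_sym sympD sympI symp_rtranclp)

text \<open>A rotation changes only letters to the right of the winner, and the winner ends the
  other row. Whatever is put in front of the top row is carried along; the rows need not have the
  same letters for this.\<close>

lemma rz_top_prefix: "rz p q \<Longrightarrow> rz (K @ fst p, snd p) (K @ fst q, snd q)"
proof (induction rule: rz.induct)
  case (rz_top P e U V Q)
  then show ?case using rz.rz_top[of "K @ P" e U V Q] by simp
next
  case (rz_bot Q e P U V)
  then show ?case using rz.rz_bot[of "K @ Q" e P U V] by simp
qed

lemma rz_rtranclp_top_prefix:
  "rz\<^sup>*\<^sup>* p q \<Longrightarrow> rz\<^sup>*\<^sup>* (K @ fst p, snd p) (K @ fst q, snd q)"
  by (induction rule: rtranclp_induct) (auto dest: rz_top_prefix intro: rtranclp.rtrancl_into_rtrancl)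

text \<open>
  The words \<open>W\<close> and \<open>W'\<close> are arbitrary and unrelated, which makes equivalence of cores compatible with
  appending suffixes.
\<close>

definition ceq :: "'a list \<times> 'a list \<Rightarrow> 'a list \<times> 'a list \<Rightarrow> bool" where
  "ceq p q \<longleftrightarrow> (\<forall>a z W W'. rz\<^sup>*\<^sup>* (a # fst p @ W @ [z], z # snd p @ W' @ [a])
                                (a # fst q @ W @ [z], z # snd q @ W' @ [a]))"

lemma ceqI:
  assumes "\<And>a z W W'. rz\<^sup>*\<^sup>* (a # X @ W @ [z], z # Y @ W' @ [a]) (a # X' @ W @ [z], z # Y' @ W' @ [a])"
  shows "ceq (X, Y) (X', Y')"
  using assms by (simp add: ceq_def)

lemma ceq_refl: "ceq p p"
  by (simp add: ceq_def)

lemma ceq_sym: "ceq p q \<Longrightarrow> ceq q p"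
  by (simp add: ceq_def rz_rtranclp_sym)

lemma ceq_trans: "ceq p q \<Longrightarrow> ceq q r \<Longrightarrow> ceq p r"
  unfolding ceq_def by (meson rtranclp_trans)

lemma ceq_suffix: "ceq (X, Y) (X', Y') \<Longrightarrow> ceq (X @ U, Y @ V) (X' @ U, Y' @ V)"
  unfolding ceq_def by simp (metis append.assoc)

text \<open>A letter \<open>s\<close> that ends a common prefix of both rows can play the role of the first letter \<open>a\<close>.\<close>

lemma ceq_unit_prefix:
  assumes "ceq (X, Y) (X', Y')"
  shows "ceq (U @ s # X, V @ s # Y) (U @ s # X', V @ s # Y')"
proof (rule ceqI)
  fix a z W W'
  \<comment> \<open>\<open>s\<close> takes the place of \<open>a\<close>; the chosen
    \<open>W'\<close> hides \<open>a\<close> and \<open>V\<close> between \<open>Y\<close> and the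
    final \<open>s\<close>.\<close>
  have "rz\<^sup>*\<^sup>* (s # X @ W @ [z], z # Y @ (W' @ a # V) @ [s]) (s # X' @ W @ [z], z # Y' @ (W' @ a # V) @ [s])"
    using assms unfolding ceq_def fst_conv snd_conv by blast
  from rz_rtranclp_top_prefix[OF this, of "a # U"]
  have "rz\<^sup>*\<^sup>* (a # U @ s # X @ W @ [z], z # Y @ W' @ a # V @ [s]) (a # U @ s # X' @ W @ [z], z # Y' @ W' @ a # V @ [s])"
    by simp
  \<comment> \<open>The winner \<open>z\<close> starts the bottom row, so everything behind it
    rotates until \<open>s\<close> is last.\<close>
  moreover have "rz\<^sup>*\<^sup>* (a # U @ s # X @ W @ [z], z # V @ s # Y @ W' @ [a]) (a # U @ s # X @ W @ [z], z # Y @ W' @ a # V @ [s])" for X Y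
    by (rule rz_botI[of _ "[]" z "V @ [s]" "Y @ W' @ [a]" _ "a # U @ s # X @ W"]) simp_all
  ultimately show "rz\<^sup>*\<^sup>* (a # (U @ s # X) @ W @ [z], z # (V @ s # Y) @ W' @ [a])
      (a # (U @ s # X') @ W @ [z], z # (V @ s # Y') @ W' @ [a])"
    by (simp, meson rz_rtranclp_sym rtranclp_trans)
qed

section \<open>Explicit paths\<close>

text \<open>
  The paths were found by breadth-first search. Capital letters stand for words whose letters never
  win; a word and its primed companion are independent of each other.
\<close>

lemma ceq_unit_swap:
  "ceq (P @ x1 # Q @ [x2], P' @ x1 # Q' @ [x2])
    (Q @ x2 # P @ [x1], Q' @ x2 # P' @ [x1])"
proof (rule ceqI, simp only: append_Cons append_assoc append_Nil)
  fix a z W W'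
  show "rz\<^sup>*\<^sup>* (a # P @ x1 # Q @ x2 # W @ [z],
      z # P' @ x1 # Q' @ x2 # W' @ [a])
    (a # Q @ x2 # P @ x1 # W @ [z],
      z # Q' @ x2 # P' @ x1 # W' @ [a])"
    by (rule rz_botI[of _ "[]" z "P' @ [x1]" "Q' @ x2 # W' @ [a]" _ "a # P @ x1 # Q @ x2 # W"], simp, simp,
      rule rz_topI[of _ "a # P" x1 "Q @ [x2]" "W @ [z]" _ "z # Q' @ x2 # W' @ a # P'"], simp, simp,
      rule rz_botI[of _ "z # Q'" x2 "W' @ [a]" "P' @ [x1]" _ "a # P @ x1 # W @ z # Q"], simp, simp,
      rule rz_topI[of _ "[]" a "P @ x1 # W @ [z]" "Q @ [x2]" _ "z # Q' @ x2 # P' @ x1 # W'"], simp, simp, simp)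
qed

text \<open>The letters \<open>x2\<close> and \<open>x3\<close> have the same order in both rows, so
  the word inside the frame \<open>x1\<close>, \<open>x4\<close> is not reversed. The path makes
  \<open>x3\<close> the last letter on top; an exchange of units can then move \<open>Q\<close> and
  \<open>x3\<close> out of the frame.\<close>

lemma ceq_frame_swap:
  "ceq (A @ x1 # P @ x2 # Q @ x3 # R @ [x4], A' @ x4 # P' @ x2 # Q' @ x3 # R' @ [x1])
    (A @ x1 # P @ x2 # R @ x4 # Q @ [x3], A' @ x4 # Q' @ x3 # P' @ x2 # R' @ [x1])"
proof (rule ceqI, simp only: append_Cons append_assoc append_Nil)
  fix a z W W'
  show "rz\<^sup>*\<^sup>* (a # A @ x1 # P @ x2 # Q @ x3 # R @ x4 # W @ [z],
      z # A' @ x4 # P' @ x2 # Q' @ x3 # R' @ x1 # W' @ [a])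
    (a # A @ x1 # P @ x2 # R @ x4 # Q @ x3 # W @ [z],
      z # A' @ x4 # Q' @ x3 # P' @ x2 # R' @ x1 # W' @ [a])"
    by (rule rz_botI[of _ "[]" z "A' @ x4 # P' @ x2 # Q' @ x3 # R' @ [x1]" "W' @ [a]" _ "a # A @ x1 # P @ x2 # Q @ x3 # R @ x4 # W"], simp, simp,
      rule rz_topI[of _ "a # A" x1 "P @ x2 # Q @ x3 # R @ [x4]" "W @ [z]" _ "z # W' @ a # A' @ x4 # P' @ x2 # Q' @ x3 # R'"], simp, simp,
      rule rz_botI[of _ "z # W' @ a # A'" x4 "P' @ [x2]" "Q' @ x3 # R' @ [x1]" _ "a # A @ x1 # W @ z # P @ x2 # Q @ x3 # R"], simp, simp,
      rule rz_topI[of _ "a # A @ x1 # W @ z # P" x2 "Q @ [x3]" "R @ [x4]" _ "z # W' @ a # A' @ x4 # Q' @ x3 # R' @ x1 # P'"], simp, simp,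
      rule rz_botI[of _ "z # W' @ a # A' @ x4 # Q'" x3 "R' @ [x1]" "P' @ [x2]" _ "a # A @ x1 # W @ z # P @ x2 # R @ x4 # Q"], simp, simp,
      rule rz_topI[of _ "a # A" x1 "W @ [z]" "P @ x2 # R @ x4 # Q @ [x3]" _ "z # W' @ a # A' @ x4 # Q' @ x3 # P' @ x2 # R'"], simp, simp,
      rule rz_botI[of _ "[]" z "W' @ [a]" "A' @ x4 # Q' @ x3 # P' @ x2 # R' @ [x1]" _ "a # A @ x1 # P @ x2 # R @ x4 # Q @ x3 # W"], simp, simp, simp)
qed

text \<open>For \<open>M' = rev M\<close> the core ends in a reversed block, seen as two nested
  pairs around \<open>M\<close>. The inverted pair \<open>x1\<close>, \<open>x2\<close> on its left
  is what allows the path to break it up and to leave \<open>x6\<close>, \<open>x5\<close> as a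
  final 2-block.\<close>

lemma ceq_frame_block_ge4:
  "ceq (B @ x1 # F @ x2 # C @ x3 # x5 # M @ [x6, x4], B' @ x2 # F' @ x1 # C' @ x4 # x6 # M' @ [x5, x3])
    (B @ x1 # x4 # C @ x3 # F @ x2 # M @ [x6, x5], B' @ x2 # x3 # C' @ x4 # F' @ x1 # M' @ [x5, x6])"
proof (rule ceqI, simp only: append_Cons append_assoc append_Nil)
  fix a z W W'
  show "rz\<^sup>*\<^sup>* (a # B @ x1 # F @ x2 # C @ x3 # x5 # M @ x6 # x4 # W @ [z],
      z # B' @ x2 # F' @ x1 # C' @ x4 # x6 # M' @ x5 # x3 # W' @ [a])
    (a # B @ x1 # x4 # C @ x3 # F @ x2 # M @ x6 # x5 # W @ [z],
      z # B' @ x2 # x3 # C' @ x4 # F' @ x1 # M' @ x5 # x6 # W' @ [a])"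
    by (rule rz_topI[of _ "[]" a "B @ x1 # F @ [x2]" "C @ x3 # x5 # M @ x6 # x4 # W @ [z]" _ "z # B' @ x2 # F' @ x1 # C' @ x4 # x6 # M' @ x5 # x3 # W'"], simp, simp,
      rule rz_botI[of _ "z # B'" x2 "F' @ x1 # C' @ x4 # x6 # M' @ [x5]" "x3 # W' @ [a]" _ "a # C @ x3 # x5 # M @ x6 # x4 # W @ z # B @ x1 # F"], simp, simp,
      rule rz_topI[of _ "a # C @ [x3]" x5 "M @ x6 # x4 # W @ [z]" "B @ x1 # F @ [x2]" _ "z # B' @ x2 # x3 # W' @ a # F' @ x1 # C' @ x4 # x6 # M'"], simp, simp,
      rule rz_botI[of _ "[]" z "B' @ x2 # x3 # W' @ a # F' @ [x1]" "C' @ x4 # x6 # M' @ [x5]" _ "a # C @ x3 # x5 # B @ x1 # F @ x2 # M @ x6 # x4 # W"], simp, simp,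
      rule rz_topI[of _ "a # C @ x3 # x5 # B" x1 "F @ x2 # M @ [x6]" "x4 # W @ [z]" _ "z # C' @ x4 # x6 # M' @ x5 # B' @ x2 # x3 # W' @ a # F'"], simp, simp,
      rule rz_botI[of _ "z # C' @ [x4]" x6 "M' @ x5 # B' @ [x2, x3]" "W' @ a # F' @ [x1]" _ "a # C @ x3 # x5 # B @ x1 # x4 # W @ z # F @ x2 # M"], simp, simp,
      rule rz_topI[of _ "a # C" x3 "x5 # B @ x1 # x4 # W @ [z]" "F @ x2 # M @ [x6]" _ "z # C' @ x4 # x6 # W' @ a # F' @ x1 # M' @ x5 # B' @ [x2]"], simp, simp,
      rule rz_botI[of _ "[]" z "C' @ x4 # x6 # W' @ a # F' @ x1 # M' @ [x5]" "B' @ [x2, x3]" _ "a # C @ x3 # F @ x2 # M @ x6 # x5 # B @ x1 # x4 # W"], simp, simp,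
      rule rz_topI[of _ "a # C @ x3 # F @ x2 # M @ [x6]" x5 "B @ [x1, x4]" "W @ [z]" _ "z # B' @ x2 # x3 # C' @ x4 # x6 # W' @ a # F' @ x1 # M'"], simp, simp,
      rule rz_botI[of _ "z # B' @ x2 # x3 # C'" x4 "x6 # W' @ [a]" "F' @ x1 # M' @ [x5]" _ "a # C @ x3 # F @ x2 # M @ x6 # x5 # W @ z # B @ [x1]"], simp, simp,
      rule rz_topI[of _ "[]" a "C @ x3 # F @ x2 # M @ x6 # x5 # W @ [z]" "B @ [x1, x4]" _ "z # B' @ x2 # x3 # C' @ x4 # F' @ x1 # M' @ x5 # x6 # W'"], simp, simp, simp)
qed

lemma ceq_frame_block3:
  "ceq (D @ x1 # F @ x2 # C @ [x3, x4, x5], D' @ x2 # F' @ x1 # C' @ [x5, x4, x3])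
    (x5 # C @ x3 # F @ x2 # x4 # D @ [x1], x3 # C' @ x5 # F' @ x1 # x4 # D' @ [x2])"
proof (rule ceqI, simp only: append_Cons append_assoc append_Nil)
  fix a z W W'
  show "rz\<^sup>*\<^sup>* (a # D @ x1 # F @ x2 # C @ x3 # x4 # x5 # W @ [z],
      z # D' @ x2 # F' @ x1 # C' @ x5 # x4 # x3 # W' @ [a])
    (a # x5 # C @ x3 # F @ x2 # x4 # D @ x1 # W @ [z],
      z # x3 # C' @ x5 # F' @ x1 # x4 # D' @ x2 # W' @ [a])"
    by (rule rz_topI[of _ "[]" a "D @ [x1]" "F @ x2 # C @ x3 # x4 # x5 # W @ [z]" _ "z # D' @ x2 # F' @ x1 # C' @ x5 # x4 # x3 # W'"], simp, simp,
      rule rz_botI[of _ "z # D' @ x2 # F'" x1 "C' @ [x5]" "x4 # x3 # W' @ [a]" _ "a # F @ x2 # C @ x3 # x4 # x5 # W @ z # D"], simp, simp,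
      rule rz_topI[of _ "a # F @ x2 # C @ [x3, x4]" x5 "W @ [z]" "D @ [x1]" _ "z # D' @ x2 # F' @ x1 # x4 # x3 # W' @ a # C'"], simp, simp,
      rule rz_botI[of _ "[]" z "D' @ x2 # F' @ [x1, x4]" "x3 # W' @ a # C' @ [x5]" _ "a # F @ x2 # C @ x3 # x4 # x5 # D @ x1 # W"], simp, simp,
      rule rz_topI[of _ "a # F @ x2 # C @ [x3]" x4 "[x5]" "D @ x1 # W @ [z]" _ "z # x3 # W' @ a # C' @ x5 # D' @ x2 # F' @ [x1]"], simp, simp,
      rule rz_botI[of _ "z # x3 # W' @ a # C'" x5 "D' @ [x2]" "F' @ [x1, x4]" _ "a # F @ x2 # C @ x3 # x4 # D @ x1 # W @ [z]"], simp, simp,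
      rule rz_topI[of _ "a # F" x2 "C @ [x3]" "x4 # D @ x1 # W @ [z, x5]" _ "z # x3 # W' @ a # C' @ x5 # F' @ x1 # x4 # D'"], simp, simp,
      rule rz_botI[of _ "[z]" x3 "W' @ [a]" "C' @ x5 # F' @ x1 # x4 # D' @ [x2]" _ "a # F @ x2 # x4 # D @ x1 # W @ z # x5 # C"], simp, simp,
      rule rz_topI[of _ "[]" a "F @ x2 # x4 # D @ x1 # W @ [z]" "x5 # C @ [x3]" _ "z # x3 # C' @ x5 # F' @ x1 # x4 # D' @ x2 # W'"], simp, simp, simp)
qed

lemma ceq_two_frame_block3:
  "ceq (x1 # x2 # x3 # F @ x4 # C @ [x5, x6, x7], x2 # x1 # x4 # F' @ x3 # C' @ [x7, x6, x5])
    (x2 # x7 # C @ x5 # F @ [x4, x1, x6, x3], x4 # x2 # x5 # C' @ x7 # F' @ [x3, x6, x1])"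
proof (rule ceqI, simp only: append_Cons append_assoc append_Nil)
  fix a z W W'
  show "rz\<^sup>*\<^sup>* (a # x1 # x2 # x3 # F @ x4 # C @ x5 # x6 # x7 # W @ [z],
      z # x2 # x1 # x4 # F' @ x3 # C' @ x7 # x6 # x5 # W' @ [a])
    (a # x2 # x7 # C @ x5 # F @ x4 # x1 # x6 # x3 # W @ [z],
      z # x4 # x2 # x5 # C' @ x7 # F' @ x3 # x6 # x1 # W' @ [a])"
    by (rule rz_topI[of _ "[]" a "[x1, x2, x3]" "F @ x4 # C @ x5 # x6 # x7 # W @ [z]" _ "z # x2 # x1 # x4 # F' @ x3 # C' @ x7 # x6 # x5 # W'"], simp, simp,
      rule rz_botI[of _ "z # x2 # x1 # x4 # F'" x3 "C' @ [x7, x6]" "x5 # W' @ [a]" _ "a # F @ x4 # C @ x5 # x6 # x7 # W @ [z, x1, x2]"], simp, simp,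
      rule rz_topI[of _ "a # F @ x4 # C @ [x5]" x6 "x7 # W @ [z, x1, x2]" "[x3]" _ "z # x2 # x1 # x4 # F' @ x3 # x5 # W' @ a # C' @ [x7]"], simp, simp,
      rule rz_botI[of _ "[z]" x2 "x1 # x4 # F' @ [x3]" "x5 # W' @ a # C' @ [x7, x6]" _ "a # F @ x4 # C @ x5 # x6 # x3 # x7 # W @ [z, x1]"], simp, simp,
      rule rz_topI[of _ "a # F @ x4 # C @ [x5, x6]" x3 "[x7]" "W @ [z, x1, x2]" _ "z # x2 # x5 # W' @ a # C' @ x7 # x6 # x1 # x4 # F'"], simp, simp,
      rule rz_botI[of _ "z # x2 # x5 # W' @ a # C'" x7 "[x6, x1, x4]" "F' @ [x3]" _ "a # F @ x4 # C @ x5 # x6 # x3 # W @ [z, x1, x2]"], simp, simp,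
      rule rz_topI[of _ "a # F" x4 "C @ x5 # x6 # x3 # W @ [z]" "[x1, x2, x7]" _ "z # x2 # x5 # W' @ a # C' @ x7 # F' @ [x3, x6, x1]"], simp, simp,
      rule rz_botI[of _ "[]" z "x2 # x5 # W' @ a # C' @ x7 # F' @ [x3, x6, x1]" "[x4]" _ "a # F @ x4 # x1 # x2 # x7 # C @ x5 # x6 # x3 # W"], simp, simp,
      rule rz_topI[of _ "a # F @ [x4]" x1 "x2 # x7 # C @ [x5]" "x6 # x3 # W @ [z]" _ "z # x4 # x2 # x5 # W' @ a # C' @ x7 # F' @ [x3, x6]"], simp, simp,
      rule rz_botI[of _ "[z, x4, x2]" x5 "W' @ [a]" "C' @ x7 # F' @ [x3, x6, x1]" _ "a # F @ x4 # x1 # x6 # x3 # W @ z # x2 # x7 # C"], simp, simp,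
      rule rz_topI[of _ "[]" a "F @ x4 # x1 # x6 # x3 # W @ [z]" "x2 # x7 # C @ [x5]" _ "z # x4 # x2 # x5 # C' @ x7 # F' @ x3 # x6 # x1 # W'"], simp, simp, simp)
qed

lemma ceq_frame_one_two:
  "ceq (x1 # x3 # D @ [x4, x5, x2], x2 # x3 # D' @ [x5, x4, x1])
    (x5 # x1 # D @ [x4, x3, x2], x1 # D' @ [x5, x2, x3, x4])"
proof (rule ceqI, simp only: append_Cons append_assoc append_Nil)
  fix a z W W'
  show "rz\<^sup>*\<^sup>* (a # x1 # x3 # D @ x4 # x5 # x2 # W @ [z],
      z # x2 # x3 # D' @ x5 # x4 # x1 # W' @ [a])
    (a # x5 # x1 # D @ x4 # x3 # x2 # W @ [z],
      z # x1 # D' @ x5 # x2 # x3 # x4 # W' @ [a])"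
    by (rule rz_topI[of _ "[]" a "x1 # x3 # D @ [x4]" "x5 # x2 # W @ [z]" _ "z # x2 # x3 # D' @ x5 # x4 # x1 # W'"], simp, simp,
      rule rz_botI[of _ "z # x2 # x3 # D' @ [x5]" x4 "[x1]" "W' @ [a]" _ "a # x5 # x2 # W @ z # x1 # x3 # D"], simp, simp,
      rule rz_topI[of _ "a # x5 # x2 # W @ [z]" x1 "[x3]" "D @ [x4]" _ "z # x2 # x3 # D' @ x5 # x4 # W' @ [a]"], simp, simp,
      rule rz_botI[of _ "[z, x2]" x3 "D' @ [x5]" "x4 # W' @ [a, x1]" _ "a # x5 # x2 # W @ z # x1 # D @ [x4]"], simp, simp,
      rule rz_topI[of _ "[a]" x5 "x2 # W @ [z]" "x1 # D @ [x4, x3]" _ "z # x2 # x3 # x4 # W' @ a # x1 # D'"], simp, simp,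
      rule rz_botI[of _ "[]" z "x2 # x3 # x4 # W' @ [a]" "x1 # D' @ [x5]" _ "a # x5 # x1 # D @ x4 # x3 # x2 # W"], simp, simp, simp)
qed

lemma ceq_lhook_two:
  "ceq (x1 # A @ [x3, x4, x2], x2 # x1 # A' @ [x4, x3])
    (x2 # A @ [x3, x1, x4], x3 # x2 # A' @ [x4, x1])"
proof (rule ceqI, simp only: append_Cons append_assoc append_Nil)
  fix a z W W'
  show "rz\<^sup>*\<^sup>* (a # x1 # A @ x3 # x4 # x2 # W @ [z],
      z # x2 # x1 # A' @ x4 # x3 # W' @ [a])
    (a # x2 # A @ x3 # x1 # x4 # W @ [z],
      z # x3 # x2 # A' @ x4 # x1 # W' @ [a])"
    by (rule rz_botI[of _ "[]" z "x2 # x1 # A' @ [x4]" "x3 # W' @ [a]" _ "a # x1 # A @ x3 # x4 # x2 # W"], simp, simp,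
      rule rz_topI[of _ "a # x1 # A @ [x3]" x4 "[x2]" "W @ [z]" _ "z # x3 # W' @ a # x2 # x1 # A'"], simp, simp,
      rule rz_botI[of _ "z # x3 # W' @ [a]" x2 "[x1]" "A' @ [x4]" _ "a # x1 # A @ x3 # x4 # W @ [z]"], simp, simp,
      rule rz_topI[of _ "[a]" x1 "A @ [x3]" "x4 # W @ [z, x2]" _ "z # x3 # W' @ a # x2 # A' @ [x4]"], simp, simp,
      rule rz_botI[of _ "[z]" x3 "W' @ [a]" "x2 # A' @ [x4, x1]" _ "a # x1 # x4 # W @ z # x2 # A"], simp, simp,
      rule rz_topI[of _ "[]" a "x1 # x4 # W @ [z]" "x2 # A @ [x3]" _ "z # x3 # x2 # A' @ x4 # x1 # W'"], simp, simp, simp)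
qed

lemma ceq_rhook_two:
  "ceq (x2 # x1 # A @ [x3, x4], x1 # A' @ [x4, x3, x2])
    (x4 # x2 # A @ [x3, x1], x2 # A' @ [x4, x1, x3])"
proof (rule ceqI, simp only: append_Cons append_assoc append_Nil)
  fix a z W W'
  show "rz\<^sup>*\<^sup>* (a # x2 # x1 # A @ x3 # x4 # W @ [z],
      z # x1 # A' @ x4 # x3 # x2 # W' @ [a])
    (a # x4 # x2 # A @ x3 # x1 # W @ [z],
      z # x2 # A' @ x4 # x1 # x3 # W' @ [a])"
    by (rule rz_topI[of _ "[]" a "x2 # x1 # A @ [x3]" "x4 # W @ [z]" _ "z # x1 # A' @ x4 # x3 # x2 # W'"], simp, simp,
      rule rz_botI[of _ "z # x1 # A' @ [x4]" x3 "[x2]" "W' @ [a]" _ "a # x4 # W @ z # x2 # x1 # A"], simp, simp,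
      rule rz_topI[of _ "a # x4 # W @ [z]" x2 "[x1]" "A @ [x3]" _ "z # x1 # A' @ x4 # x3 # W' @ [a]"], simp, simp,
      rule rz_botI[of _ "[z]" x1 "A' @ [x4]" "x3 # W' @ [a, x2]" _ "a # x4 # W @ z # x2 # A @ [x3]"], simp, simp,
      rule rz_topI[of _ "[a]" x4 "W @ [z]" "x2 # A @ [x3, x1]" _ "z # x1 # x3 # W' @ a # x2 # A'"], simp, simp,
      rule rz_botI[of _ "[]" z "x1 # x3 # W' @ [a]" "x2 # A' @ [x4]" _ "a # x4 # x2 # A @ x3 # x1 # W"], simp, simp, simp)
qed

lemma ceq_frame_two_two:
  "ceq (B @ x1 # x3 # x4 # x5 # x6 # A @ [x2], B' @ x2 # x4 # x3 # x6 # x5 # A' @ [x1])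
    (B @ x1 # A @ [x2, x6, x5, x4, x3], B' @ x2 # A' @ [x1, x5, x6, x3, x4])"
proof (rule ceqI, simp only: append_Cons append_assoc append_Nil)
  fix a z W W'
  show "rz\<^sup>*\<^sup>* (a # B @ x1 # x3 # x4 # x5 # x6 # A @ x2 # W @ [z],
      z # B' @ x2 # x4 # x3 # x6 # x5 # A' @ x1 # W' @ [a])
    (a # B @ x1 # A @ x2 # x6 # x5 # x4 # x3 # W @ [z],
      z # B' @ x2 # A' @ x1 # x5 # x6 # x3 # x4 # W' @ [a])"
    by (rule rz_topI[of _ "[]" a "B @ [x1, x3]" "x4 # x5 # x6 # A @ x2 # W @ [z]" _ "z # B' @ x2 # x4 # x3 # x6 # x5 # A' @ x1 # W'"], simp, simp,
      rule rz_botI[of _ "z # B' @ [x2, x4]" x3 "[x6]" "x5 # A' @ x1 # W' @ [a]" _ "a # x4 # x5 # x6 # A @ x2 # W @ z # B @ [x1]"], simp, simp,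
      rule rz_topI[of _ "[a, x4, x5]" x6 "A @ [x2]" "W @ z # B @ [x1, x3]" _ "z # B' @ x2 # x4 # x3 # x5 # A' @ x1 # W' @ [a]"], simp, simp,
      rule rz_botI[of _ "z # B'" x2 "[x4, x3, x5]" "A' @ x1 # W' @ [a, x6]" _ "a # x4 # x5 # x6 # W @ z # B @ x1 # x3 # A"], simp, simp,
      rule rz_topI[of _ "[a, x4]" x5 "[x6]" "W @ z # B @ x1 # x3 # A @ [x2]" _ "z # B' @ x2 # A' @ x1 # W' @ [a, x6, x4, x3]"], simp, simp,
      rule rz_botI[of _ "z # B' @ x2 # A' @ x1 # W' @ [a]" x6 "[x4]" "[x3, x5]" _ "a # x4 # x5 # W @ z # B @ x1 # x3 # A @ [x2]"], simp, simp,
      rule rz_topI[of _ "[a]" x4 "x5 # W @ z # B @ [x1]" "x3 # A @ [x2, x6]" _ "z # B' @ x2 # A' @ x1 # W' @ [a, x6, x3, x5]"], simp, simp,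
      rule rz_botI[of _ "z # B' @ x2 # A'" x1 "W' @ [a, x6, x3]" "[x5, x4]" _ "a # x4 # x3 # A @ x2 # x6 # x5 # W @ z # B"], simp, simp,
      rule rz_topI[of _ "[a, x4]" x3 "A @ [x2, x6, x5]" "W @ z # B @ [x1]" _ "z # B' @ x2 # A' @ x1 # x5 # x4 # W' @ [a, x6]"], simp, simp,
      rule rz_botI[of _ "z # B' @ x2 # A' @ [x1]" x5 "x4 # W' @ [a]" "[x6, x3]" _ "a # x4 # x3 # W @ z # B @ x1 # A @ [x2, x6]"], simp, simp,
      rule rz_topI[of _ "[]" a "x4 # x3 # W @ [z]" "B @ x1 # A @ [x2, x6, x5]" _ "z # B' @ x2 # A' @ x1 # x5 # x6 # x3 # x4 # W'"], simp, simp, simp)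
qed

lemma ceq_frame_frame_one:
  "ceq (x1 # x3 # A @ [x4, x5, x2], x2 # x4 # A' @ [x3, x5, x1])
    (x2 # x5 # x1 # A @ [x4, x3], x1 # x5 # x2 # A' @ [x3, x4])"
proof (rule ceqI, simp only: append_Cons append_assoc append_Nil)
  fix a z W W'
  show "rz\<^sup>*\<^sup>* (a # x1 # x3 # A @ x4 # x5 # x2 # W @ [z],
      z # x2 # x4 # A' @ x3 # x5 # x1 # W' @ [a])
    (a # x2 # x5 # x1 # A @ x4 # x3 # W @ [z],
      z # x1 # x5 # x2 # A' @ x3 # x4 # W' @ [a])"
    by (rule rz_topI[of _ "[]" a "[x1, x3]" "A @ x4 # x5 # x2 # W @ [z]" _ "z # x2 # x4 # A' @ x3 # x5 # x1 # W'"], simp, simp,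
      rule rz_botI[of _ "z # x2 # x4 # A'" x3 "[x5]" "x1 # W' @ [a]" _ "a # A @ x4 # x5 # x2 # W @ [z, x1]"], simp, simp,
      rule rz_topI[of _ "a # A @ [x4]" x5 "x2 # W @ [z]" "[x1, x3]" _ "z # x2 # x4 # A' @ x3 # x1 # W' @ [a]"], simp, simp,
      rule rz_botI[of _ "[]" z "x2 # x4 # A' @ [x3]" "x1 # W' @ [a, x5]" _ "a # A @ x4 # x5 # x1 # x3 # x2 # W"], simp, simp,
      rule rz_topI[of _ "a # A @ [x4, x5, x1]" x3 "[x2]" "W @ [z]" _ "z # x1 # W' @ a # x5 # x2 # x4 # A'"], simp, simp,
      rule rz_botI[of _ "z # x1 # W' @ [a, x5]" x2 "[x4]" "A' @ [x3]" _ "a # A @ x4 # x5 # x1 # x3 # W @ [z]"], simp, simp,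
      rule rz_topI[of _ "a # A" x4 "[x5, x1]" "x3 # W @ [z, x2]" _ "z # x1 # W' @ a # x5 # x2 # A' @ [x3]"], simp, simp,
      rule rz_botI[of _ "[z]" x1 "W' @ [a]" "x5 # x2 # A' @ [x3, x4]" _ "a # A @ x4 # x3 # W @ [z, x2, x5]"], simp, simp,
      rule rz_topI[of _ "[]" a "A @ x4 # x3 # W @ [z]" "[x2, x5, x1]" _ "z # x1 # x5 # x2 # A' @ x3 # x4 # W'"], simp, simp, simp)
qed

lemma ceq_two_frame_frame_one:
  "ceq (x1 # x2 # x3 # x5 # A @ [x6, x7, x4], x2 # x1 # x4 # x6 # A' @ [x5, x7, x3])
    (x2 # x4 # x1 # x7 # x3 # A @ [x6, x5], x4 # x2 # x3 # x7 # x1 # A' @ [x5, x6])"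
proof (rule ceqI, simp only: append_Cons append_assoc append_Nil)
  fix a z W W'
  show "rz\<^sup>*\<^sup>* (a # x1 # x2 # x3 # x5 # A @ x6 # x7 # x4 # W @ [z],
      z # x2 # x1 # x4 # x6 # A' @ x5 # x7 # x3 # W' @ [a])
    (a # x2 # x4 # x1 # x7 # x3 # A @ x6 # x5 # W @ [z],
      z # x4 # x2 # x3 # x7 # x1 # A' @ x5 # x6 # W' @ [a])"
    by (rule rz_botI[of _ "[]" z "[x2, x1]" "x4 # x6 # A' @ x5 # x7 # x3 # W' @ [a]" _ "a # x1 # x2 # x3 # x5 # A @ x6 # x7 # x4 # W"], simp, simp,
      rule rz_topI[of _ "[a]" x1 "x2 # x3 # x5 # A @ [x6]" "x7 # x4 # W @ [z]" _ "z # x4 # x6 # A' @ x5 # x7 # x3 # W' @ [a, x2]"], simp, simp,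
      rule rz_botI[of _ "[z, x4]" x6 "A' @ [x5, x7, x3]" "W' @ [a, x2, x1]" _ "a # x1 # x7 # x4 # W @ z # x2 # x3 # x5 # A"], simp, simp,
      rule rz_topI[of _ "a # x1 # x7 # x4 # W @ [z, x2]" x3 "[x5]" "A @ [x6]" _ "z # x4 # x6 # W' @ a # x2 # x1 # A' @ [x5, x7]"], simp, simp,
      rule rz_botI[of _ "z # x4 # x6 # W' @ a # x2 # x1 # A'" x5 "[x7]" "[x3]" _ "a # x1 # x7 # x4 # W @ z # x2 # x3 # A @ [x6]"], simp, simp,
      rule rz_topI[of _ "[a, x1]" x7 "x4 # W @ [z, x2]" "x3 # A @ [x6, x5]" _ "z # x4 # x6 # W' @ a # x2 # x1 # A' @ [x5, x3]"], simp, simp,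
      rule rz_botI[of _ "z # x4 # x6 # W' @ [a]" x2 "x1 # A' @ [x5]" "[x3, x7]" _ "a # x1 # x7 # x3 # A @ x6 # x5 # x4 # W @ [z]"], simp, simp,
      rule rz_topI[of _ "a # x1 # x7 # x3 # A @ [x6]" x5 "[x4]" "W @ [z, x2]" _ "z # x4 # x6 # W' @ a # x2 # x3 # x7 # x1 # A'"], simp, simp,
      rule rz_botI[of _ "[z]" x4 "x6 # W' @ [a]" "x2 # x3 # x7 # x1 # A' @ [x5]" _ "a # x1 # x7 # x3 # A @ x6 # x5 # W @ [z, x2]"], simp, simp,
      rule rz_topI[of _ "[]" a "x1 # x7 # x3 # A @ x6 # x5 # W @ [z]" "[x2, x4]" _ "z # x4 # x2 # x3 # x7 # x1 # A' @ x5 # x6 # W'"], simp, simp, simp)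
qed

lemma ceq_two_two_frame_frame_one:
  "ceq (B @ x1 # x2 # x3 # x4 # x5 # x7 # A @ [x8, x9, x6], B' @ x2 # x1 # x4 # x3 # x6 # x8 # A' @ [x7, x9, x5])
    (B @ x1 # x4 # x3 # x2 # x5 # x9 # x6 # A @ [x8, x7], B' @ x2 # x3 # x4 # x1 # x6 # x9 # x5 # A' @ [x7, x8])"
proof (rule ceqI, simp only: append_Cons append_assoc append_Nil)
  fix a z W W'
  show "rz\<^sup>*\<^sup>* (a # B @ x1 # x2 # x3 # x4 # x5 # x7 # A @ x8 # x9 # x6 # W @ [z],
      z # B' @ x2 # x1 # x4 # x3 # x6 # x8 # A' @ x7 # x9 # x5 # W' @ [a])
    (a # B @ x1 # x4 # x3 # x2 # x5 # x9 # x6 # A @ x8 # x7 # W @ [z],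
      z # B' @ x2 # x3 # x4 # x1 # x6 # x9 # x5 # A' @ x7 # x8 # W' @ [a])"
    by (rule rz_topI[of _ "[]" a "B @ [x1, x2]" "x3 # x4 # x5 # x7 # A @ x8 # x9 # x6 # W @ [z]" _ "z # B' @ x2 # x1 # x4 # x3 # x6 # x8 # A' @ x7 # x9 # x5 # W'"], simp, simp,
      rule rz_botI[of _ "z # B'" x2 "[x1, x4]" "x3 # x6 # x8 # A' @ x7 # x9 # x5 # W' @ [a]" _ "a # x3 # x4 # x5 # x7 # A @ x8 # x9 # x6 # W @ z # B @ [x1]"], simp, simp,
      rule rz_topI[of _ "[a, x3]" x4 "[x5, x7]" "A @ x8 # x9 # x6 # W @ z # B @ [x1, x2]" _ "z # B' @ x2 # x3 # x6 # x8 # A' @ x7 # x9 # x5 # W' @ [a, x1]"], simp, simp,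
      rule rz_botI[of _ "z # B' @ x2 # x3 # x6 # x8 # A'" x7 "x9 # x5 # W' @ [a]" "[x1, x4]" _ "a # x3 # x4 # A @ x8 # x9 # x6 # W @ z # B @ [x1, x2, x5]"], simp, simp,
      rule rz_topI[of _ "[]" a "x3 # x4 # A @ x8 # x9 # x6 # W @ z # B @ [x1]" "[x2, x5, x7]" _ "z # B' @ x2 # x3 # x6 # x8 # A' @ x7 # x1 # x4 # x9 # x5 # W'"], simp, simp,
      rule rz_botI[of _ "z # B' @ x2 # x3 # x6 # x8 # A' @ [x7]" x1 "[x4, x9, x5]" "W' @ [a]" _ "a # x2 # x5 # x7 # x3 # x4 # A @ x8 # x9 # x6 # W @ z # B"], simp, simp,
      rule rz_topI[of _ "[a, x2]" x5 "x7 # x3 # x4 # A @ [x8]" "x9 # x6 # W @ z # B @ [x1]" _ "z # B' @ x2 # x3 # x6 # x8 # A' @ x7 # x1 # W' @ [a, x4, x9]"], simp, simp,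
      rule rz_botI[of _ "z # B' @ [x2, x3, x6]" x8 "A' @ [x7, x1]" "W' @ [a, x4, x9, x5]" _ "a # x2 # x5 # x9 # x6 # W @ z # B @ x1 # x7 # x3 # x4 # A"], simp, simp,
      rule rz_topI[of _ "a # x2 # x5 # x9 # x6 # W @ z # B" x1 "[x7, x3]" "x4 # A @ [x8]" _ "z # B' @ x2 # x3 # x6 # x8 # W' @ a # x4 # x9 # x5 # A' @ [x7]"], simp, simp,
      rule rz_botI[of _ "z # B' @ [x2]" x3 "x6 # x8 # W' @ [a]" "x4 # x9 # x5 # A' @ [x7, x1]" _ "a # x2 # x5 # x9 # x6 # W @ z # B @ x1 # x4 # A @ [x8, x7]"], simp, simp,
      rule rz_topI[of _ "[]" a "x2 # x5 # x9 # x6 # W @ z # B @ x1 # x4 # A @ [x8, x7]" "[x3]" _ "z # B' @ x2 # x3 # x4 # x9 # x5 # A' @ x7 # x1 # x6 # x8 # W'"], simp, simp,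
      rule rz_botI[of _ "z # B' @ x2 # x3 # x4 # x9 # x5 # A'" x7 "[x1, x6]" "x8 # W' @ [a]" _ "a # x3 # x2 # x5 # x9 # x6 # W @ z # B @ x1 # x4 # A @ [x8]"], simp, simp,
      rule rz_topI[of _ "[a, x3, x2, x5, x9]" x6 "W @ z # B @ [x1, x4]" "A @ [x8, x7]" _ "z # B' @ x2 # x3 # x4 # x9 # x5 # A' @ x7 # x8 # W' @ [a, x1]"], simp, simp,
      rule rz_botI[of _ "z # B' @ [x2, x3]" x4 "x9 # x5 # A' @ x7 # x8 # W' @ [a]" "[x1, x6]" _ "a # x3 # x2 # x5 # x9 # x6 # A @ x8 # x7 # W @ z # B @ [x1]"], simp, simp,
      rule rz_topI[of _ "[]" a "x3 # x2 # x5 # x9 # x6 # A @ x8 # x7 # W @ [z]" "B @ [x1, x4]" _ "z # B' @ x2 # x3 # x4 # x1 # x6 # x9 # x5 # A' @ x7 # x8 # W'"], simp, simp, simp)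
qed

lemma ceq_frame_three_two:
  "ceq (B @ [x1, x3, x4, x5, x6, x7, x2], B' @ [x2, x5, x4, x3, x7, x6, x1])
    (B @ [x1, x2, x7, x6, x4, x5, x3], B' @ [x2, x1, x6, x7, x4, x3, x5])"
proof (rule ceqI, simp only: append_Cons append_assoc append_Nil)
  fix a z W W'
  show "rz\<^sup>*\<^sup>* (a # B @ x1 # x3 # x4 # x5 # x6 # x7 # x2 # W @ [z],
      z # B' @ x2 # x5 # x4 # x3 # x7 # x6 # x1 # W' @ [a])
    (a # B @ x1 # x2 # x7 # x6 # x4 # x5 # x3 # W @ [z],
      z # B' @ x2 # x1 # x6 # x7 # x4 # x3 # x5 # W' @ [a])"
    by (rule rz_topI[of _ "[]" a "B @ [x1, x3]" "x4 # x5 # x6 # x7 # x2 # W @ [z]" _ "z # B' @ x2 # x5 # x4 # x3 # x7 # x6 # x1 # W'"], simp, simp,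
      rule rz_botI[of _ "z # B' @ [x2, x5, x4]" x3 "[x7]" "x6 # x1 # W' @ [a]" _ "a # x4 # x5 # x6 # x7 # x2 # W @ z # B @ [x1]"], simp, simp,
      rule rz_topI[of _ "[a, x4, x5, x6]" x7 "[x2]" "W @ z # B @ [x1, x3]" _ "z # B' @ x2 # x5 # x4 # x3 # x6 # x1 # W' @ [a]"], simp, simp,
      rule rz_botI[of _ "z # B'" x2 "[x5, x4, x3, x6]" "x1 # W' @ [a, x7]" _ "a # x4 # x5 # x6 # x7 # W @ z # B @ [x1, x3]"], simp, simp,
      rule rz_topI[of _ "[a, x4, x5]" x6 "[x7]" "W @ z # B @ [x1, x3, x2]" _ "z # B' @ x2 # x1 # W' @ [a, x7, x5, x4, x3]"], simp, simp,
      rule rz_botI[of _ "z # B' @ x2 # x1 # W' @ [a]" x7 "[x5]" "[x4, x3, x6]" _ "a # x4 # x5 # x6 # W @ z # B @ [x1, x3, x2]"], simp, simp,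
      rule rz_topI[of _ "[a, x4]" x5 "x6 # W @ z # B @ [x1]" "[x3, x2, x7]" _ "z # B' @ x2 # x1 # W' @ [a, x7, x4, x3, x6]"], simp, simp,
      rule rz_botI[of _ "z # B' @ [x2]" x1 "W' @ [a, x7, x4, x3]" "[x6, x5]" _ "a # x4 # x5 # x3 # x2 # x7 # x6 # W @ z # B"], simp, simp,
      rule rz_topI[of _ "[a, x4, x5]" x3 "[x2, x7, x6]" "W @ z # B @ [x1]" _ "z # B' @ x2 # x1 # x6 # x5 # W' @ [a, x7, x4]"], simp, simp,
      rule rz_botI[of _ "z # B' @ [x2, x1]" x6 "x5 # W' @ [a]" "[x7, x4, x3]" _ "a # x4 # x5 # x3 # W @ z # B @ [x1, x2, x7]"], simp, simp,
      rule rz_topI[of _ "[]" a "x4 # x5 # x3 # W @ [z]" "B @ [x1, x2, x7, x6]" _ "z # B' @ x2 # x1 # x6 # x7 # x4 # x3 # x5 # W'"], simp, simp, simp)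
qed

lemma ceq_frame_one_shift:
  "ceq (x1 # A @ [x3, x2, x4, x5], x2 # A' @ [x3, x1, x5, x4])
    (x2 # x5 # x4 # A @ [x3, x1], x1 # x4 # x5 # A' @ [x3, x2])"
proof (rule ceqI, simp only: append_Cons append_assoc append_Nil)
  fix a z W W'
  show "rz\<^sup>*\<^sup>* (a # x1 # A @ x3 # x2 # x4 # x5 # W @ [z],
      z # x2 # A' @ x3 # x1 # x5 # x4 # W' @ [a])
    (a # x2 # x5 # x4 # A @ x3 # x1 # W @ [z],
      z # x1 # x4 # x5 # A' @ x3 # x2 # W' @ [a])"
    by (rule rz_topI[of _ "[]" a "[x1]" "A @ x3 # x2 # x4 # x5 # W @ [z]" _ "z # x2 # A' @ x3 # x1 # x5 # x4 # W'"], simp, simp,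
      rule rz_botI[of _ "z # x2 # A' @ [x3]" x1 "[x5]" "x4 # W' @ [a]" _ "a # A @ x3 # x2 # x4 # x5 # W @ [z]"], simp, simp,
      rule rz_topI[of _ "a # A @ [x3, x2, x4]" x5 "W @ [z]" "[x1]" _ "z # x2 # A' @ x3 # x1 # x4 # W' @ [a]"], simp, simp,
      rule rz_botI[of _ "[]" z "x2 # A' @ [x3]" "x1 # x4 # W' @ [a, x5]" _ "a # A @ x3 # x2 # x4 # x5 # x1 # W"], simp, simp,
      rule rz_topI[of _ "a # A" x3 "[x2, x4, x5]" "x1 # W @ [z]" _ "z # x1 # x4 # W' @ a # x5 # x2 # A'"], simp, simp,
      rule rz_botI[of _ "z # x1 # x4 # W' @ [a]" x5 "[x2]" "A' @ [x3]" _ "a # A @ x3 # x1 # W @ [z, x2, x4]"], simp, simp,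
      rule rz_topI[of _ "a # A @ x3 # x1 # W @ [z]" x2 "[x4]" "[x5]" _ "z # x1 # x4 # W' @ a # x5 # A' @ [x3]"], simp, simp,
      rule rz_botI[of _ "[z, x1]" x4 "W' @ [a]" "x5 # A' @ [x3, x2]" _ "a # A @ x3 # x1 # W @ [z, x2, x5]"], simp, simp,
      rule rz_topI[of _ "[]" a "A @ x3 # x1 # W @ [z]" "[x2, x5, x4]" _ "z # x1 # x4 # x5 # A' @ x3 # x2 # W'"], simp, simp, simp)
qed

lemma ceq_frame_one_two_shift:
  "ceq (x1 # A @ [x3, x4, x5, x2, x6, x7], x2 # A' @ [x3, x5, x4, x1, x7, x6])
    (x2 # x7 # x6 # A @ [x3, x5, x1, x4], x4 # x6 # x7 # A' @ [x3, x1, x5, x2])"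
proof (rule ceqI, simp only: append_Cons append_assoc append_Nil)
  fix a z W W'
  show "rz\<^sup>*\<^sup>* (a # x1 # A @ x3 # x4 # x5 # x2 # x6 # x7 # W @ [z],
      z # x2 # A' @ x3 # x5 # x4 # x1 # x7 # x6 # W' @ [a])
    (a # x2 # x7 # x6 # A @ x3 # x5 # x1 # x4 # W @ [z],
      z # x4 # x6 # x7 # A' @ x3 # x1 # x5 # x2 # W' @ [a])"
    by (rule rz_topI[of _ "[]" a "x1 # A @ [x3, x4]" "x5 # x2 # x6 # x7 # W @ [z]" _ "z # x2 # A' @ x3 # x5 # x4 # x1 # x7 # x6 # W'"], simp, simp,
      rule rz_botI[of _ "z # x2 # A' @ [x3, x5]" x4 "[x1, x7]" "x6 # W' @ [a]" _ "a # x5 # x2 # x6 # x7 # W @ z # x1 # A @ [x3]"], simp, simp,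
      rule rz_topI[of _ "[a, x5, x2, x6]" x7 "W @ [z]" "x1 # A @ [x3, x4]" _ "z # x2 # A' @ x3 # x5 # x4 # x6 # W' @ [a, x1]"], simp, simp,
      rule rz_botI[of _ "[]" z "x2 # A' @ [x3, x5]" "x4 # x6 # W' @ [a, x1, x7]" _ "a # x5 # x2 # x6 # x7 # x1 # A @ x3 # x4 # W"], simp, simp,
      rule rz_topI[of _ "[a]" x5 "[x2, x6, x7]" "x1 # A @ x3 # x4 # W @ [z]" _ "z # x4 # x6 # W' @ a # x1 # x7 # x2 # A' @ [x3]"], simp, simp,
      rule rz_botI[of _ "z # x4 # x6 # W' @ [a, x1]" x7 "[x2]" "A' @ [x3, x5]" _ "a # x5 # x1 # A @ x3 # x4 # W @ [z, x2, x6]"], simp, simp,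
      rule rz_topI[of _ "a # x5 # x1 # A @ x3 # x4 # W @ [z]" x2 "[x6]" "[x7]" _ "z # x4 # x6 # W' @ a # x1 # x7 # A' @ [x3, x5]"], simp, simp,
      rule rz_botI[of _ "[z, x4]" x6 "W' @ [a, x1]" "x7 # A' @ [x3, x5, x2]" _ "a # x5 # x1 # A @ x3 # x4 # W @ [z, x2, x7]"], simp, simp,
      rule rz_topI[of _ "[a, x5]" x1 "A @ [x3]" "x4 # W @ [z, x2, x7, x6]" _ "z # x4 # x6 # x7 # A' @ x3 # x5 # x2 # W' @ [a]"], simp, simp,
      rule rz_botI[of _ "z # x4 # x6 # x7 # A'" x3 "x5 # x2 # W' @ [a]" "[x1]" _ "a # x5 # x1 # x4 # W @ z # x2 # x7 # x6 # A"], simp, simp,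
      rule rz_topI[of _ "[]" a "x5 # x1 # x4 # W @ [z]" "x2 # x7 # x6 # A @ [x3]" _ "z # x4 # x6 # x7 # A' @ x3 # x1 # x5 # x2 # W'"], simp, simp, simp)
qed

section \<open>Shapes of cores\<close>

type_synonym 'a shape = "('a list \<times> 'a list) set"

definition osum :: "'a shape \<Rightarrow> 'a shape \<Rightarrow> 'a shape" (infixr "\<oplus>" 65) where
  "S \<oplus> T = {(X @ X', Y @ Y') | X Y X' Y'. (X, Y) \<in> S \<and> (X', Y') \<in> T}"

definition blk :: "nat \<Rightarrow> 'a shape" where
  "blk k = {(X, rev X) | X. length X = k}"

text \<open>A frame around a composite word is in general not a list of blocks. Frames and hooks
  describe the cores that occur in the middle of a derivation.\<close>

definition frame :: "'a shape \<Rightarrow> 'a shape" where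
  "frame S = {(t # X @ [s], s # Y @ [t]) | t s X Y. (X, Y) \<in> S}"

text \<open>Both kinds of hook arise in front of a 3-block. A hook around the empty core is a
  2-block, and 2-blocks can leave a hook one at a time, so hooks around 2-blocks disappear
  again.\<close>

definition lhook :: "'a shape \<Rightarrow> 'a shape" where
  "lhook S = {(c # X @ [t], t # c # Y) | c t X Y. (X, Y) \<in> S}"

definition rhook :: "'a shape \<Rightarrow> 'a shape" where
  "rhook S = {(c # t # X, t # Y @ [c]) | c t X Y. (X, Y) \<in> S}"

lemma osum_assoc: "(S \<oplus> T) \<oplus> U = S \<oplus> T \<oplus> U"
proof (rule set_eqI, rule iffI)
  fix p assume "p \<in> (S \<oplus> T) \<oplus> U"
  then obtain X Y X' Y' X'' Y'' where "p = (X @ X' @ X'', Y @ Y' @ Y'')" "(X, Y) \<in> S" "(X', Y') \<in> T" "(X'', Y'') \<in> U"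
    by (auto simp: osum_def)
  then show "p \<in> S \<oplus> T \<oplus> U"
    unfolding osum_def by blast
next
  fix p assume "p \<in> S \<oplus> T \<oplus> U"
  then obtain X Y X' Y' X'' Y'' where "p = ((X @ X') @ X'', (Y @ Y') @ Y'')" "(X, Y) \<in> S" "(X', Y') \<in> T" "(X'', Y'') \<in> U"
    by (auto simp: osum_def)
  then show "p \<in> (S \<oplus> T) \<oplus> U"
    unfolding osum_def by blast
qed

lemma mem_osum: "p \<in> S \<oplus> T \<longleftrightarrow> (\<exists>X Y X' Y'. p = (X @ X', Y @ Y') \<and> (X, Y) \<in> S \<and> (X', Y') \<in> T)"
  by (auto simp: osum_def)

lemma mem_frame: "p \<in> frame S \<longleftrightarrow> (\<exists>t s X Y. p = (t # X @ [s], s # Y @ [t]) \<and> (X, Y) \<in> S)"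
  by (auto simp: frame_def)

lemma mem_lhook: "p \<in> lhook S \<longleftrightarrow> (\<exists>c t X Y. p = (c # X @ [t], t # c # Y) \<and> (X, Y) \<in> S)"
  by (auto simp: lhook_def)

lemma mem_rhook: "p \<in> rhook S \<longleftrightarrow> (\<exists>c t X Y. p = (c # t # X, t # Y @ [c]) \<and> (X, Y) \<in> S)"
  by (auto simp: rhook_def)

lemma blk_0: "blk 0 = {([], [])}"
  by (auto simp: blk_def)

lemma blk_Suc_0: "blk (Suc 0) = {([s], [s]) | s. True}"
  by (auto simp: blk_def length_Suc_conv)

lemma blk_add_2: "blk (k + 2) = frame (blk k)"
proof (intro set_eqI iffI)
  fix p :: "'a list \<times> 'a list"
  assume "p \<in> blk (k + 2)"
  then obtain Z where Z: "p = (Z, rev Z)" "length Z = k + 2"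
    by (auto simp: blk_def)
  then obtain t Z' where "Z = t # Z'" "length Z' = Suc k"
    by (cases Z) auto
  moreover from this obtain X s where "Z' = X @ [s]" "length X = k"
    by (cases Z' rule: rev_cases) auto
  ultimately show "p \<in> frame (blk k)"
    using Z by (auto simp: blk_def frame_def)
qed (auto simp: blk_def frame_def)

lemma blk_2: "blk 2 = frame (blk 0)"
  by (metis add_0 blk_add_2)

lemma blk_3: "blk 3 = frame (blk 1)"
proof -
  have "(3::nat) = 1 + 2" by simp
  then show ?thesis
    using blk_add_2 by metis
qed

lemma osum_blk_0 [simp]: "blk 0 \<oplus> S = S" "S \<oplus> blk 0 = S"
  by (auto simp: osum_def blk_0)

lemma mem_blk_0: "p \<in> blk 0 \<longleftrightarrow> p = ([], [])"
  by (simp add: blk_0)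

lemma mem_blk_1: "p \<in> blk (Suc 0) \<longleftrightarrow> (\<exists>s. p = ([s], [s]))"
  by (simp add: blk_Suc_0)

lemmas mem_shape = mem_osum mem_frame mem_lhook mem_rhook mem_blk_0 mem_blk_1

lemma osumI: "(X, Y) \<in> S \<Longrightarrow> (X', Y') \<in> T \<Longrightarrow> (X @ X', Y @ Y') \<in> S \<oplus> T"
  by (auto simp: osum_def)

lemma frameI: "(X, Y) \<in> S \<Longrightarrow> (t # X @ [s], s # Y @ [t]) \<in> frame S"
  by (auto simp: frame_def)

lemma lhookI: "(X, Y) \<in> S \<Longrightarrow> (c # X @ [t], t # c # Y) \<in> lhook S"
  by (auto simp: lhook_def)

lemma rhookI: "(X, Y) \<in> S \<Longrightarrow> (c # t # X, t # Y @ [c]) \<in> rhook S"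
  by (auto simp: rhook_def)

lemma blk_0I: "([], []) \<in> blk 0"
  by (simp add: blk_0)

lemma blk_1I: "([s], [s]) \<in> blk (Suc 0)"
  by (simp add: blk_Suc_0)

lemmas shape_intros = osumI frameI lhookI rhookI blk_0I blk_1I
text \<open>A shape does not fix its letters, so each core only needs some equivalent core of the
  other shape. Demanding this in both directions makes the relation symmetric.\<close>

definition conv :: "'a shape \<Rightarrow> 'a shape \<Rightarrow> bool" where
  "conv S T \<longleftrightarrow> (\<forall>p\<in>S. \<exists>q\<in>T. ceq p q) \<and> (\<forall>q\<in>T. \<exists>p\<in>S. ceq q p)"

lemma conv_refl: "conv S S"
  unfolding conv_def using ceq_refl by blast

lemma conv_sym: "conv S T \<Longrightarrow> conv T S"
  unfolding conv_def by blast

lemma conv_trans [trans]: "conv S T \<Longrightarrow> conv T U \<Longrightarrow> conv S U"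
  unfolding conv_def using ceq_trans by meson

lemma conv_osum: "conv S T \<Longrightarrow> conv (S \<oplus> U) (T \<oplus> U)"
proof -
  have *: "\<exists>q\<in>T \<oplus> U. ceq p q" if ST: "\<forall>p\<in>S. \<exists>q\<in>T. ceq p q" and "p \<in> S \<oplus> U" for S T p
  proof -
    from that obtain X Y A B where p: "p = (X @ A, Y @ B)" "(X, Y) \<in> S" "(A, B) \<in> U"
      by (auto simp: mem_osum)
    from ST p obtain X' Y' where q: "(X', Y') \<in> T" "ceq (X, Y) (X', Y')"
      by (metis surj_pair)
    with p have "(X' @ A, Y' @ B) \<in> T \<oplus> U"
      by (auto simp: mem_osum)
    with p ceq_suffix[OF q(2)] show ?thesis by blast
  qed
  assume "conv S T"
  then show ?thesis
    unfolding conv_def using *[of S T] *[of T S] by simp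
qed

lemma conv_unit_prefix:
  assumes "conv S T"
  shows "conv (U \<oplus> blk 1 \<oplus> S) (U \<oplus> blk 1 \<oplus> T)"
proof -
  have *: "\<exists>q\<in>U \<oplus> blk 1 \<oplus> T. ceq p q"
    if ST: "\<forall>p\<in>S. \<exists>q\<in>T. ceq p q" and "p \<in> U \<oplus> blk 1 \<oplus> S" for S T p
  proof -
    from that obtain A B s X Y where p: "p = (A @ s # X, B @ s # Y)" "(A, B) \<in> U" "(X, Y) \<in> S"
      by (auto simp: mem_osum blk_Suc_0)
    from ST p obtain X' Y' where q: "(X', Y') \<in> T" "ceq (X, Y) (X', Y')"
      by (metis surj_pair)
    then have "(A @ s # X', B @ s # Y') \<in> U \<oplus> blk 1 \<oplus> T"
      using osumI[OF p(2) osumI[OF blk_1I q(1)]] by simp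
    with p ceq_unit_prefix[OF q(2)] show ?thesis by blast
  qed
  show ?thesis
    using assms *[of S T] *[of T S] unfolding conv_def by simp
qed

text \<open>Only some of the equivalences survive an arbitrary prefix; \<open>conv\<close> tolerates just prefixes ending in a 1-block.\<close>

definition gconv :: "'a shape \<Rightarrow> 'a shape \<Rightarrow> bool" where
  "gconv S T \<longleftrightarrow> (\<forall>B. conv (B \<oplus> S) (B \<oplus> T))"

lemma gconv_refl: "gconv S S"
  by (simp add: gconv_def conv_refl)

lemma gconv_sym: "gconv S T \<Longrightarrow> gconv T S"
  by (simp add: gconv_def conv_sym)

lemma gconv_trans [trans]: "gconv S T \<Longrightarrow> gconv T U \<Longrightarrow> gconv S U"
  unfolding gconv_def using conv_trans by blast

lemma gconv_conv: "gconv S T \<Longrightarrow> conv S T"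
  unfolding gconv_def by (metis osum_blk_0(1))

lemma gconv_osum: "gconv S T \<Longrightarrow> gconv (A \<oplus> S \<oplus> C) (A \<oplus> T \<oplus> C)"
  unfolding gconv_def using conv_osum by (metis osum_assoc)

lemma convI:
  assumes "\<And>p. p \<in> S \<Longrightarrow> \<exists>q\<in>T. ceq p q" and "\<And>q. q \<in> T \<Longrightarrow> \<exists>p\<in>S. ceq q p"
  shows "conv S T"
  using assms by (auto simp: conv_def)

text \<open>The membership premise comes first: solving it by \<open>shape_intros\<close> builds the
  schematic core, and only then is the path matched against it.\<close>

lemma ceq_witness: "q \<in> T \<Longrightarrow> ceq p q \<Longrightarrow> \<exists>q\<in>T. ceq p q"
  by blast

lemma ceq_witness': "q \<in> T \<Longrightarrow> ceq q p \<Longrightarrow> \<exists>q\<in>T. ceq p q"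
  using ceq_sym by blast

section \<open>Equivalences of shapes read off from the explicit paths\<close>

lemma conv_unit_swap:
  "conv ((A \<oplus> blk 1) \<oplus> (B \<oplus> blk 1)) ((B \<oplus> blk 1) \<oplus> (A \<oplus> blk 1))"
  unfolding blk_2 blk_3
  apply (rule convI)
   apply (clarsimp simp: mem_shape)
   apply (rule ceq_witness, (unfold One_nat_def)?, (assumption | rule shape_intros)+, (simp only: append_assoc append_Cons append_Nil)?, rule ceq_unit_swap)
  apply (clarsimp simp: mem_shape)
  apply (rule ceq_witness', (unfold One_nat_def)?, (assumption | rule shape_intros)+, (simp only: append_assoc append_Cons append_Nil)?, rule ceq_unit_swap)
  done

lemma gconv_frame_block_ge4:
  "gconv (frame F \<oplus> C \<oplus> frame (frame M)) (frame (frame C \<oplus> F) \<oplus> M \<oplus> blk 2)"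
  \<comment> \<open>Blocks of size 2 and 3 are written as frames so that \<open>mem_shape\<close>
    exposes their letters.\<close>
  unfolding gconv_def blk_2 blk_3
  apply (intro allI)
  apply (rule convI)
   apply (clarsimp simp: mem_shape)
   apply (rule ceq_witness, (unfold One_nat_def)?, (assumption | rule shape_intros)+, (simp only: append_assoc append_Cons append_Nil)?, rule ceq_frame_block_ge4)
  apply (clarsimp simp: mem_shape)
  apply (rule ceq_witness', (unfold One_nat_def)?, (assumption | rule shape_intros)+, (simp only: append_assoc append_Cons append_Nil)?, rule ceq_frame_block_ge4)
  done

text \<open>For empty \<open>D\<close> the last summand is again a 3-block, so a final 3-block can
  be used repeatedly. For \<open>F = blk 1\<close> a 1-block is set free.\<close>

lemma conv_frame_block3:
  "conv (D \<oplus> frame F \<oplus> C \<oplus> blk 3) (frame C \<oplus> F \<oplus> frame (blk 1 \<oplus> D))"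
  unfolding blk_2 blk_3
  apply (rule convI)
   apply (clarsimp simp: mem_shape)
   apply (rule ceq_witness, (unfold One_nat_def)?, (assumption | rule shape_intros)+, (simp only: append_assoc append_Cons append_Nil)?, rule ceq_frame_block3)
  apply (clarsimp simp: mem_shape)
  apply (rule ceq_witness', (unfold One_nat_def)?, (assumption | rule shape_intros)+, (simp only: append_assoc append_Cons append_Nil)?, rule ceq_frame_block3)
  done

lemma conv_two_frame_block3:
  "conv (blk 2 \<oplus> frame F \<oplus> C \<oplus> blk 3) (lhook (frame C \<oplus> F) \<oplus> blk 3)"
  unfolding blk_2 blk_3
  apply (rule convI)
   apply (clarsimp simp: mem_shape)
   apply (rule ceq_witness, (unfold One_nat_def)?, (assumption | rule shape_intros)+, (simp only: append_assoc append_Cons append_Nil)?, rule ceq_two_frame_block3)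
  apply (clarsimp simp: mem_shape)
  apply (rule ceq_witness', (unfold One_nat_def)?, (assumption | rule shape_intros)+, (simp only: append_assoc append_Cons append_Nil)?, rule ceq_two_frame_block3)
  done

lemma conv_frame_one_two:
  "conv (frame (blk 1 \<oplus> D \<oplus> blk 2)) (rhook D \<oplus> blk 3)"
  unfolding blk_2 blk_3
  apply (rule convI)
   apply (clarsimp simp: mem_shape)
   apply (rule ceq_witness, (unfold One_nat_def)?, (assumption | rule shape_intros)+, (simp only: append_assoc append_Cons append_Nil)?, rule ceq_frame_one_two)
  apply (clarsimp simp: mem_shape)
  apply (rule ceq_witness', (unfold One_nat_def)?, (assumption | rule shape_intros)+, (simp only: append_assoc append_Cons append_Nil)?, rule ceq_frame_one_two)
  done

lemma conv_lhook_two: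
  "conv (lhook (A \<oplus> blk 2)) (lhook A \<oplus> blk 2)"
  unfolding blk_2 blk_3
  apply (rule convI)
   apply (clarsimp simp: mem_shape)
   apply (rule ceq_witness, (unfold One_nat_def)?, (assumption | rule shape_intros)+, (simp only: append_assoc append_Cons append_Nil)?, rule ceq_lhook_two)
  apply (clarsimp simp: mem_shape)
  apply (rule ceq_witness', (unfold One_nat_def)?, (assumption | rule shape_intros)+, (simp only: append_assoc append_Cons append_Nil)?, rule ceq_lhook_two)
  done

lemma conv_rhook_two:
  "conv (rhook (A \<oplus> blk 2)) (rhook A \<oplus> blk 2)"
  unfolding blk_2 blk_3
  apply (rule convI)
   apply (clarsimp simp: mem_shape)
   apply (rule ceq_witness, (unfold One_nat_def)?, (assumption | rule shape_intros)+, (simp only: append_assoc append_Cons append_Nil)?, rule ceq_rhook_two)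
  apply (clarsimp simp: mem_shape)
  apply (rule ceq_witness', (unfold One_nat_def)?, (assumption | rule shape_intros)+, (simp only: append_assoc append_Cons append_Nil)?, rule ceq_rhook_two)
  done

lemma gconv_frame_two_two:
  "gconv (frame (blk 2 \<oplus> blk 2 \<oplus> A)) (frame A \<oplus> blk 2 \<oplus> blk 2)"
  unfolding gconv_def blk_2 blk_3
  apply (intro allI)
  apply (rule convI)
   apply (clarsimp simp: mem_shape)
   apply (rule ceq_witness, (unfold One_nat_def)?, (assumption | rule shape_intros)+, (simp only: append_assoc append_Cons append_Nil)?, rule ceq_frame_two_two)
  apply (clarsimp simp: mem_shape)
  apply (rule ceq_witness', (unfold One_nat_def)?, (assumption | rule shape_intros)+, (simp only: append_assoc append_Cons append_Nil)?, rule ceq_frame_two_two)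
  done

lemma conv_frame_frame_one:
  "conv (frame (frame A \<oplus> blk 1)) (blk 3 \<oplus> A \<oplus> blk 2)"
  unfolding blk_2 blk_3
  apply (rule convI)
   apply (clarsimp simp: mem_shape)
   apply (rule ceq_witness, (unfold One_nat_def)?, (assumption | rule shape_intros)+, (simp only: append_assoc append_Cons append_Nil)?, rule ceq_frame_frame_one)
  apply (clarsimp simp: mem_shape)
  apply (rule ceq_witness', (unfold One_nat_def)?, (assumption | rule shape_intros)+, (simp only: append_assoc append_Cons append_Nil)?, rule ceq_frame_frame_one)
  done

lemma conv_two_frame_frame_one:
  "conv (blk 2 \<oplus> frame (frame A \<oplus> blk 1)) (blk 2 \<oplus> blk 3 \<oplus> A \<oplus> blk 2)"
  unfolding blk_2 blk_3
  apply (rule convI)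
   apply (clarsimp simp: mem_shape)
   apply (rule ceq_witness, (unfold One_nat_def)?, (assumption | rule shape_intros)+, (simp only: append_assoc append_Cons append_Nil)?, rule ceq_two_frame_frame_one)
  apply (clarsimp simp: mem_shape)
  apply (rule ceq_witness', (unfold One_nat_def)?, (assumption | rule shape_intros)+, (simp only: append_assoc append_Cons append_Nil)?, rule ceq_two_frame_frame_one)
  done

lemma gconv_two_two_frame_frame_one:
  "gconv (blk 2 \<oplus> blk 2 \<oplus> frame (frame A \<oplus> blk 1)) (frame (blk 2) \<oplus> blk 3 \<oplus> A \<oplus> blk 2)"
  unfolding gconv_def blk_2 blk_3
  apply (intro allI)
  apply (rule convI)
   apply (clarsimp simp: mem_shape)
   apply (rule ceq_witness, (unfold One_nat_def)?, (assumption | rule shape_intros)+, (simp only: append_assoc append_Cons append_Nil)?, rule ceq_two_two_frame_frame_one)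
  apply (clarsimp simp: mem_shape)
  apply (rule ceq_witness', (unfold One_nat_def)?, (assumption | rule shape_intros)+, (simp only: append_assoc append_Cons append_Nil)?, rule ceq_two_two_frame_frame_one)
  done

lemma gconv_frame_three_two:
  "gconv (frame (blk 3 \<oplus> blk 2)) (blk 2 \<oplus> blk 2 \<oplus> blk 1 \<oplus> blk 2)"
  unfolding gconv_def blk_2 blk_3
  apply (intro allI)
  apply (rule convI)
   apply (clarsimp simp: mem_shape)
   apply (rule ceq_witness, (unfold One_nat_def)?, (assumption | rule shape_intros)+, (simp only: append_assoc append_Cons append_Nil)?, rule ceq_frame_three_two)
  apply (clarsimp simp: mem_shape)
  apply (rule ceq_witness', (unfold One_nat_def)?, (assumption | rule shape_intros)+, (simp only: append_assoc append_Cons append_Nil)?, rule ceq_frame_three_two)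
  done

text \<open>Lets a 2-block behind a frame enter it at the front; \<open>four_one_three\<close>
  applies this between two exchanges of frames.\<close>

lemma conv_frame_one_shift:
  "conv (frame (A \<oplus> blk 1) \<oplus> blk 2) (frame (blk 2 \<oplus> A \<oplus> blk 1))"
  unfolding blk_2 blk_3
  apply (rule convI)
   apply (clarsimp simp: mem_shape)
   apply (rule ceq_witness, (unfold One_nat_def)?, (assumption | rule shape_intros)+, (simp only: append_assoc append_Cons append_Nil)?, rule ceq_frame_one_shift)
  apply (clarsimp simp: mem_shape)
  apply (rule ceq_witness', (unfold One_nat_def)?, (assumption | rule shape_intros)+, (simp only: append_assoc append_Cons append_Nil)?, rule ceq_frame_one_shift)
  done

lemma conv_frame_one_two_shift:
  "conv (frame (A \<oplus> blk 1 \<oplus> blk 2) \<oplus> blk 2) (frame (blk 2 \<oplus> A \<oplus> blk 1 \<oplus> blk 2))"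
  unfolding blk_2 blk_3
  apply (rule convI)
   apply (clarsimp simp: mem_shape)
   apply (rule ceq_witness, (unfold One_nat_def)?, (assumption | rule shape_intros)+, (simp only: append_assoc append_Cons append_Nil)?, rule ceq_frame_one_two_shift)
  apply (clarsimp simp: mem_shape)
  apply (rule ceq_witness', (unfold One_nat_def)?, (assumption | rule shape_intros)+, (simp only: append_assoc append_Cons append_Nil)?, rule ceq_frame_one_two_shift)
  done

section \<open>Rewriting lists of block sizes\<close>

fun blocks :: "nat list \<Rightarrow> 'a shape" where
  "blocks [] = blk 0"
| "blocks (k # L) = blk k \<oplus> blocks L"

lemma blocks_append: "blocks (L @ M) = blocks L \<oplus> blocks M"
  by (induction L) (simp_all add: osum_assoc)

text \<open>Admitting the size 0 lets a rule with a free block size also cover the case that the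
  block is absent.\<close>

lemma blocks_zero: "blocks (L @ 0 # M) = blocks (L @ M)"
  by (simp add: blocks_append)

lemma frame_blk: "frame (blk 0) = blk 2" "frame (blk (Suc 0)) = blk 3" "frame (blk 2) = blk 4"
  "frame (frame (blk k)) = blk (k + 4)"
proof -
  have "(4::nat) = 2 + 2" "k + 4 = k + 2 + 2" by simp_all
  then show "frame (blk 2) = blk 4" "frame (frame (blk k)) = blk (k + 4)"
    by (metis blk_add_2)+
qed (simp_all add: blk_2 blk_3)

text \<open>The letters are fixed to be naturals because the two lists do not determine a letter
  type.\<close>

definition lconv :: "nat list \<Rightarrow> nat list \<Rightarrow> bool" (infix "\<sim>" 50) where
  "L \<sim> M \<longleftrightarrow> conv (blocks L :: nat shape) (blocks M)"

definition glconv :: "nat list \<Rightarrow> nat list \<Rightarrow> bool" (infix "\<approx>" 50) where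
  "L \<approx> M \<longleftrightarrow> gconv (blocks L :: nat shape) (blocks M)"

lemma lconv_refl: "L \<sim> L"
  by (simp add: lconv_def conv_refl)

lemma lconv_trans [trans]: "L \<sim> M \<Longrightarrow> M \<sim> N \<Longrightarrow> L \<sim> N"
  unfolding lconv_def by (rule conv_trans)

lemma glconv_refl: "L \<approx> L"
  by (simp add: glconv_def gconv_refl)

lemma glconv_sym: "L \<approx> M \<Longrightarrow> M \<approx> L"
  by (simp add: glconv_def gconv_sym)

lemma glconv_trans [trans]: "L \<approx> M \<Longrightarrow> M \<approx> N \<Longrightarrow> L \<approx> N"
  unfolding glconv_def by (rule gconv_trans)

lemma glconv_lconv: "L \<approx> M \<Longrightarrow> L \<sim> M"
  by (simp add: glconv_def lconv_def gconv_conv)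

lemma glconv_lconv_trans [trans]: "L \<approx> M \<Longrightarrow> M \<sim> N \<Longrightarrow> L \<sim> N"
  using glconv_lconv lconv_trans by blast

lemma lconv_glconv_trans [trans]: "L \<sim> M \<Longrightarrow> M \<approx> N \<Longrightarrow> L \<sim> N"
  using glconv_lconv lconv_trans by blast

lemma glconv_context: "L \<approx> M \<Longrightarrow> A @ L @ C \<approx> A @ M @ C"
  unfolding glconv_def blocks_append by (rule gconv_osum)

lemma lconv_suffix: "L \<sim> M \<Longrightarrow> L @ C \<sim> M @ C"
  unfolding lconv_def blocks_append by (rule conv_osum)

definition unitlist :: "nat list \<Rightarrow> bool" where
  "unitlist A \<longleftrightarrow> A = [] \<or> last A = 1"

lemma unitlist_simps [simp]: "unitlist []" "unitlist (A @ [Suc 0])"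
  by (simp_all add: unitlist_def)

lemma lconv_unit_context:
  assumes "L \<sim> M" and "unitlist A"
  shows "A @ L @ C \<sim> A @ M @ C"
proof (cases "A = []")
  case True
  then show ?thesis using assms lconv_suffix by simp
next
  case False
  then obtain B where A: "A = B @ [1]"
    using assms(2) by (metis append_butlast_last_id unitlist_def)
  have "conv (blocks B \<oplus> blk 1 \<oplus> blocks (L @ C)) (blocks B \<oplus> blk 1 \<oplus> (blocks (M @ C) :: nat shape))"
    by (rule conv_unit_prefix) (use lconv_suffix[OF assms(1), of C] in \<open>simp add: lconv_def\<close>)
  then show ?thesis
    by (simp add: A lconv_def blocks_append osum_assoc)
qed

text \<open>Applied to chains with the 1-block that follows them: all chains but the last can be
  reordered.\<close>

lemma lconv_swap_units:
  assumes "unitlist A" and "unitlist U" and "unitlist V"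
  shows "A @ U @ V @ C \<sim> A @ V @ U @ C"
proof (cases "U = [] \<or> V = []")
  case True
  then show ?thesis by (auto simp: lconv_refl)
next
  case False
  then obtain U' V' where UV: "U = U' @ [1]" "V = V' @ [1]"
    using assms(2,3) by (metis append_butlast_last_id unitlist_def)
  have "U @ V \<sim> V @ U"
    using conv_unit_swap[of "blocks U' :: nat shape" "blocks V'"]
    by (simp add: UV lconv_def blocks_append osum_assoc)
  from lconv_unit_context[OF this assms(1), of C] show ?thesis by simp
qed

section \<open>Words of 2-blocks and 4-blocks\<close>

abbreviation twos :: "nat \<Rightarrow> nat list" where
  "twos n \<equiv> replicate n 2"

lemma replicate_twos_2: "twos 2 = [2, 2]"
  by (simp add: eval_nat_numeral)

text \<open>The frame around the \<open>j\<close>-block lies directly inside another frame, which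
  adds four letters to it; the last block loses four.\<close>

lemma merge_block: "[2, j, m + 4] \<approx> [j + 4, m, 2]"
  using gconv_frame_block_ge4[of "blk 0" "blk j :: nat shape" "blk m"]
  by (simp add: glconv_def frame_blk)

lemma two_four: "[2, 4] \<approx> [4, 2]"
  using merge_block[of 0 0] by (simp add: glconv_def)

text \<open>2-blocks leave a frame in pairs, so parity decides: an empty frame is a 2-block, a frame
  around one 2-block is a 4-block.\<close>

lemma gconv_frame_twos:
  "gconv (frame (blocks (twos n)) :: nat shape) (blocks (if even n then twos (n + 1) else 4 # twos (n - 1)))"
proof (induction n rule: less_induct)
  case (less n)
  consider "n = 0" | "n = 1" | k where "n = Suc (Suc k)"
    by (metis One_nat_def not0_implies_Suc)
  then show ?case
  proof cases
    case 3
    have IH: "gconv (frame (blocks (twos k)) :: nat shape) (blocks (if even k then twos (k + 1) else 4 # twos (k - 1)))"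
      by (rule less.IH) (simp add: 3)
    have "gconv (frame (blocks (twos n)) :: nat shape) (frame (blocks (twos k)) \<oplus> blocks (twos 2))"
      using gconv_frame_two_two[of "blocks (twos k)"] by (simp add: 3 numeral_2_eq_2)
    also have "gconv \<dots> (blocks (if even k then twos (k + 1) else 4 # twos (k - 1)) \<oplus> blocks (twos 2))"
      using gconv_osum[OF IH, of "blk 0" "blocks (twos 2)"] by (simp only: osum_blk_0)
    also have "\<dots> = blocks (if even n then twos (n + 1) else 4 # twos (n - 1))"
    proof -
      have "(if even k then twos (k + 1) else 4 # twos (k - 1)) @ twos 2 = (if even n then twos (n + 1) else 4 # twos (n - 1))"
        by (auto simp: 3 simp flip: replicate_add simp del: replicate_Suc elim!: oddE)
      then show ?thesis by (simp only: blocks_append[symmetric])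
    qed
    finally show ?thesis .
  qed (simp_all add: frame_blk gconv_refl)
qed

text \<open>The first 4-block is a frame around a 2-block. Breaking the second one puts another
  2-block into this frame, and an even number of them can leave it.\<close>

lemma four_four: "[4, 4] \<approx> twos 4"
proof -
  have "gconv (blocks [4, 4] :: nat shape) (frame (blocks (twos 2)) \<oplus> blk 2)"
    using gconv_frame_block_ge4[of "blk 2" "blk 0" "blk 0 :: nat shape"]
    by (simp add: frame_blk replicate_twos_2)
  also have "gconv \<dots> (blocks (twos 3) \<oplus> blk 2)"
    using gconv_osum[OF gconv_frame_twos[of 2], of "blk 0" "blk 2"] by simp
  also have "\<dots> = blocks (twos 4)"
    by (simp add: eval_nat_numeral osum_assoc)
  finally show ?thesis
    by (simp add: glconv_def)
qed

lemma two_ge4: "[2, c + 4] \<approx> [4, c, 2]"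
  using merge_block[of 0 c] by (simp add: glconv_def)

lemma four_ge4: "[4, c + 4] \<approx> [2, 2, 2, c, 2]"
proof -
  have "gconv (blocks [4, c + 4] :: nat shape) (frame (blocks (twos 2)) \<oplus> blk c \<oplus> blk 2)"
    using gconv_frame_block_ge4[of "blk 2" "blk 0" "blk c :: nat shape"]
    by (simp add: frame_blk replicate_twos_2)
  also have "gconv \<dots> (blocks (twos 3) \<oplus> blk c \<oplus> blk 2)"
    using gconv_osum[OF gconv_frame_twos[of 2], of "blk 0" "blk c \<oplus> blk 2"] by simp
  also have "\<dots> = blocks [2, 2, 2, c, 2]"
    by (simp add: eval_nat_numeral osum_assoc)
  finally show ?thesis
    by (simp add: glconv_def)
qed

lemma four_twos: "4 # twos n \<approx> twos n @ [4]"
proof (induction n)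
  case (Suc n)
  have "4 # twos (Suc n) \<approx> 2 # 4 # twos n"
    using glconv_context[OF glconv_sym[OF two_four], of "[]" "twos n"] by simp
  also have "\<dots> \<approx> 2 # twos n @ [4]"
    using glconv_context[OF Suc.IH, of "[2]" "[]"] by simp
  finally show ?case by simp
qed (simp add: glconv_refl)

text \<open>4-blocks commute with 2-blocks and cancel in pairs. The sum of the sizes is recorded
  because it yields the number of remaining blocks.\<close>

lemma two_four_word:
  assumes "set P \<subseteq> {2, 4}"
  obtains (twos) x where "P \<approx> twos x" "sum_list P = 2 * x"
  | (four) x where "P \<approx> 4 # twos x" "sum_list P = 2 * x + 4"
proof -
  have "(\<exists>x. P \<approx> twos x \<and> sum_list P = 2 * x) \<or> (\<exists>x. P \<approx> 4 # twos x \<and> sum_list P = 2 * x + 4)"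
    using assms
  proof (induction P)
    case Nil
    have "[] \<approx> twos 0" by (simp add: glconv_refl)
    then show ?case by fastforce
  next
    case (Cons h P)
    then have h: "h = 2 \<or> h = 4" by simp
    have hd: "h # P \<approx> h # Q" if "P \<approx> Q" for Q
      using glconv_context[OF that, of "[h]" "[]"] by simp
    from Cons consider x where "P \<approx> twos x" "sum_list P = 2 * x" | x where "P \<approx> 4 # twos x" "sum_list P = 2 * x + 4"
      by auto
    then show ?case
    proof cases
      case (1 x)
      with h hd[OF 1(1)] show ?thesis
        by (metis add.commute mult_2 numeral_Bit0 replicate_Suc sum_list.Cons mult_Suc_right)
    next
      case (2 x)
      show ?thesis
      proof (cases "h = 2")
        case True
        have "2 # 4 # twos x \<approx> 4 # twos (Suc x)"
          using glconv_context[OF two_four, of "[]" "twos x"] by simp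
        with hd[OF 2(1)] True have "h # P \<approx> 4 # twos (Suc x)"
          using glconv_trans by simp
        then show ?thesis
          using 2 True by (intro disjI2 exI[of _ "Suc x"]) simp
      next
        case False
        have "4 # 4 # twos x \<approx> twos (x + 4)"
          using glconv_context[OF four_four, of "[]" "twos x"] by (simp add: eval_nat_numeral)
        with hd[OF 2(1)] False h have "h # P \<approx> twos (x + 4)"
          using glconv_trans by simp
        then show ?thesis
          using 2 False h by (intro disjI1 exI[of _ "x + 4"]) simp
      qed
    qed
  qed
  then show thesis using that by blast
qed

text \<open>A block preceded by a 2- or 4-block loses four letters at a time, so only its size modulo 4 survives.\<close>

lemma split_block_aux:
  "h = 2 \<or> h = 4 \<Longrightarrow> \<exists>P y. set P \<subseteq> {2, 4} \<and> P \<noteq> [] \<and> (4 \<le> c \<longrightarrow> 1 \<le> y) \<and> sum_list P + c mod 4 + 2 * y = h + c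
    \<and> [h, c] \<approx> P @ [c mod 4] @ twos y"
proof (induction c arbitrary: h rule: less_induct)
  case (less c)
  show ?case
  proof (cases "c < 4")
    case True
    then have "[h, c] \<approx> [h] @ [c mod 4] @ twos 0"
      by (simp add: glconv_refl)
    with less.prems True show ?thesis
      by (intro exI[of _ "[h]"] exI[of _ 0]) auto
  next
    case False
    then obtain d where d: "c = d + 4"
      by (metis add.commute le_Suc_ex not_less)
    \<comment> \<open>Treats \<open>two_ge4\<close> and \<open>four_ge4\<close> uniformly: the block
      in front alternates between 2 and 4, and \<open>A\<close> collects the surplus
      2-blocks.\<close>
    define A where "A = (if h = 2 then [] else [2, 2::nat])"
    define g where "g = (if h = 2 then 4 else 2::nat)"
    have 1: "[h, c] \<approx> A @ [g, d] @ [2]"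
      using less.prems two_ge4[of d] four_ge4[of d] by (auto simp: A_def g_def d)
    obtain P y where P: "set P \<subseteq> {2, 4}" "P \<noteq> []" "sum_list P + d mod 4 + 2 * y = g + d"
      "[g, d] \<approx> P @ [d mod 4] @ twos y"
    proof -
      have "g = 2 \<or> g = 4" by (simp add: g_def)
      from less.IH[OF _ this, of d] d that show thesis by auto
    qed
    have "[h, c] \<approx> (A @ P) @ [c mod 4] @ twos (Suc y)"
      using glconv_trans[OF 1 glconv_context[OF P(4)]]
      by (simp add: d replicate_append_same flip: replicate_Suc)
    moreover have "sum_list (A @ P) + c mod 4 + 2 * Suc y = h + c"
      using P(3) less.prems by (auto simp: A_def g_def d)
    moreover have "set (A @ P) \<subseteq> {2, 4}"
      using P(1) by (auto simp: A_def)
    ultimately show ?thesis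
      using P(2) by (intro exI[of _ "A @ P"] exI[of _ "Suc y"]) simp
  qed
qed

section \<open>Simplifications made possible by a 3-block on the right\<close>

lemma lhook_twos: "conv (lhook (blocks (twos n)) :: nat shape) (blocks (twos (n + 1)))"
proof (induction n)
  case 0
  have "lhook (blk 0) = (blk 2 :: nat shape)"
    by (auto simp: mem_shape blk_2)
  then show ?case by (simp add: conv_refl)
next
  case (Suc n)
  have eq: "blocks (twos (Suc n)) = blocks (twos n) \<oplus> (blk 2 :: nat shape)" for n
    using blocks_append[of "twos n" "[2]"] by (simp add: replicate_append_same)
  show ?case
    using conv_trans[OF conv_lhook_two conv_osum[OF Suc.IH]] by (simp only: eq Suc_eq_plus1[symmetric])
qed

lemma rhook_twos: "conv (rhook (blocks (twos n)) :: nat shape) (blocks (twos (n + 1)))"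
proof (induction n)
  case 0
  have "rhook (blk 0) = (blk 2 :: nat shape)"
    by (auto simp: mem_shape blk_2)
  then show ?case by (simp add: conv_refl)
next
  case (Suc n)
  have eq: "blocks (twos (Suc n)) = blocks (twos n) \<oplus> (blk 2 :: nat shape)" for n
    using blocks_append[of "twos n" "[2]"] by (simp add: replicate_append_same)
  show ?case
    using conv_trans[OF conv_rhook_two conv_osum[OF Suc.IH]] by (simp only: eq Suc_eq_plus1[symmetric])
qed

lemma blocks_twos_Suc: "blocks (twos (Suc n)) = blocks (twos n) \<oplus> blk 2"
  using blocks_append[of "twos n" "[2]"] by (simp add: replicate_append_same)

text \<open>In front of a 3-block the 2-block inside the 4-block changes places with the 2-blocks
  behind it. For odd \<open>m\<close> this would only give another 4-block, so there a 2-block is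
  kept on the left and the path through a hook is used.\<close>

lemma four_twos_three: "4 # twos m @ [3] \<sim> twos (m + 2) @ [3]"
proof (cases "even m")
  case True
  have "conv (blocks (4 # twos m @ [3]) :: nat shape) (frame (blocks (twos m)) \<oplus> blk 2 \<oplus> blk 3)"
    using conv_frame_block3[of "blk 0" "blk 2" "blocks (twos m) :: nat shape"]
    by (simp add: frame_blk blocks_append)
  also have "conv \<dots> (blocks (twos (m + 1)) \<oplus> blk 2 \<oplus> blk 3)"
    using conv_osum[OF gconv_conv[OF gconv_frame_twos[of m]], of "blk 2 \<oplus> blk 3"] True by simp
  also have "\<dots> = blocks (twos (m + 2) @ [3])"
    by (simp add: blocks_append blocks_twos_Suc osum_assoc del: replicate_Suc)
  finally show ?thesis
    by (simp add: lconv_def)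
next
  case False
  then obtain n where m: "m = Suc n" and "even n"
    by (metis even_Suc not0_implies_Suc even_zero)
  have "4 # twos m @ [3] \<approx> 2 # 4 # twos n @ [3]"
    using glconv_context[OF glconv_sym[OF two_four], of "[]" "twos n @ [3]"] by (simp add: m)
  \<comment> \<open>\<open>gconv_frame_twos\<close> read backwards: for odd \<open>m\<close> the
    part \<open>4 # twos n\<close> is a frame around \<open>twos m\<close>.\<close>
  moreover have "conv (blocks (2 # 4 # twos n @ [3]) :: nat shape) (blk 2 \<oplus> frame (blocks (twos m)) \<oplus> blk 3)"
    using gconv_sym[OF gconv_osum[OF gconv_frame_twos[of m], of "blk 2" "blk 3"]] False
    by (simp add: m blocks_append osum_assoc gconv_conv)
  moreover have "conv (blk 2 \<oplus> frame (blocks (twos m)) \<oplus> blk 3 :: nat shape) (lhook (blocks (twos (m + 1))) \<oplus> blk 3)"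
    using conv_two_frame_block3[of "blocks (twos m) :: nat shape" "blk 0"] by (simp add: frame_blk)
  moreover have "conv (lhook (blocks (twos (m + 1))) \<oplus> blk 3 :: nat shape) (blocks (twos (m + 2) @ [3]))"
    using conv_osum[OF lhook_twos[of "m + 1"], of "blk 3"] by (simp add: blocks_append osum_assoc)
  ultimately show ?thesis
    unfolding lconv_def glconv_def by (meson conv_trans gconv_conv)
qed

lemma frame_swap_three: "conv (frame F \<oplus> C \<oplus> blk 3) (frame C \<oplus> F \<oplus> blk 3)"
  using conv_frame_block3[of "blk 0" F C] by (simp add: frame_blk)

text \<open>An exchange in front of the 3-block moves the frame of the 4-block onto \<open>A\<close>
  and the 1-block; its 2-block then enters the frame from behind, and a second exchange leaves the
  frame empty, that is, a 2-block.\<close>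

lemma four_one_three: "4 # A @ [1, 3] \<sim> 2 # 2 # A @ [1, 3]"
proof -
  let ?A = "blocks A :: nat shape"
  have "conv (blocks (4 # A @ [1, 3])) (frame (?A \<oplus> blk 1) \<oplus> blk 2 \<oplus> blk 3)"
    using frame_swap_three[of "blk 2" "?A \<oplus> blk 1"] by (simp add: frame_blk blocks_append osum_assoc)
  also have "conv \<dots> (frame (blk 2 \<oplus> ?A \<oplus> blk 1) \<oplus> blk 3)"
    using conv_osum[OF conv_frame_one_shift, of ?A "blk 3"] by (simp add: osum_assoc)
  also have "conv \<dots> (blocks (2 # 2 # A @ [1, 3]))"
    using conv_sym[OF frame_swap_three[of "blk 0" "blk 2 \<oplus> ?A \<oplus> blk 1"]]
    by (simp add: frame_blk blocks_append osum_assoc)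
  finally show ?thesis by (simp add: lconv_def)
qed

lemma four_one_two_three: "4 # A @ [1, 2, 3] \<sim> 2 # 2 # A @ [1, 2, 3]"
proof -
  let ?A = "blocks A :: nat shape"
  have "conv (blocks (4 # A @ [1, 2, 3])) (frame (?A \<oplus> blk 1 \<oplus> blk 2) \<oplus> blk 2 \<oplus> blk 3)"
    using frame_swap_three[of "blk 2" "?A \<oplus> blk 1 \<oplus> blk 2"] by (simp add: frame_blk blocks_append osum_assoc)
  also have "conv \<dots> (frame (blk 2 \<oplus> ?A \<oplus> blk 1 \<oplus> blk 2) \<oplus> blk 3)"
    using conv_osum[OF conv_frame_one_two_shift, of ?A "blk 3"] by (simp add: osum_assoc)
  also have "conv \<dots> (blocks (2 # 2 # A @ [1, 2, 3]))"
    using conv_sym[OF frame_swap_three[of "blk 0" "blk 2 \<oplus> ?A \<oplus> blk 1 \<oplus> blk 2"]]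
    by (simp add: frame_blk blocks_append osum_assoc)
  finally show ?thesis by (simp add: lconv_def)
qed

text \<open>Both lists come from \<open>[2, 5, 2]\<close>, depending on which 2-block takes part.
  The effect is that a 4-block jumps over a 1-block.\<close>

lemma four_one_two_two: "[4, 1, 2, 2] \<approx> [2, 2, 1, 4]"
proof -
  have "[4, 1, 2, 2] \<approx> [2, 5, 2]"
    using glconv_context[OF glconv_sym[OF merge_block[of 0 1]], of "[]" "[2]"] by (simp add: blocks_zero glconv_def)
  also have "\<dots> \<approx> [2, 2, 1, 4]"
    using glconv_context[OF glconv_sym[OF merge_block[of 1 0]], of "[2]" "[]"] by (simp add: glconv_def)
  finally show ?thesis .
qed

text \<open>With two 2-blocks behind the 1-block the 4-block jumps over it; there
  \<open>four_twos_three\<close> applies since its left context ends in a 1-block. The cases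
  \<open>a = 0\<close> and \<open>a = 1\<close> rest on separate paths.\<close>

lemma four_twos_one_twos_three: "4 # twos x @ 1 # twos a @ [3] \<sim> twos (x + 2) @ 1 # twos a @ [3]"
proof -
  consider "a = 0" | "a = 1" | b where "a = b + 2"
    by (metis One_nat_def Suc_1 add.commute add_2_eq_Suc not0_implies_Suc)
  then show ?thesis
  proof cases
    case 1
    then show ?thesis using four_one_three[of "twos x"] by simp
  next
    case 2
    then show ?thesis using four_one_two_three[of "twos x"] by simp
  next
    case 3
    have "4 # twos x @ 1 # twos a @ [3] \<approx> twos x @ [4, 1, 2, 2] @ twos b @ [3]"
      using glconv_context[OF four_twos[of x], of "[]" "1 # twos a @ [3]"] by (simp add: 3)
    also have "\<dots> \<approx> twos x @ [2, 2, 1, 4] @ twos b @ [3]"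
      by (rule glconv_context[OF four_one_two_two])
    also have "\<dots> = (twos x @ [2, 2, 1]) @ (4 # twos b @ [3]) @ []"
      by simp
    also have "\<dots> \<sim> (twos x @ [2, 2, 1]) @ (twos (b + 2) @ [3]) @ []"
      by (rule lconv_unit_context[OF four_twos_three]) (simp add: unitlist_def)
    also have "\<dots> = twos (x + 2) @ 1 # twos a @ [3]"
      by (simp add: 3 replicate_app_Cons_same)
    finally show ?thesis .
  qed
qed

text \<open>The first 3-block is a frame around a 1-block, and the second one sets this 1-block
  free. The word behind it may then be simplified by \<open>conv\<close> alone, and a 4-block in
  front, which arises for odd \<open>b\<close>, is dissolved.\<close>

lemma three_twos_three: "twos a @ 3 # twos b @ [3] \<sim> twos (b + 1) @ 1 # twos a @ [3]"
proof -
  have 1: "conv (frame (blk 1 \<oplus> blocks (twos a)) :: nat shape) (blocks (twos a @ [3]))"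
  proof (cases a)
    case 0
    then show ?thesis by (simp add: frame_blk conv_refl)
  next
    case (Suc d)
    have "conv (frame (blk 1 \<oplus> blocks (twos a)) :: nat shape) (rhook (blocks (twos d)) \<oplus> blk 3)"
      using conv_frame_one_two[of "blocks (twos d)"] by (simp only: Suc blocks_twos_Suc)
    also have "conv \<dots> (blocks (twos a @ [3]))"
      using conv_osum[OF rhook_twos[of d], of "blk 3"] by (simp add: Suc blocks_append osum_assoc)
    finally show ?thesis .
  qed
  have "conv (blocks (twos a @ 3 # twos b @ [3]) :: nat shape)
     (frame (blocks (twos b)) \<oplus> blk 1 \<oplus> frame (blk 1 \<oplus> blocks (twos a)))"
    using conv_frame_block3[of "blocks (twos a)" "blk 1" "blocks (twos b) :: nat shape"]
    by (simp add: frame_blk blocks_append)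
  also have "conv \<dots> (frame (blocks (twos b)) \<oplus> blk 1 \<oplus> blocks (twos a @ [3]))"
    by (rule conv_unit_prefix[OF 1])
  also have "conv \<dots> (blocks (if even b then twos (b + 1) else 4 # twos (b - 1)) \<oplus> blk 1 \<oplus> blocks (twos a @ [3]))"
    by (rule conv_osum[OF gconv_conv[OF gconv_frame_twos]])
  finally have *: "twos a @ 3 # twos b @ [3] \<sim> (if even b then twos (b + 1) else 4 # twos (b - 1)) @ 1 # twos a @ [3]"
    by (simp add: lconv_def blocks_append osum_assoc)
  show ?thesis
  proof (cases "even b")
    case True
    then show ?thesis using * by simp
  next
    case False
    then have "b - 1 + 2 = b + 1" by (cases b) auto
    with four_twos_one_twos_three[of "b - 1" a]
    have "4 # twos (b - 1) @ 1 # twos a @ [3] \<sim> twos (b + 1) @ 1 # twos a @ [3]" by metis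
    with * False show ?thesis using lconv_trans by simp
  qed
qed

section \<open>Types of block lists\<close>

text \<open>Every chain but the last is followed by a 1-block, so \<open>units us @ c\<close>
  rebuilds a list from its chains \<open>us @ [c]\<close>.\<close>

definition units :: "nat list list \<Rightarrow> nat list" where
  "units us = concat (map (\<lambda>c. c @ [1]) us)"

lemma units_simps [simp]:
  "units [] = []" "units (c # us) = c @ Suc 0 # units us" "units (us @ vs) = units us @ units vs"
  by (simp_all add: units_def)

lemma unitlist_units [simp]: "unitlist (units us)"
  by (cases us rule: rev_cases) (auto simp: unitlist_def)

lemma set_units: "set (units us) \<subseteq> insert 1 (\<Union>c\<in>set us. set c)"
  by (induction us) auto

lemma chains_nonempty [simp]: "chains L \<noteq> []"
  by (induction L) (auto simp: Let_def)

lemma chains_append_one [simp]: "chains (A @ Suc 0 # L) = chains A @ chains L"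
  by (induction A) (auto simp: Let_def)

lemma chains_no_one: "1 \<notin> set C \<Longrightarrow> chains C = [C]"
  by (induction C) auto

lemma chains_units: "\<forall>c\<in>set us. 1 \<notin> set c \<Longrightarrow> chains (units us @ L) = us @ chains L"
  by (induction us) (auto simp: chains_no_one)

lemma chains_decomp:
  obtains us c where "L = units us @ c" "chains L = us @ [c]" "\<forall>d\<in>set (us @ [c]). 1 \<notin> set d"
proof -
  have "\<exists>us c. L = units us @ c \<and> (\<forall>d\<in>set (us @ [c]). 1 \<notin> set d)"
  proof (induction L)
    case Nil
    show ?case by (intro exI[of _ "[]"]) simp
  next
    case (Cons x L)
    then obtain us c where L: "L = units us @ c" "\<forall>d\<in>set (us @ [c]). 1 \<notin> set d"
      by blast
    show ?case
    proof (cases "x = 1")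
      case True
      then show ?thesis
        using L by (intro exI[of _ "[] # us"] exI[of _ c]) simp
    next
      case False
      then show ?thesis
        using L by (cases us) (auto intro: exI[of _ "[]"] exI[of _ "(x # hd us) # tl us"])
    qed
  qed
  then show thesis
    using that chains_units chains_no_one by (metis in_set_conv_decomp_first list.set_intros(1) set_append Un_iff)
qed

lemma multi_big_append: "multi_big L \<Longrightarrow> multi_big (L @ M)" "multi_big M \<Longrightarrow> multi_big (L @ M)"
  by (auto simp: multi_big_def)

text \<open>Size 0 is convenient for rewriting but must not remain in the end, because the cut
  points of a decomposition increase strictly.\<close>

definition typed :: "nat list \<Rightarrow> bool" where
  "typed L \<longleftrightarrow> 0 \<notin> set L \<and> (type1 L \<or> type2 L \<or> type3 L \<or> type4 L \<or> type5 L)"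

lemma set_concat_chains: "set (concat (chains L)) = set L - {1}"
proof (induction L)
  case (Cons x L)
  then show ?case by (cases "chains L") (auto simp: Let_def)
qed simp

lemma concat_chains: "concat (chains L) = filter (\<lambda>x. x \<noteq> 1) L"
proof (induction L)
  case (Cons x L)
  then show ?case by (cases "chains L") (auto simp: Let_def)
qed simp

lemma type1_iff: "type1 L \<longleftrightarrow> length (filter (\<lambda>x. x \<noteq> 1) L) \<le> 1"
proof -
  have "length (filter (\<lambda>c. c \<noteq> []) cs) \<le> 1 \<and> (\<forall>c\<in>set cs. c \<noteq> [] \<longrightarrow> length c = 1)
    \<longleftrightarrow> length (concat cs) \<le> 1" for cs :: "nat list list"
  proof (induction cs)
    case (Cons c cs)
    have "filter (\<lambda>c. c \<noteq> []) cs = [] \<longleftrightarrow> concat cs = []"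
      by (auto simp: filter_empty_conv)
    moreover have "(\<forall>xs\<in>set cs. xs = []) \<longleftrightarrow> length (concat cs) = 0"
      by (simp only: length_0_conv concat_eq_Nil_conv)
    ultimately show ?case
      using Cons by (cases c) (auto simp del: length_0_conv)
  qed simp
  then show ?thesis by (simp add: type1_def concat_chains)
qed

lemma type2_iff: "type2 L \<longleftrightarrow> multi_big L \<and> set L \<subseteq> {1, 2}"
proof -
  have "(\<forall>c\<in>set (chains L). \<forall>x\<in>set c. x = 2) \<longleftrightarrow> set (concat (chains L)) \<subseteq> {2}"
    by auto
  then show ?thesis
    unfolding type2_def set_concat_chains by auto
qed

text \<open>Includes the empty chain, so that the condition can be imposed on all chains
  alike.\<close>

definition chain3 :: "nat list \<Rightarrow> bool" where
  "chain3 c \<longleftrightarrow> set c \<subseteq> {2} \<or> formI c"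

lemma all_twos: "set c \<subseteq> {2} \<longleftrightarrow> (\<exists>n. c = twos n)"
proof
  assume "set c \<subseteq> {2}"
  then have "c = twos (length c)"
    by (intro replicate_eqI) auto
  then show "\<exists>n. c = twos n" ..
qed auto

lemma type3_iff: "type3 L \<longleftrightarrow> multi_big L \<and> (\<forall>c\<in>set (chains L). chain3 c) \<and> (\<exists>c\<in>set (chains L). formI c)"
proof -
  have "c \<noteq> [] \<longrightarrow> formI c \<or> formII c \<longleftrightarrow> chain3 c" for c
    unfolding chain3_def all_twos formII_def
    by (metis One_nat_def Suc_leI length_greater_0_conv length_replicate replicate_0)
  moreover have "chain3 []"
    by (simp add: chain3_def)
  ultimately show ?thesis
    unfolding type3_def by metis
qed

lemma formI_iff: "formI c \<longleftrightarrow> (\<exists>u v. c = u @ 3 # v \<and> set u \<subseteq> {2} \<and> set v \<subseteq> {2})"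
  unfolding formI_def all_twos by auto

text \<open>Replaces the distinguished index in Types 4 and 5 by a splitting of the list of chains,
  which is easier to extend at either end.\<close>

lemma nth_split_iff:
  "(\<exists>i<length cs. P (cs ! i) \<and> (\<forall>j<length cs. j \<noteq> i \<longrightarrow> Q (cs ! j)))
   \<longleftrightarrow> (\<exists>us c vs. cs = us @ c # vs \<and> P c \<and> (\<forall>d\<in>set us \<union> set vs. Q d))"
proof
  assume "\<exists>i<length cs. P (cs ! i) \<and> (\<forall>j<length cs. j \<noteq> i \<longrightarrow> Q (cs ! j))"
  then obtain i where i: "i < length cs" "P (cs ! i)" "\<And>j. j < length cs \<Longrightarrow> j \<noteq> i \<Longrightarrow> Q (cs ! j)"
    by blast
  have "cs = take i cs @ cs ! i # drop (Suc i) cs"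
    using i(1) by (rule id_take_nth_drop)
  moreover have "Q d" if "d \<in> set (take i cs) \<union> set (drop (Suc i) cs)" for d
    using that i by (auto simp: in_set_conv_nth)
  ultimately show "\<exists>us c vs. cs = us @ c # vs \<and> P c \<and> (\<forall>d\<in>set us \<union> set vs. Q d)"
    using i(2) by blast
next
  assume "\<exists>us c vs. cs = us @ c # vs \<and> P c \<and> (\<forall>d\<in>set us \<union> set vs. Q d)"
  then obtain us c vs where cs: "cs = us @ c # vs" "P c" "\<forall>d\<in>set us \<union> set vs. Q d"
    by blast
  have "Q (cs ! j)" if "j < length cs" "j \<noteq> length us" for j
    using that cs by (auto simp: nth_append nth_Cons' split: if_splits)
  then show "\<exists>i<length cs. P (cs ! i) \<and> (\<forall>j<length cs. j \<noteq> i \<longrightarrow> Q (cs ! j))"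
    using cs by (intro exI[of _ "length us"]) simp
qed

lemma type4_iff: "type4 L \<longleftrightarrow> multi_big L \<and>
  (\<exists>us m vs. chains L = us @ (4 # twos m) # vs \<and> (\<forall>d\<in>set us \<union> set vs. set d \<subseteq> {2}))"
proof -
  have "type4 L \<longleftrightarrow> multi_big L \<and> (\<exists>i<length (chains L). (\<exists>m. chains L ! i = 4 # twos m) \<and>
     (\<forall>j<length (chains L). j \<noteq> i \<longrightarrow> set (chains L ! j) \<subseteq> {2}))"
    unfolding type4_def by (simp add: subset_iff Ball_def)
  also have "\<dots> \<longleftrightarrow> multi_big L \<and> (\<exists>us c vs. chains L = us @ c # vs \<and> (\<exists>m. c = 4 # twos m) \<and>
     (\<forall>d\<in>set us \<union> set vs. set d \<subseteq> {2}))"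
    by (rule arg_cong[where f = "\<lambda>x. multi_big L \<and> x"], rule nth_split_iff)
  finally show ?thesis
    by (smt (verit, best))
qed

lemma type5_iff: "type5 L \<longleftrightarrow> multi_big L \<and>
  (\<exists>us vs. chains L = us @ [5] # vs \<and> (\<forall>d\<in>set us \<union> set vs. d = [] \<or> d = [2]))"
proof -
  have "type5 L \<longleftrightarrow> multi_big L \<and> (\<exists>us c vs. chains L = us @ c # vs \<and> c = [5] \<and>
     (\<forall>d\<in>set us \<union> set vs. d = [] \<or> d = [2]))"
    unfolding type5_def by (rule arg_cong[where f = "\<lambda>x. multi_big L \<and> x"], rule nth_split_iff)
  then show ?thesis by simp
qed

lemma typed_ones_prefix: "typed L \<Longrightarrow> typed (replicate i 1 @ L)"
proof (induction i)
  case (Suc i)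
  have "typed (1 # M)" if "typed M" for M
  proof -
    have c: "chains (1 # M) = [] # chains M" by (simp add: Let_def)
    have m: "multi_big (1 # M) = multi_big M" by (simp add: multi_big_def)
    have "type4 (1 # M)" if "type4 M"
      using that unfolding type4_iff c m
      by (metis Cons_eq_appendI Un_iff empty_subsetI list.set(1) set_ConsD)
    moreover have "type5 (1 # M)" if "type5 M"
      using that unfolding type5_iff c m by (metis Cons_eq_appendI Un_iff set_ConsD)
    ultimately show ?thesis
      using that unfolding typed_def type1_iff type2_iff type3_iff c m by (auto simp: chain3_def)
  qed
  with Suc show ?case by simp
qed simp

lemma typed_append_one: "typed L \<Longrightarrow> typed (L @ [1])"
proof -
  assume L: "typed L"
  have c: "chains (L @ [1]) = chains L @ [[]]" by simp
  have m: "multi_big (L @ [1]) = multi_big L" by (simp add: multi_big_def)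
  have "type4 (L @ [1])" if "type4 L"
  proof -
    from that obtain us k vs where "chains L = us @ (4 # twos k) # vs" "\<forall>d\<in>set us \<union> set vs. set d \<subseteq> {2}"
      unfolding type4_iff by blast
    then show ?thesis
      unfolding type4_iff c m using that type4_def
      by (intro conjI exI[of _ us] exI[of _ k] exI[of _ "vs @ [[]]"]) auto
  qed
  moreover have "type5 (L @ [1])" if "type5 L"
  proof -
    from that obtain us vs where "chains L = us @ [5] # vs" "\<forall>d\<in>set us \<union> set vs. d = [] \<or> d = [2]"
      unfolding type5_iff by blast
    then show ?thesis
      unfolding type5_iff c m using that type5_def
      by (intro conjI exI[of _ us] exI[of _ "vs @ [[]]"]) auto
  qed
  ultimately show "typed (L @ [1])"
    using L unfolding typed_def type1_iff type2_iff type3_iff c m by (auto simp: chain3_def)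
qed

lemma typed2I: "set M \<subseteq> {1, 2} \<Longrightarrow> multi_big M \<Longrightarrow> typed M"
  unfolding typed_def type2_iff by auto

lemma typed3I:
  "0 \<notin> set M \<Longrightarrow> multi_big M \<Longrightarrow> \<forall>c\<in>set (chains M). chain3 c \<Longrightarrow> \<exists>c\<in>set (chains M). formI c \<Longrightarrow> typed M"
  unfolding typed_def type3_iff by auto

lemma typed4I:
  "chains M = us @ (4 # twos m) # vs \<Longrightarrow> \<forall>d\<in>set us \<union> set vs. set d \<subseteq> {2} \<Longrightarrow> 0 \<notin> set M \<Longrightarrow> multi_big M \<Longrightarrow> typed M"
  unfolding typed_def type4_iff by blast

lemma set_twos_subset [simp]: "set (twos n) \<subseteq> {2}"
  by (auto dest: in_set_replicate[THEN iffD1])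

lemma chain3_twos [simp]: "set c \<subseteq> {2} \<Longrightarrow> chain3 c"
  by (simp add: chain3_def)

lemma chain3_formI [simp]: "formI c \<Longrightarrow> chain3 c"
  by (simp add: chain3_def)

lemma formI_three [simp]: "set u \<subseteq> {2} \<Longrightarrow> set v \<subseteq> {2} \<Longrightarrow> formI (u @ 3 # v)" "set v \<subseteq> {2} \<Longrightarrow> formI (3 # v)"
  "formI (2 # c) = formI c"
proof -
  show "set u \<subseteq> {2} \<Longrightarrow> set v \<subseteq> {2} \<Longrightarrow> formI (u @ 3 # v)" for u v
    unfolding formI_iff by blast
  from this[of "[]"] show "set v \<subseteq> {2} \<Longrightarrow> formI (3 # v)" for v
    by simp
  show "formI (2 # c) = formI c"
  proof
    assume "formI (2 # c)"
    then obtain u v where uv: "2 # c = u @ 3 # v" "set u \<subseteq> {2}" "set v \<subseteq> {2}"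
      unfolding formI_iff by blast
    then show "formI c"
      unfolding formI_iff by (cases u) auto
  next
    assume "formI c"
    then obtain u v where uv: "c = u @ 3 # v" "set u \<subseteq> {2}" "set v \<subseteq> {2}"
      unfolding formI_iff by blast
    then show "formI (2 # c)"
      unfolding formI_iff by (intro exI[of _ "2 # u"] exI[of _ v]) simp
  qed
qed

text \<open>4-blocks cancel even across a 1-block, which keeps two neighbouring chains from both
  retaining one.\<close>

lemma four_one_four: "[4, 1, 4] \<approx> [2, 2, 1, 2, 2]"
proof -
  have "gconv (blocks [4, 1, 4] :: nat shape) (frame (blk 3 \<oplus> blk 2) \<oplus> blk 2)"
    using gconv_frame_block_ge4[of "blk 2" "blk 1" "blk 0 :: nat shape"] by (simp add: frame_blk)
  also have "gconv \<dots> (blocks [2, 2, 1, 2, 2])"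
    using gconv_osum[OF gconv_frame_three_two, of "blk 0" "blk 2"] by (simp add: osum_assoc)
  finally show ?thesis by (simp add: glconv_def)
qed

text \<open>Breaking the last block yields a frame around \<open>frame L\<close> and a 1-block, to
  be rewritten as \<open>3 # L @ [2]\<close>. If at least two 2-blocks precede, a 4-block appears,
  which travels to the front and is dissolved by the 3-block; zero or one 2-block are handled by
  separate paths.\<close>

lemma three_block_ge4: "twos x @ 3 # L @ [m + 4] \<sim> twos x @ 3 # L @ [2, m, 2]"
proof -
  let ?L = "blocks L :: nat shape"
  have "conv (blocks (twos x) \<oplus> frame (frame ?L \<oplus> blk 1)) (blocks (twos x @ 3 # L @ [2]))"
  proof -
    consider "x = 0" | "x = 1" | n where "x = n + 2"
      by (metis One_nat_def Suc_1 add.commute add_2_eq_Suc not0_implies_Suc)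
    then show ?thesis
    proof cases
      case 1
      then show ?thesis using conv_frame_frame_one[of ?L] by (simp add: blocks_append)
    next
      case 2
      then show ?thesis using conv_two_frame_frame_one[of ?L] by (simp add: blocks_append)
    next
      case 3
      have "gconv (blocks (twos n) \<oplus> (blk 2 \<oplus> blk 2 \<oplus> frame (frame ?L \<oplus> blk 1)))
          (blocks (twos n) \<oplus> (frame (blk 2) \<oplus> blk 3 \<oplus> ?L \<oplus> blk 2))"
        using gconv_osum[OF gconv_two_two_frame_frame_one, of "blocks (twos n)" ?L "blk 0"] by simp
      moreover have "blocks (twos x) \<oplus> frame (frame ?L \<oplus> blk 1) =
          blocks (twos n) \<oplus> (blk 2 \<oplus> blk 2 \<oplus> frame (frame ?L \<oplus> blk 1))"
      proof -
        have "twos x = twos n @ [2, 2]"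
          by (simp add: 3 replicate_app_Cons_same replicate_append_same)
        then show ?thesis
          by (simp only: blocks_append blocks.simps osum_assoc osum_blk_0)
      qed
      moreover have "blocks (twos n) \<oplus> (frame (blk 2) \<oplus> blk 3 \<oplus> ?L \<oplus> blk 2) = blocks (twos n @ [4] @ 3 # L @ [2])"
        by (simp add: blocks_append frame_blk)
      ultimately have "conv (blocks (twos x) \<oplus> frame (frame ?L \<oplus> blk 1)) (blocks (twos n @ [4] @ 3 # L @ [2]))"
        by (simp only: gconv_conv)
      moreover have "twos n @ [4] @ 3 # L @ [2] \<approx> 4 # twos n @ 3 # L @ [2]"
        using glconv_context[OF glconv_sym[OF four_twos[of n]], of "[]" "3 # L @ [2]"] by simp
      moreover have "4 # twos n @ 3 # L @ [2] \<sim> twos x @ 3 # L @ [2]"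
        using lconv_suffix[OF four_twos_three[of n], of "L @ [2]"] by (simp add: 3)
      ultimately show ?thesis
        unfolding lconv_def glconv_def by (meson conv_trans gconv_conv)
    qed
  qed
  from conv_osum[OF this, of "blk m \<oplus> blk 2"]
  have "conv (blocks (twos x) \<oplus> frame (frame ?L \<oplus> blk 1) \<oplus> blk m \<oplus> blk 2) (blocks (twos x @ 3 # L @ [2, m, 2]))"
    by (simp add: blocks_append osum_assoc)
  moreover have "conv (blocks (twos x @ 3 # L @ [m + 4])) (blocks (twos x) \<oplus> frame (frame ?L \<oplus> blk 1) \<oplus> blk m \<oplus> blk 2)"
    using gconv_conv[OF gconv_osum[OF gconv_frame_block_ge4[of "blk 1" ?L "blk m"], of "blocks (twos x)" "blk 0"]]
    by (simp add: blocks_append frame_blk)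
  ultimately show ?thesis
    unfolding lconv_def using conv_trans by blast
qed

lemma two_four_word_nonempty:
  assumes "set P \<subseteq> {2, 4}" and "P \<noteq> []"
  obtains (twos) x where "P \<approx> twos (Suc x)" | (four) x where "P \<approx> 4 # twos x"
proof -
  from assms have "0 < sum_list P"
    by (cases P) auto
  show thesis
    using assms(1)
  proof (cases rule: two_four_word)
    case (twos x)
    with \<open>0 < sum_list P\<close> obtain y where "x = Suc y"
      by (cases x) auto
    with twos that(1) show thesis by blast
  next
    case (four x)
    with that(2) show thesis by blast
  qed
qed

lemma split_block:
  obtains (even) P where "set P \<subseteq> {2, 4}" "sum_list P = c + 2" "[2, c] \<approx> P"
  | (one) P y where "set P \<subseteq> {2, 4}" "P \<noteq> []" "2 \<le> c \<longrightarrow> 1 \<le> y" "[2, c] \<approx> P @ 1 # twos y"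
  | (three) P y where "set P \<subseteq> {2, 4}" "P \<noteq> []" "[2, c] \<approx> P @ 3 # twos y"
proof -
  obtain P y where P: "set P \<subseteq> {2, 4}" "P \<noteq> []" "4 \<le> c \<longrightarrow> 1 \<le> y" "sum_list P + c mod 4 + 2 * y = 2 + c"
    "[2, c] \<approx> P @ [c mod 4] @ twos y"
    using split_block_aux[of 2 c] by blast
  have "c mod 4 < 4" by simp
  then consider "c mod 4 = 0" | "c mod 4 = 1" | "c mod 4 = 2" | "c mod 4 = 3"
    by linarith
  then show thesis
  proof cases
    case 1
    with P have "[2, c] \<approx> P @ twos y"
      by (simp add: glconv_def blocks_zero)
    moreover have "sum_list (P @ twos y) = c + 2"
      using P 1 by (simp add: sum_list_replicate)
    ultimately show thesis
      using P(1) by (intro even[of "P @ twos y"]) auto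
  next
    case 2
    \<comment> \<open>The sizes 2 and 3 are not congruent to 1 modulo 4.\<close>
    then have "2 \<le> c \<longrightarrow> 4 \<le> c"
      by presburger
    with P 2 show thesis
      by (intro one[of P y]) auto
  next
    case 3
    then show thesis
      using P by (intro even[of "P @ 2 # twos y"]) (auto simp: sum_list_replicate)
  next
    case 4
    with P show thesis
      by (intro three[of P y]) auto
  qed
qed

text \<open>The last letter of \<open>V\<close> takes part in stripping four letters from the
  5-block, of which a 1-block remains.\<close>

lemma word_five:
  assumes "set V \<subseteq> {2, 4}" and "V \<noteq> []"
  obtains V' where "set V' \<subseteq> {2, 4}" "V' \<noteq> []" "V @ [5] \<approx> V' @ [1, 2]"
proof -
  obtain U h where V: "V = U @ [h]" "h = 2 \<or> h = 4" "set U \<subseteq> {2, 4}"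
    using assms by (cases V rule: rev_cases) auto
  have "[2, 5] \<approx> [4] @ [1, 2]" "[4, 5] \<approx> [2, 2, 2] @ [1, 2]"
    using two_ge4[of 1] four_ge4[of 1] by simp_all
  with V(2) obtain W where W: "[h, 5] \<approx> W @ [1, 2]" "set W \<subseteq> {2, 4}" "W \<noteq> []"
    using that by (metis empty_subsetI insert_subset insert_iff list.distinct(1) list.set(1) list.simps(15))
  show thesis
    using that[of "U @ W"] glconv_context[OF W(1), of U "[]"] V W by simp
qed

text \<open>\<open>m\<close> tells whether a 1-block lies between the two blocks. Reading
  \<open>merge_block\<close> backwards enlarges the final 2-block to size 4 or 5 and puts a 2-block
  in front, so \<open>split_block\<close> applies. The bound 6 makes the middle size at least 2;
  this secures several big blocks, and a 2-block in front of a final 5-block.\<close>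

lemma big_block_two:
  assumes "6 \<le> k" and "m \<le> 1"
  shows "\<exists>M. [k, m, 2] \<sim> M \<and> typed M"
proof -
  define c where "c = k - 4"
  have c: "k = c + 4" "2 \<le> c" using assms(1) by (auto simp: c_def)
  have start: "[k, m, 2] \<approx> [2, c, m + 4]"
    using glconv_sym[OF merge_block[of c m]] by (simp add: c)
  have m: "m = 0 \<or> m = 1" using assms(2) by auto
  have next2: "[k, m, 2] \<approx> Q @ [m + 4]" if "[2, c] \<approx> Q" for Q
    using glconv_trans[OF start] glconv_context[OF that, of "[]" "[m + 4]"] by simp
  show ?thesis
  proof (cases rule: split_block[of c])
    case (even P)
    show ?thesis
    proof (cases "m = 0")
      case True
      \<comment> \<open>A sum of at least 8 rules out normal forms with just one block.\<close>
      have w: "set (P @ [4]) \<subseteq> {2, 4}" "sum_list (P @ [4]) \<ge> 8"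
        using even c by auto
      from next2[OF even(3)] True have start': "[k, m, 2] \<approx> P @ [4]" by simp
      from w(1) show ?thesis
      proof (cases rule: two_four_word)
        case (twos x)
        then have "typed (twos x)"
          using w(2) by (intro typed2I) (auto simp: multi_big_def)
        then show ?thesis using glconv_lconv[OF glconv_trans[OF start' twos(1)]] by blast
      next
        case (four x)
        then have "typed (4 # twos x)"
          using w(2) by (intro typed4I[of _ "[]" x "[]"]) (auto simp: multi_big_def chains_no_one)
        then show ?thesis using glconv_lconv[OF glconv_trans[OF start' four(1)]] by blast
      qed
    next
      case False
      then have "m = 1" using m by simp
      obtain V where V: "set V \<subseteq> {2, 4}" "V \<noteq> []" "P @ [5] \<approx> V @ [1, 2]"
        using word_five[of P] even c by (metis add_is_0 sum_list.Nil zero_neq_numeral)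
      have start': "[k, m, 2] \<approx> V @ [1, 2]"
        using glconv_trans[OF next2[OF even(3)]] V(3) \<open>m = 1\<close> by simp
      from V(1,2) show ?thesis
      proof (cases rule: two_four_word_nonempty)
        case (twos x)
        have "typed (twos (Suc x) @ [1, 2])"
          by (intro typed2I) (auto simp: multi_big_def)
        moreover have "V @ [1, 2] \<approx> twos (Suc x) @ [1, 2]"
          using glconv_context[OF twos, of "[]" "[1, 2]"] by simp
        ultimately show ?thesis
          using glconv_lconv[OF glconv_trans[OF start']] by blast
      next
        case (four x)
        have "typed (4 # twos x @ [1, 2])"
          by (intro typed4I[of _ "[]" x "[[2]]"]) (auto simp: multi_big_def chains_no_one)
        moreover have "V @ [1, 2] \<approx> 4 # twos x @ [1, 2]"
          using glconv_context[OF four, of "[]" "[1, 2]"] by simp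
        ultimately show ?thesis
          using glconv_lconv[OF glconv_trans[OF start']] by blast
      qed
    qed
  next
    case (one P y)
    \<comment> \<open>The last block travels to the front of its chain. A 5-block first turns,
      together with a 2-block on its left, into \<open>[4, 1, 2]\<close>; this is where
      \<open>y\<close> has to be positive.\<close>
    have tail: "\<exists>y' T. (T = [] \<or> T = [1, 2]) \<and> twos y @ [m + 4] \<approx> 4 # twos y' @ T"
    proof (cases "m = 0")
      case True
      then show ?thesis
        using glconv_sym[OF four_twos[of y]] by (intro exI[of _ y] exI[of _ "[]"]) simp
    next
      case False
      then have "m = 1" using m by simp
      obtain y' where y': "y = Suc y'"
        using one(3) c by (cases y) auto
      have "twos y @ [m + 4] \<approx> twos y' @ [4, 1, 2]"
        using glconv_context[OF two_ge4[of 1], of "twos y'" "[]"] \<open>m = 1\<close>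
        by (simp add: y' replicate_app_Cons_same)
      also have "\<dots> \<approx> 4 # twos y' @ [1, 2]"
        using glconv_context[OF glconv_sym[OF four_twos[of y']], of "[]" "[1, 2]"] by simp
      finally show ?thesis by (intro exI[of _ y'] exI[of _ "[1, 2]"]) simp
    qed
    then obtain y' T where T: "T = [] \<or> T = [1, 2]" "twos y @ [m + 4] \<approx> 4 # twos y' @ T"
      by blast
    have "[k, m, 2] \<approx> P @ 1 # twos y @ [m + 4]"
      using next2[OF one(4)] by simp
    also have "\<dots> \<approx> P @ 1 # 4 # twos y' @ T"
      using glconv_context[OF T(2), of "P @ [1]" "[]"] by simp
    finally have start': "[k, m, 2] \<approx> P @ 1 # 4 # twos y' @ T" .
    from one(1,2) show ?thesis
    proof (cases rule: two_four_word_nonempty)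
      case (twos x)
      have "[k, m, 2] \<approx> twos (Suc x) @ 1 # 4 # twos y' @ T"
        using glconv_trans[OF start'] glconv_context[OF twos, of "[]" "1 # 4 # twos y' @ T"] by simp
      moreover have "typed (twos (Suc x) @ 1 # 4 # twos y' @ T)"
        using T(1) by (intro typed4I[of _ "[twos (Suc x)]" y' "tl (chains T)"])
          (auto simp: multi_big_def chains_no_one)
      ultimately show ?thesis using glconv_lconv by blast
    next
      case (four x)
      have "[k, m, 2] \<approx> 4 # twos x @ 1 # 4 # twos y' @ T"
        using glconv_trans[OF start'] glconv_context[OF four, of "[]" "1 # 4 # twos y' @ T"] by simp
      also have "\<dots> \<approx> twos x @ [4, 1, 4] @ twos y' @ T"
        using glconv_context[OF four_twos[of x], of "[]" "1 # 4 # twos y' @ T"] by simp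
      also have "\<dots> \<approx> twos x @ [2, 2, 1, 2, 2] @ twos y' @ T"
        by (rule glconv_context[OF four_one_four])
      finally have "[k, m, 2] \<approx> twos x @ [2, 2, 1, 2, 2] @ twos y' @ T" .
      moreover have "typed (twos x @ [2, 2, 1, 2, 2] @ twos y' @ T)"
        using T(1) by (intro typed2I) (auto simp: multi_big_def)
      ultimately show ?thesis using glconv_lconv by blast
    qed
  next
    case (three P y)
    have start': "[k, m, 2] \<approx> P @ 3 # twos y @ [m + 4]"
      using next2[OF three(3)] by simp
    \<comment> \<open>A 4-block in front of the 3-block dissolves, so that only 2-blocks precede it,
      as \<open>three_block_ge4\<close> demands.\<close>
    have "\<exists>x. P @ 3 # twos y @ [m + 4] \<sim> twos (Suc x) @ 3 # twos y @ [m + 4]"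
      using three(1,2)
    proof (cases rule: two_four_word_nonempty)
      case (twos x)
      then show ?thesis
        using glconv_lconv[OF glconv_context[OF twos, of "[]" "3 # twos y @ [m + 4]"]] by auto
    next
      case (four x)
      have "P @ 3 # twos y @ [m + 4] \<approx> 4 # twos x @ 3 # twos y @ [m + 4]"
        using glconv_context[OF four, of "[]" "3 # twos y @ [m + 4]"] by simp
      also have "\<dots> \<sim> twos (Suc (Suc x)) @ 3 # twos y @ [m + 4]"
        using lconv_suffix[OF four_twos_three[of x], of "twos y @ [m + 4]"] by simp
      finally show ?thesis by blast
    qed
    then obtain x where x: "P @ 3 # twos y @ [m + 4] \<sim> twos (Suc x) @ 3 # twos y @ [m + 4]"
      by blast
    note start'
    also note x
    also note three_block_ge4[of "Suc x" "twos y" m]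
    also have "twos (Suc x) @ 3 # twos y @ [2, m, 2] \<sim> twos (Suc x) @ 3 # twos y @ 2 # (if m = 0 then [2] else [1, 2])"
    proof -
      have "blocks (twos (Suc x) @ 3 # twos y @ [2, m, 2]) =
          blocks (twos (Suc x) @ 3 # twos y @ 2 # (if m = 0 then [2] else [1, 2]))"
        using m blocks_zero[of "twos (Suc x) @ 3 # twos y @ [2]" "[2]"] by auto
      then show ?thesis
        unfolding lconv_def by (metis conv_refl)
    qed
    finally have "[k, m, 2] \<sim> twos (Suc x) @ 3 # twos y @ 2 # (if m = 0 then [2] else [1, 2])" .
    moreover have "typed (twos (Suc x) @ 3 # twos y @ 2 # (if m = 0 then [2] else [1, 2]))"
    proof (cases "m = 0")
      case True
      then show ?thesis
        by (intro typed3I) (auto simp: multi_big_def chains_no_one)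
    next
      case False
      have "twos (Suc x) @ 3 # twos y @ [2, 1, 2] = (twos (Suc x) @ 3 # twos y @ [2]) @ Suc 0 # [2]" by simp
      then have "chains (twos (Suc x) @ 3 # twos y @ [2, 1, 2]) = [twos (Suc x) @ 3 # twos y @ [2], [2]]"
        by (simp only: chains_append_one) (simp add: chains_no_one)
      then show ?thesis using False
        by (intro typed3I) (auto simp: multi_big_def)
    qed
    ultimately show ?thesis by blast
  qed
qed

section \<open>Appending a block of size two or three\<close>

lemma typed_ones_context: "L \<sim> M \<Longrightarrow> typed M \<Longrightarrow> \<exists>N. replicate i 1 @ L \<sim> N \<and> typed N"
  using lconv_unit_context[of L M "replicate i 1" "[]"] typed_ones_prefix[of M i]
  by (metis append_Nil2 last_replicate replicate_empty unitlist_def)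

lemma type1_decomp:
  assumes "type1 L"
  obtains (ones) i where "L = replicate i 1" | (block) i k j where "L = replicate i 1 @ k # replicate j 1" "k \<noteq> 1"
proof (cases "filter (\<lambda>x. x \<noteq> 1) L")
  case Nil
  then have "L = replicate (length L) 1"
    by (intro replicate_eqI) (auto simp: filter_empty_conv)
  with ones show thesis .
next
  case (Cons k K)
  with assms have "filter (\<lambda>x. x \<noteq> 1) L = [k]"
    by (simp add: type1_iff)
  then obtain A B where AB: "L = A @ k # B" "\<forall>x\<in>set A. x = 1" "k \<noteq> 1" "filter (\<lambda>x. x \<noteq> 1) B = []"
    by (auto simp: filter_eq_Cons_iff)
  then have "A = replicate (length A) 1" "B = replicate (length B) 1"
    by (auto intro!: replicate_eqI simp: filter_empty_conv)
  with AB(1,3) block show thesis by metis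
qed

lemma unitlist_ones [simp]: "unitlist (replicate i (Suc 0))"
  by (cases "i = 0") (simp_all add: unitlist_def)

text \<open>The \<open>k\<close>-block with one 1-block behind it can be exchanged with 1-blocks. So
  at most one 1-block has to be considered between the \<open>k\<close>-block and an appended
  block.\<close>

lemma collect_ones:
  "replicate i 1 @ k # replicate (Suc j) 1 @ C \<sim> replicate (i + j) 1 @ k # 1 # C"
proof -
  have "replicate i 1 @ [k, 1] @ replicate j 1 @ C \<sim> replicate i 1 @ replicate j 1 @ [k, 1] @ C"
  proof -
    have "unitlist [k, 1]" by (simp add: unitlist_def)
    then show ?thesis by (intro lconv_swap_units) simp_all
  qed
  then show ?thesis by (simp add: replicate_add)
qed

lemma split_ones:
  "\<exists>i' m. m \<le> 1 \<and> replicate i 1 @ k # replicate j 1 @ C \<sim> replicate i' 1 @ k # replicate m 1 @ C"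
proof (cases j)
  case 0
  then show ?thesis by (intro exI[of _ i] exI[of _ 0]) (simp add: lconv_refl)
next
  case (Suc j')
  then show ?thesis
    using collect_ones[of i k j' C] by (intro exI[of _ "i + j'"] exI[of _ 1]) simp
qed

lemma lconv_typed_trans: "L \<sim> M \<Longrightarrow> \<exists>N. M \<sim> N \<and> typed N \<Longrightarrow> \<exists>N. L \<sim> N \<and> typed N"
  using lconv_trans by blast

text \<open>Brings an exceptional chain next to the last chain, where it can interact with an
  appended block.\<close>

lemma move_unit_last: "units us @ c @ 1 # units vs @ D \<sim> units (us @ vs) @ c @ 1 # D"
proof -
  have "units us @ (c @ [1]) @ units vs @ D \<sim> units us @ units vs @ (c @ [1]) @ D"
    by (rule lconv_swap_units) simp_all
  then show ?thesis by simp
qed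

lemma chains_snoc_decomp:
  assumes "chains L = us @ c # vs"
  obtains (last) "vs = []" "L = units us @ c"
  | (inner) ws d where "vs = ws @ [d]" "L = units us @ c @ 1 # units ws @ d"
proof -
  obtain us' c' where L: "L = units us' @ c'" "chains L = us' @ [c']"
    using chains_decomp by blast
  show thesis
  proof (cases vs rule: rev_cases)
    case Nil
    with L assms last show thesis by simp
  next
    case (snoc ws d)
    with L assms have "us' = us @ c # ws" "c' = d" by simp_all
    with L inner[of ws d] snoc show thesis by simp
  qed
qed

text \<open>Here Types 4 and 5 originate: \<open>[4, 2]\<close>, \<open>[4, 1, 2]\<close> and
  \<open>[5, 1, 2]\<close> are kept, and \<open>[5, 2]\<close> becomes \<open>[2, 1, 4]\<close>.
  From size 6 on the big block is broken up.\<close>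

lemma append_two_type1:
  assumes "type1 L" and "0 \<notin> set L"
  shows "\<exists>N. L @ [2] \<sim> N \<and> typed N"
  using assms(1)
proof (cases rule: type1_decomp)
  case (ones i)
  have "typed [2]"
    by (simp add: typed_def type1_iff)
  then show ?thesis
    using typed_ones_context[OF lconv_refl, of "[2]" i] ones by simp
next
  case (block i k j)
  obtain i' m where m: "m \<le> 1" "replicate i 1 @ k # replicate j 1 @ [2] \<sim> replicate i' 1 @ k # replicate m 1 @ [2]"
    using split_ones by blast
  have k: "k = 2 \<or> k = 3 \<or> k = 4 \<or> k = 5 \<or> 6 \<le> k"
    using block assms(2) by auto
  have "\<exists>N. k # replicate m 1 @ [2] \<sim> N \<and> typed N"
  proof (cases "m = 0")
    case True
    consider "k = 2" | "k = 3" | "k = 4" | "k = 5" | "6 \<le> k" using k by blast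
    then show ?thesis
    proof cases
      case 1
      have "typed [2, 2]" by (rule typed2I) (auto simp: multi_big_def)
      then show ?thesis using lconv_refl 1 True by auto
    next
      case 2
      have "typed [3, 2]" by (rule typed3I) (auto simp: multi_big_def chains_no_one)
      then show ?thesis using lconv_refl 2 True by auto
    next
      case 3
      have "typed [4, 2]" by (rule typed4I[of _ "[]" 1 "[]"]) (auto simp: multi_big_def)
      then show ?thesis using lconv_refl 3 True by auto
    next
      case 4
      have "typed [2, 1, 4]" by (rule typed4I[of _ "[[2]]" 0 "[]"]) (auto simp: multi_big_def)
      moreover have "[5, 2] \<sim> [2, 1, 4]"
        using glconv_lconv[OF glconv_sym[OF merge_block[of 1 0]]] by (simp add: lconv_def)
      ultimately show ?thesis using 4 True by auto
    next
      case 5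
      have "[k, 2] \<sim> [k, 0, 2]" by (simp add: lconv_def conv_refl)
      then show ?thesis using big_block_two[OF 5, of 0] lconv_typed_trans True by simp
    qed
  next
    case False
    then have m1: "m = 1" using m by simp
    consider "k = 2" | "k = 3" | "k = 4" | "k = 5" | "6 \<le> k" using k by blast
    then show ?thesis
    proof cases
      case 1
      have "typed [2, 1, 2]" by (rule typed2I) (auto simp: multi_big_def)
      then show ?thesis using lconv_refl 1 m1 by auto
    next
      case 2
      have "typed [3, 1, 2]" by (rule typed3I) (auto simp: multi_big_def)
      then show ?thesis using lconv_refl 2 m1 by auto
    next
      case 3
      have "typed [4, 1, 2]" by (rule typed4I[of _ "[]" 0 "[[2]]"]) (auto simp: multi_big_def)
      then show ?thesis using lconv_refl 3 m1 by auto
    next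
      case 4
      have "type5 [5, 1, 2]"
        unfolding type5_iff by (intro conjI exI[of _ "[]"] exI[of _ "[[2]]"]) (auto simp: multi_big_def)
      then have "typed [5, 1, 2]" by (simp add: typed_def)
      then show ?thesis using lconv_refl 4 m1 by auto
    next
      case 5
      then show ?thesis using big_block_two[OF 5, of 1] m1 by simp
    qed
  qed
  then have "\<exists>N. replicate i' 1 @ k # replicate m 1 @ [2] \<sim> N \<and> typed N"
    using typed_ones_context by blast
  then show ?thesis
    using lconv_typed_trans[OF m(2)] block(1) by simp
qed

lemma append_two_type5:
  assumes "type5 L"
  shows "\<exists>N. L @ [2] \<sim> N \<and> typed N"
proof -
  from assms obtain us vs where c: "chains L = us @ [5] # vs" "\<forall>d\<in>set us \<union> set vs. d = [] \<or> d = [2]" and "multi_big L"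
    unfolding type5_iff by blast
  have all: "\<forall>d\<in>set us \<union> set vs. 1 \<notin> set d \<and> set d \<subseteq> {2} \<and> 0 \<notin> set d"
  proof
    fix d assume "d \<in> set us \<union> set vs"
    from bspec[OF c(2) this] show "1 \<notin> set d \<and> set d \<subseteq> {2} \<and> 0 \<notin> set d"
      by auto
  qed
  have us: "\<forall>c\<in>set us. 1 \<notin> set c" "\<forall>c\<in>set us. set c \<subseteq> {2}" "\<forall>c\<in>set us. 0 \<notin> set c"
    using all by simp_all
  have vs: "\<forall>c\<in>set vs. 1 \<notin> set c" "\<forall>c\<in>set vs. set c \<subseteq> {2}" "\<forall>c\<in>set vs. 0 \<notin> set c"
    using all by simp_all
  have nz: "0 \<notin> set (units ws)" if "\<forall>c\<in>set ws. 0 \<notin> set c" for ws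
    using set_units[of ws] that by auto
  show ?thesis
    using c(1)
  proof (cases rule: chains_snoc_decomp)
    case last
    have "L @ [2] \<approx> units us @ [2, 1, 4]"
      using glconv_context[OF glconv_sym[OF merge_block[of 1 0]], of "units us" "[]"] last(2)
      by (simp add: glconv_def blocks_append)
    moreover have "typed (units us @ [2, 1, 4])"
      by (rule typed4I[of _ "us @ [[2]]" 0 "[]"]) (use us nz[of us] in \<open>simp_all add: chains_units multi_big_def\<close>)
    ultimately show ?thesis using glconv_lconv by blast
  next
    case (inner ws d)
    have d: "d = [] \<or> d = [2]" and ws: "\<forall>c\<in>set (us @ ws). 1 \<notin> set c" "\<forall>c\<in>set (us @ ws). set c \<subseteq> {2}" "\<forall>c\<in>set (us @ ws). 0 \<notin> set c"
      using c(2) us vs inner(1) by auto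
    show ?thesis
    proof (cases "d = []")
      case True
      \<comment> \<open>The appended 2-block forms the last chain on its own, so Type 5
        persists.\<close>
      have "type5 (L @ [2])"
        unfolding type5_iff
      proof (intro conjI exI)
        have "L @ [2] = units us @ [5] @ 1 # (units ws @ [2])"
          using inner(2) True by simp
        then show "chains (L @ [2]) = us @ [5] # (ws @ [[2]])"
          using us(1) ws(1) by (simp add: chains_units)
        show "multi_big (L @ [2])"
          using \<open>multi_big L\<close> by (rule multi_big_append(1))
        show "\<forall>d\<in>set us \<union> set (ws @ [[2]]). d = [] \<or> d = [2]"
          using c(2) inner(1) by simp
      qed
      moreover have "0 \<notin> set (L @ [2])"
        using inner(2) True nz[of us] nz[of ws] us ws by auto
      ultimately show ?thesis
        using lconv_refl typed_def by blast
    next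
      case False
      \<comment> \<open>A last chain of two 2-blocks violates Type 5. The 5-block passes over the
        1-block and then breaks up, leaving a 4-block.\<close>
      have "L @ [2] \<sim> units (us @ ws) @ [5] @ 1 # [2, 2]"
        using move_unit_last[of us "[5]" ws "[2, 2]"] inner(2) d False by simp
      also have "\<dots> \<approx> units (us @ ws) @ [2, 1, 5] @ [2]"
        using glconv_context[OF glconv_sym[OF merge_block[of 1 1]], of "units (us @ ws)" "[2]"] by simp
      also have "\<dots> \<approx> units (us @ ws) @ [2, 1] @ [2, 1, 4]"
        using glconv_context[OF glconv_sym[OF merge_block[of 1 0]], of "units (us @ ws) @ [2, 1]" "[]"]
        by (simp add: glconv_def blocks_append osum_assoc)
      finally have "L @ [2] \<sim> units (us @ ws) @ [2, 1] @ [2, 1, 4]" .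
      moreover have "typed (units (us @ ws) @ [2, 1] @ [2, 1, 4])"
        by (rule typed4I[of _ "us @ ws @ [[2], [2]]" 0 "[]"])
          (use ws nz[of us] nz[of ws] in \<open>simp_all add: chains_units multi_big_def\<close>)
      ultimately show ?thesis by blast
    qed
  qed
qed

section \<open>Large blocks in front of a final 3-block\<close>

lemma typed_three_twos: "1 \<le> x \<Longrightarrow> typed (twos x @ [3])"
  by (intro typed3I) (auto simp: multi_big_def chains_no_one)

lemma typed_twos_one_three: "1 \<le> x \<or> 1 \<le> a \<Longrightarrow> typed (twos x @ 1 # twos a @ [3])"
  by (intro typed3I) (auto simp: multi_big_def chains_no_one)

text \<open>The big block is a frame around a \<open>c\<close>-block, and in front of the 3-block
  this \<open>c\<close>-block can leave it, which gives \<open>[2, c, 3]\<close>. After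
  \<open>split_block\<close> the 3-block removes any 4-block, and a second 3-block is separated from
  it.\<close>

lemma big_block_three:
  assumes "4 \<le> k"
  shows "\<exists>N. [k, 3] \<sim> N \<and> typed N"
proof -
  define c where "c = k - 2"
  have c: "k = c + 2" "2 \<le> c" using assms by (auto simp: c_def)
  have start: "[k, 3] \<sim> [2, c, 3]"
    using frame_swap_three[of "blk c :: nat shape" "blk 0"]
    unfolding lconv_def c blocks.simps blk_add_2 by (simp add: frame_blk)
  show ?thesis
  proof (cases rule: split_block[of c])
    case (even P)
    have P: "[k, 3] \<sim> P @ [3]"
      using lconv_glconv_trans[OF start] glconv_context[OF even(3), of "[]" "[3]"] by simp
    from even(1) show ?thesis
    proof (cases rule: two_four_word)
      case (twos x)
      have "[k, 3] \<sim> twos x @ [3]"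
        using lconv_glconv_trans[OF P] glconv_context[OF twos(1), of "[]" "[3]"] by simp
      moreover have "1 \<le> x" using twos even(2) c by simp
      ultimately show ?thesis using typed_three_twos by blast
    next
      case (four x)
      have "[k, 3] \<sim> 4 # twos x @ [3]"
        using lconv_glconv_trans[OF P] glconv_context[OF four(1), of "[]" "[3]"] by simp
      then show ?thesis
        using lconv_trans[OF _ four_twos_three[of x]] typed_three_twos[of "x + 2"] by auto
    qed
  next
    case (one P y)
    have P: "[k, 3] \<sim> P @ 1 # twos y @ [3]"
      using lconv_glconv_trans[OF start] glconv_context[OF one(4), of "[]" "[3]"] by simp
    from one(1,2) show ?thesis
    proof (cases rule: two_four_word_nonempty)
      case (twos x)
      have "[k, 3] \<sim> twos (Suc x) @ 1 # twos y @ [3]"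
        using lconv_glconv_trans[OF P] glconv_context[OF twos(1), of "[]" "1 # twos y @ [3]"] by simp
      then show ?thesis using typed_twos_one_three[of "Suc x" y] by auto
    next
      case (four x)
      have "[k, 3] \<sim> 4 # twos x @ 1 # twos y @ [3]"
        using lconv_glconv_trans[OF P] glconv_context[OF four(1), of "[]" "1 # twos y @ [3]"] by simp
      then show ?thesis
        using lconv_trans[OF _ four_twos_one_twos_three[of x y]] typed_twos_one_three[of "x + 2" y] by auto
    qed
  next
    case (three P y)
    have P: "[k, 3] \<sim> P @ 3 # twos y @ [3]"
      using lconv_glconv_trans[OF start] glconv_context[OF three(3), of "[]" "[3]"] by simp
    have "\<exists>x. [k, 3] \<sim> twos x @ 3 # twos y @ [3]"
      using three(1)
    proof (cases rule: two_four_word)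
      case (twos x)
      show ?thesis
        using lconv_glconv_trans[OF P] glconv_context[OF twos(1), of "[]" "3 # twos y @ [3]"] by auto
    next
      case (four x)
      have "[k, 3] \<sim> 4 # twos x @ 3 # twos y @ [3]"
        using lconv_glconv_trans[OF P] glconv_context[OF four(1), of "[]" "3 # twos y @ [3]"] by simp
      also have "\<dots> \<sim> twos (x + 2) @ 3 # twos y @ [3]"
        using lconv_suffix[OF four_twos_three[of x], of "twos y @ [3]"] by simp
      finally show ?thesis by blast
    qed
    then obtain x where "[k, 3] \<sim> twos x @ 3 # twos y @ [3]" by blast
    then show ?thesis
      using lconv_trans[OF _ three_twos_three[of x y]] typed_twos_one_three[of "y + 1" x] by auto
  qed
qed

text \<open>To the right of a 3-block a single 4-block splits as well: it is the case
  \<open>m = 0\<close> of \<open>three_block_ge4\<close>.\<close>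

lemma three_word:
  assumes "set P \<subseteq> {2, 4}"
  obtains x where "3 # P \<sim> 3 # twos x"
  using assms
proof (cases rule: two_four_word)
  case (twos x)
  then show thesis
    using that glconv_lconv[OF glconv_context[OF twos(1), of "[3]" "[]"]] by simp
next
  case (four x)
  have "3 # P \<approx> 3 # twos x @ [4]"
    using glconv_context[OF glconv_trans[OF four(1) four_twos], of "[3]" "[]"] by simp
  also have "\<dots> \<sim> 3 # twos x @ [2, 0, 2]"
    using three_block_ge4[of 0 "twos x" 0] by simp
  also have "\<dots> \<sim> 3 # twos x @ [2, 2]"
  proof -
    have "blocks (3 # twos x @ [2, 0, 2]) = blocks (3 # twos x @ [2, 2])"
      using blocks_zero[of "3 # twos x @ [2]" "[2]"] by simp
    then show ?thesis
      unfolding lconv_def by (metis conv_refl)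
  qed
  also have "\<dots> = 3 # twos (x + 2)"
    by (simp add: replicate_app_Cons_same replicate_append_same)
  finally show thesis using that by blast
qed

lemma five_three: "[5, 3] \<sim> [2, 1, 2, 3]"
proof -
  have "[5, 3] \<sim> [2, 3, 3]"
    using frame_swap_three[of "blk 3 :: nat shape" "blk 0"] blk_add_2[of 3, where 'a = nat]
    by (simp add: lconv_def frame_blk)
  also have "\<dots> \<sim> [2, 1, 2, 3]"
    using three_twos_three[of 1 0] by simp
  finally show ?thesis .
qed

lemma five_one_three: "[5, 1, 3] \<sim> [2, 1, 2, 1, 3]"
proof -
  have "[5, 1, 3] \<sim> [3, 3, 3]"
    using frame_swap_three[of "blk 3 :: nat shape" "blk 1"] blk_add_2[of 3, where 'a = nat]
    by (simp add: lconv_def frame_blk)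
  also have "\<dots> \<sim> [2, 1, 3, 3]"
    using lconv_suffix[OF three_twos_three[of 0 0], of "[3]"] by simp
  also have "\<dots> \<sim> [2, 1, 2, 1, 3]"
    using lconv_unit_context[OF three_twos_three[of 0 0], of "[2, 1]" "[]"] by (simp add: unitlist_def)
  finally show ?thesis .
qed

text \<open>Exchanging the content of the big block with the 1-block gives
  \<open>[3, k - 2, 3]\<close>. From size 6 on, the middle block has at least four letters and
  splits because a 3-block precedes it; sizes 4 and 5 are separate.\<close>

lemma big_block_one_three:
  assumes "4 \<le> k"
  shows "\<exists>N. [k, 1, 3] \<sim> N \<and> typed N"
proof -
  have "k = 4 \<or> k = 5 \<or> k = (k - 6) + 6"
    using assms by linarith
  then consider "k = 4" | "k = 5" | m where "k = m + 6"
    by blast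
  then show ?thesis
  proof cases
    case 1
    then show ?thesis
      using four_one_three[of "[]"] typed_twos_one_three[of 2 0] by (auto simp: replicate_twos_2)
  next
    case 2
    then show ?thesis
      using five_one_three typed3I[of "[2, 1, 2, 1, 3]"] by (auto simp: multi_big_def)
  next
    case 3
    have "[k, 1, 3] \<sim> [3, m + 4, 3]"
    proof -
      have "k = m + 4 + 2" by (simp add: 3)
      then show ?thesis
        using frame_swap_three[of "blk (m + 4) :: nat shape" "blk 1"]
        by (simp only: lconv_def blk_add_2 blocks.simps frame_blk osum_blk_0 One_nat_def)
    qed
    also have "\<dots> \<sim> [3, 2, m, 2, 3]"
      using lconv_suffix[OF three_block_ge4[of 0 "[]" m], of "[3]"] by simp
    finally have start: "[k, 1, 3] \<sim> [3] @ [2, m] @ [2, 3]" by simp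
    have next2: "[k, 1, 3] \<sim> 3 # Q @ [2, 3]" if "[2, m] \<approx> Q" for Q
      using lconv_glconv_trans[OF start glconv_context[OF that]] by simp
    have word: "[k, 1, 3] \<sim> M @ C" if "[k, 1, 3] \<sim> L @ C" "L \<sim> M" for L M C
      using lconv_trans[OF that(1) lconv_suffix[OF that(2)]] .
    show ?thesis
    proof (cases rule: split_block[of m])
      case (even P)
      obtain x where x: "3 # P @ [2] \<sim> 3 # twos x"
        using three_word[of "P @ [2]"] even(1) by auto
      have "[k, 1, 3] \<sim> (3 # twos x) @ [3]"
        by (rule word[OF _ x]) (use next2[OF even(3)] in simp)
      then show ?thesis
        using lconv_trans[OF _ three_twos_three[of 0 x]] typed_twos_one_three[of "x + 1" 0] by auto
    next
      case (one P y)
      obtain x where x: "3 # P \<sim> 3 # twos x"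
        using three_word one(1) by blast
      have "[k, 1, 3] \<sim> (3 # twos x) @ 1 # twos (y + 1) @ [3]"
        by (rule word[OF _ x]) (use next2[OF one(4)] in \<open>simp add: replicate_app_Cons_same\<close>)
      moreover have "typed ((3 # twos x) @ 1 # twos (y + 1) @ [3])"
        by (intro typed3I) (auto simp: multi_big_def chains_no_one Let_def)
      ultimately show ?thesis by blast
    next
      case (three P y)
      obtain x where x: "3 # P \<sim> 3 # twos x"
        using three_word three(1) by blast
      have "[k, 1, 3] \<sim> (3 # twos x) @ 3 # twos (y + 1) @ [3]"
        by (rule word[OF _ x]) (use next2[OF three(3)] in \<open>simp add: replicate_app_Cons_same\<close>)
      \<comment> \<open>The three 3-blocks are separated from left to right; the first new 1-block
        justifies rewriting behind it.\<close>
      also have "\<dots> \<sim> (twos (x + 1) @ [1, 3]) @ twos (y + 1) @ [3]"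
        using lconv_suffix[OF three_twos_three[of 0 x], of "twos (y + 1) @ [3]"] by simp
      also have "\<dots> \<sim> (twos (x + 1) @ [1]) @ (twos (y + 2) @ [1, 3])"
        using lconv_unit_context[OF three_twos_three[of 0 "y + 1"] unitlist_simps(2)[of "twos (x + 1)"], of "[]"] by simp
      finally have "[k, 1, 3] \<sim> twos (x + 1) @ 1 # twos (y + 2) @ [1, 3]" by simp
      moreover have "typed (twos (x + 1) @ 1 # twos (y + 2) @ [1, 3])"
        by (intro typed3I) (auto simp: multi_big_def chains_no_one Let_def)
      ultimately show ?thesis by blast
    qed
  qed
qed

lemma append_three_type1:
  assumes "type1 L" and "0 \<notin> set L"
  shows "\<exists>N. L @ [3] \<sim> N \<and> typed N"
  using assms(1)
proof (cases rule: type1_decomp)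
  case (ones i)
  have "typed [3]"
    by (simp add: typed_def type1_iff)
  then show ?thesis
    using typed_ones_context[OF lconv_refl, of "[3]" i] ones by simp
next
  case (block i k j)
  obtain i' m where m: "m \<le> 1" "replicate i 1 @ k # replicate j 1 @ [3] \<sim> replicate i' 1 @ k # replicate m 1 @ [3]"
    using split_ones by blast
  have k: "k = 2 \<or> k = 3 \<or> 4 \<le> k"
    using block assms(2) by auto
  have "\<exists>N. k # replicate m 1 @ [3] \<sim> N \<and> typed N"
  proof (cases "m = 0")
    case True
    consider "k = 2" | "k = 3" | "4 \<le> k" using k by blast
    then show ?thesis
    proof cases
      case 1
      then show ?thesis using lconv_refl typed_three_twos[of 1] True by auto
    next
      case 2
      then show ?thesis
        using three_twos_three[of 0 0] typed_twos_one_three[of 1 0] True by auto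
    next
      case 3
      then show ?thesis using big_block_three True by simp
    qed
  next
    case False
    then have m1: "m = 1" using m by simp
    consider "k = 2" | "k = 3" | "4 \<le> k" using k by blast
    then show ?thesis
    proof cases
      case 1
      then show ?thesis using lconv_refl typed_twos_one_three[of 1 0] m1 by auto
    next
      case 2
      have "typed [3, 1, 3]" by (rule typed3I) (auto simp: multi_big_def)
      then show ?thesis using lconv_refl 2 m1 by auto
    next
      case 3
      then show ?thesis using big_block_one_three m1 by simp
    qed
  qed
  then have "\<exists>N. replicate i' 1 @ k # replicate m 1 @ [3] \<sim> N \<and> typed N"
    using typed_ones_context by blast
  then show ?thesis
    using lconv_typed_trans[OF m(2)] block(1) by simp
qed

section \<open>Appending a block to lists of the other types\<close>

lemma append_two_type4:
  assumes "type4 L" and "0 \<notin> set L"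
  shows "typed (L @ [2])"
proof -
  from assms obtain us m vs where c: "chains L = us @ (4 # twos m) # vs" "\<forall>d\<in>set us \<union> set vs. set d \<subseteq> {2}" and "multi_big L"
    unfolding type4_iff by blast
  obtain ws d where L: "L = units ws @ d" "chains L = ws @ [d]" "\<forall>c\<in>set (ws @ [d]). 1 \<notin> set c"
    using chains_decomp by blast
  have "chains (L @ [2]) = ws @ [d @ [2]]"
    using L by (simp add: chains_units chains_no_one)
  moreover have "multi_big (L @ [2])"
    using \<open>multi_big L\<close> by (rule multi_big_append(1))
  moreover have "0 \<notin> set (L @ [2])"
    using assms(2) by simp
  ultimately show ?thesis
  proof (cases vs rule: rev_cases)
    case Nil
    with L c have "ws = us" "d = 4 # twos m" by simp_all
    with \<open>chains (L @ [2]) = ws @ [d @ [2]]\<close> have "chains (L @ [2]) = us @ (4 # twos (Suc m)) # []"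
      by (simp add: replicate_append_same)
    then show ?thesis
      by (rule typed4I) (use c(2) Nil \<open>multi_big (L @ [2])\<close> \<open>0 \<notin> set (L @ [2])\<close> in simp_all)
  next
    case (snoc vs' v)
    with L c have "ws = us @ (4 # twos m) # vs'" "d = v" by simp_all
    with \<open>chains (L @ [2]) = ws @ [d @ [2]]\<close> have "chains (L @ [2]) = us @ (4 # twos m) # (vs' @ [v @ [2]])"
      by simp
    then show ?thesis
      by (rule typed4I) (use c(2) snoc \<open>multi_big (L @ [2])\<close> \<open>0 \<notin> set (L @ [2])\<close> in simp_all)
  qed
qed

lemma append_two_type3:
  assumes "type3 L" and "0 \<notin> set L"
  shows "typed (L @ [2])"
proof -
  obtain ws d where L: "L = units ws @ d" "chains L = ws @ [d]" "\<forall>c\<in>set (ws @ [d]). 1 \<notin> set c"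
    using chains_decomp by blast
  have c: "chains (L @ [2]) = ws @ [d @ [2]]"
    using L by (simp add: chains_units chains_no_one)
  have I: "formI (d @ [2])" if "formI d"
  proof -
    from that obtain u v where "d = u @ 3 # v" "set u \<subseteq> {2}" "set v \<subseteq> {2}"
      unfolding formI_iff by blast
    then show ?thesis
      unfolding formI_iff by (intro exI[of _ u] exI[of _ "v @ [2]"]) simp
  qed
  have 3: "chain3 (d @ [2])" if "chain3 d"
    using that I unfolding chain3_def by auto
  show ?thesis
    using assms I 3 unfolding type3_iff L(2)
    by (intro typed3I) (auto simp: c multi_big_append)
qed

lemma append_two: "typed L \<Longrightarrow> \<exists>N. L @ [2] \<sim> N \<and> typed N"
proof -
  assume L: "typed L"
  then have "0 \<notin> set L" by (simp add: typed_def)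
  from L consider "type1 L" | "type2 L" | "type3 L" | "type4 L" | "type5 L"
    by (auto simp: typed_def)
  then show ?thesis
  proof cases
    case 2
    then have "typed (L @ [2])"
      unfolding type2_iff by (intro typed2I) (auto simp: multi_big_append)
    then show ?thesis using lconv_refl by blast
  qed (use append_two_type1 append_two_type3 append_two_type4 append_two_type5 \<open>0 \<notin> set L\<close> lconv_refl in blast)+
qed

lemma units_zero: "\<forall>c\<in>set us. 0 \<notin> set c \<Longrightarrow> 0 \<notin> set (units us)"
  using set_units[of us] by auto

lemma typed_units_three:
  assumes "\<forall>c\<in>set us. chain3 c \<and> 1 \<notin> set c \<and> 0 \<notin> set c" and "chain3 d" "1 \<notin> set d" "0 \<notin> set d"
    and "\<exists>c\<in>set (us @ [d]). formI c" and "multi_big (units us @ d)"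
  shows "typed (units us @ d)"
proof (rule typed3I)
  have "chains (units us @ d) = us @ [d]"
    using assms by (simp add: chains_units chains_no_one)
  then show "\<forall>c\<in>set (chains (units us @ d)). chain3 c" "\<exists>c\<in>set (chains (units us @ d)). formI c"
    using assms by simp_all
  show "0 \<notin> set (units us @ d)"
    using assms units_zero[of us] by simp
qed (rule assms)

lemma two_chain: "set c \<subseteq> {2} \<Longrightarrow> chain3 c \<and> 1 \<notin> set c \<and> 0 \<notin> set c"
  by auto

lemma append_three_twos_chains:
  assumes "\<forall>c\<in>set us. chain3 c \<and> 1 \<notin> set c \<and> 0 \<notin> set c" and "set d \<subseteq> {2}" and "multi_big (units us @ d @ [3])"
  shows "typed (units us @ d @ [3])"
  by (rule typed_units_three) (use assms in auto)

lemma append_three_type2: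
  assumes "type2 L"
  shows "typed (L @ [3])"
proof -
  obtain us d where L: "L = units us @ d" "chains L = us @ [d]"
    using chains_decomp by blast
  have "set c \<subseteq> {2}" if "c \<in> set (us @ [d])" for c
    using assms that unfolding type2_def L(2) by auto
  moreover have "multi_big (units us @ d @ [3])"
    using assms multi_big_append(1)[of L "[3]"] by (simp add: L type2_def)
  ultimately show ?thesis
    unfolding L(1) append_assoc by (intro append_three_twos_chains ballI two_chain) simp_all
qed

lemma append_three_type3:
  assumes "type3 L" and "0 \<notin> set L"
  shows "\<exists>N. L @ [3] \<sim> N \<and> typed N"
proof -
  obtain us d where L: "L = units us @ d" "chains L = us @ [d]" "\<forall>c\<in>set (us @ [d]). 1 \<notin> set c"
    using chains_decomp by blast
  have us: "\<forall>c\<in>set us. chain3 c \<and> 1 \<notin> set c \<and> 0 \<notin> set c"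
  proof
    fix c assume c: "c \<in> set us"
    then have "set c \<subseteq> set L"
      using set_concat_chains[of L] by (auto simp: L(2))
    with c show "chain3 c \<and> 1 \<notin> set c \<and> 0 \<notin> set c"
      using assms L unfolding type3_iff by auto
  qed
  have "chain3 d"
    using assms L unfolding type3_iff by simp
  then consider "set d \<subseteq> {2}" | "formI d"
    unfolding chain3_def by blast
  then show ?thesis
  proof cases
    case 1
    have "multi_big (units us @ d @ [3])"
      using assms multi_big_append(1)[of L "[3]"] by (simp add: L type3_def)
    then have "typed (L @ [3])"
      using append_three_twos_chains[OF us 1] by (simp add: L)
    then show ?thesis using lconv_refl by blast
  next
    case 2
    then obtain a b where d: "d = twos a @ 3 # twos b"
      unfolding formI_def by auto
    \<comment> \<open>Two 3-blocks in the last chain get separated by a new 1-block.\<close>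
    have "L @ [3] \<sim> units us @ twos (b + 1) @ 1 # twos a @ [3]"
      using lconv_unit_context[OF three_twos_three[of a b] unitlist_units[of us], of "[]"] by (simp add: L d)
    moreover have "typed (units (us @ [twos (b + 1)]) @ twos a @ [3])"
      by (rule append_three_twos_chains) (use us in \<open>auto simp: multi_big_def\<close>)
    ultimately show ?thesis by auto
  qed
qed

text \<open>The new 3-block dissolves the 4-block once the chain of the latter is last or next to
  last; the outcome is of Type 3.\<close>

lemma append_three_type4:
  assumes "type4 L"
  shows "\<exists>N. L @ [3] \<sim> N \<and> typed N"
proof -
  from assms obtain us m vs where c: "chains L = us @ (4 # twos m) # vs" "\<forall>d\<in>set us \<union> set vs. set d \<subseteq> {2}"
    unfolding type4_iff by blast
  show ?thesis
    using c(1)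
  proof (cases rule: chains_snoc_decomp)
    case last
    have "L @ [3] \<sim> units us @ twos (m + 2) @ [3]"
      using lconv_unit_context[OF four_twos_three[of m] unitlist_units[of us], of "[]"] by (simp add: last)
    moreover have "typed (units us @ twos (m + 2) @ [3])"
      by (intro append_three_twos_chains ballI two_chain) (use c(2) in \<open>simp_all add: multi_big_def\<close>)
    ultimately show ?thesis by blast
  next
    case (inner ws d)
    then obtain b where d: "d = twos b"
      using c(2) all_twos[of d] by auto
    have "L @ [3] \<sim> units (us @ ws) @ (4 # twos m) @ 1 # twos b @ [3]"
      using move_unit_last[of us "4 # twos m" ws "twos b @ [3]"] by (simp add: inner d)
    also have "\<dots> \<sim> units (us @ ws) @ twos (m + 2) @ 1 # twos b @ [3]"
      using lconv_unit_context[OF four_twos_one_twos_three[of m b] unitlist_units[of "us @ ws"], of "[]"] by simp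
    also have "\<dots> = units ((us @ ws) @ [twos (m + 2)]) @ twos b @ [3]"
      by simp
    finally have "L @ [3] \<sim> units ((us @ ws) @ [twos (m + 2)]) @ twos b @ [3]" .
    moreover have "typed (units ((us @ ws) @ [twos (m + 2)]) @ twos b @ [3])"
      by (intro append_three_twos_chains ballI two_chain) (use c(2) inner(1) in \<open>auto simp: multi_big_def\<close>)
    ultimately show ?thesis by blast
  qed
qed

lemma append_three_type5:
  assumes "type5 L"
  shows "\<exists>N. L @ [3] \<sim> N \<and> typed N"
proof -
  from assms obtain us vs where c: "chains L = us @ [5] # vs" "\<forall>d\<in>set us \<union> set vs. d = [] \<or> d = [2]"
    unfolding type5_iff by blast
  have two: "\<forall>d\<in>set us \<union> set vs. set d \<subseteq> {2}"
  proof
    fix d assume "d \<in> set us \<union> set vs"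
    from bspec[OF c(2) this] show "set d \<subseteq> {2}" by auto
  qed
  show ?thesis
    using c(1)
  proof (cases rule: chains_snoc_decomp)
    case last
    have "L @ [3] \<sim> units (us @ [[2]]) @ [2] @ [3]"
      using lconv_unit_context[OF five_three unitlist_units[of us], of "[]"] by (simp add: last)
    moreover have "typed (units (us @ [[2]]) @ [2] @ [3])"
      by (intro append_three_twos_chains ballI two_chain) (use two in \<open>auto simp: multi_big_def\<close>)
    ultimately show ?thesis by blast
  next
    case (inner ws d)
    have L: "L @ [3] \<sim> units (us @ ws) @ [5, 1] @ d @ [3]"
      using move_unit_last[of us "[5]" ws "d @ [3]"] by (simp add: inner)
    have d: "d = [] \<or> d = [2]" using c(2) inner(1) by simp
    have "L @ [3] \<sim> units ((us @ ws) @ [[2], [2]]) @ d @ [3]"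
    proof (cases "d = []")
      case True
      then show ?thesis
        using lconv_trans[OF L] lconv_unit_context[OF five_one_three unitlist_units[of "us @ ws"], of "[]"] by simp
    next
      case False
      \<comment> \<open>The 5-block passes over the 1-block and so meets the 3-block.\<close>
      have "units (us @ ws) @ [5, 1, 2] @ [3] \<approx> units (us @ ws) @ [2, 1, 5] @ [3]"
        using glconv_context[OF glconv_sym[OF merge_block[of 1 1]], of "units (us @ ws)" "[3]"] by simp
      also have "\<dots> = units ((us @ ws) @ [[2]]) @ [5, 3] @ []" by simp
      also have "\<dots> \<sim> units ((us @ ws) @ [[2]]) @ [2, 1, 2, 3] @ []"
        by (rule lconv_unit_context[OF five_three unitlist_units])
      finally show ?thesis
        using lconv_trans[OF L] d False by simp
    qed
    moreover have "typed (units ((us @ ws) @ [[2], [2]]) @ d @ [3])"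
      by (intro append_three_twos_chains ballI two_chain) (use two d inner(1) in \<open>auto simp: multi_big_def\<close>)
    ultimately show ?thesis by blast
  qed
qed

lemma append_three: "typed L \<Longrightarrow> \<exists>N. L @ [3] \<sim> N \<and> typed N"
proof -
  assume L: "typed L"
  then have "0 \<notin> set L" by (simp add: typed_def)
  from L consider "type1 L" | "type2 L" | "type3 L" | "type4 L" | "type5 L"
    by (auto simp: typed_def)
  then show ?thesis
    by cases (use append_three_type1 append_three_type2 append_three_type3 append_three_type4 append_three_type5
        \<open>0 \<notin> set L\<close> lconv_refl in blast)+
qed

section \<open>Bringing a core into typed form\<close>

text \<open>If the first letter of \<open>X\<close> is last in \<open>Y\<close>, it can be deleted
  from both words; otherwise it forms the required pair with its successor in
  \<open>Y\<close>.\<close>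

lemma ex_same_order:
  assumes "distinct X" and "distinct Y" and "set X = set Y" and "Y \<noteq> rev X"
  shows "\<exists>P b Q c R P' Q' R'. X = P @ b # Q @ c # R \<and> Y = P' @ b # Q' @ c # R'"
  using assms
proof (induction X arbitrary: Y)
  case (Cons x X)
  then obtain A B where Y: "Y = A @ x # B"
    by (metis list.set_intros(1) split_list)
  show ?case
  proof (cases B)
    case Nil
    with Y Cons.prems have "distinct A" "set A = set X" "A \<noteq> rev X"
      by auto
    moreover have "distinct X" using Cons.prems by simp
    ultimately obtain P b Q c R P' Q' R' where
      "X = P @ b # Q @ c # R" "A = P' @ b # Q' @ c # R'"
      using Cons.IH[of A] by metis
    then have "x # X = (x # P) @ b # Q @ c # R" "Y = P' @ b # Q' @ c # R' @ [x]"
      using Y Nil by simp_all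
    then show ?thesis by blast
  next
    case (Cons c B')
    with Y Cons.prems have "c \<in> set X"
      by auto
    then obtain Q R where "X = Q @ c # R"
      by (meson split_list)
    then have "x # X = [] @ x # Q @ c # R" "Y = A @ x # [] @ c # B'"
      using Y Cons by simp_all
    then show ?thesis by blast
  qed
qed simp

lemma ex_inverted:
  assumes "distinct X" and "distinct Y" and "set X = set Y" and "X \<noteq> Y"
  shows "\<exists>P f Q g R P' Q' R'. X = P @ f # Q @ g # R \<and> Y = P' @ g # Q' @ f # R'"
proof -
  obtain P b Q c R P' Q' R' where *: "X = P @ b # Q @ c # R" "rev Y = P' @ b # Q' @ c # R'"
    using ex_same_order[of X "rev Y"] assms by auto
  then have "Y = rev R' @ c # rev Q' @ b # rev P'"
    by (metis append.assoc append_Cons append_Nil rev.simps(2) rev_append rev_rev_ident)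
  with * show ?thesis by blast
qed

definition matching :: "'a list \<times> 'a list \<Rightarrow> bool" where
  "matching p \<longleftrightarrow> distinct (fst p) \<and> distinct (snd p) \<and> set (fst p) = set (snd p)"

lemma matching_iff: "matching (X, Y) \<longleftrightarrow> distinct X \<and> distinct Y \<and> set X = set Y"
  by (simp add: matching_def)

lemma matching_mset:
  "mset X' = mset X \<Longrightarrow> mset Y' = mset Y \<Longrightarrow> matching (X', Y') = matching (X, Y)"
  unfolding matching_iff by (metis mset_eq_imp_distinct_iff mset_eq_setD)

lemma ceq_unit_swap_suffix:
  "ceq (P @ b # Q @ c # R, P' @ b # Q' @ c # R') (Q @ c # P @ b # R, Q' @ c # P' @ b # R')"
  using ceq_suffix[OF ceq_unit_swap, of P b Q c R P' Q' R'] by simp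

text \<open>A letter common to \<open>X2\<close> and \<open>Y1\<close> precedes \<open>s\<close> in
  both rows, one common to \<open>Y2\<close> and \<open>X1\<close> precedes \<open>t\<close> in
  both; an exchange of units makes it the new end of a row and shortens \<open>X2\<close> or
  \<open>Y2\<close>. Without such letters \<open>X2\<close> and \<open>Y2\<close> have the same
  letters, and a pair in the same order can be used.\<close>

lemma reversed_suffix_framed:
  assumes "matching (X1 @ t # X2 @ [s], Y1 @ s # Y2 @ [t])"
  shows "\<exists>A A' Z. matching (A @ Z, A' @ rev Z) \<and> set A = set A' \<and> Z \<noteq> []
    \<and> set (A @ Z) = set (X1 @ t # X2 @ [s]) \<and> ceq (X1 @ t # X2 @ [s], Y1 @ s # Y2 @ [t]) (A @ Z, A' @ rev Z)"
  using assms
proof (induction "length X2 + length Y2" arbitrary: X1 t X2 s Y1 Y2 rule: less_induct)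
  case less
  note m = less.prems[unfolded matching_iff]
  have transfer: ?case
    if shorter: "length X2' + length Y2' < length X2 + length Y2"
      and top: "mset (X1' @ t' # X2' @ [s']) = mset (X1 @ t # X2 @ [s])"
      and bot: "mset (Y1' @ s' # Y2' @ [t']) = mset (Y1 @ s # Y2 @ [t])"
      and step: "ceq (X1 @ t # X2 @ [s], Y1 @ s # Y2 @ [t]) (X1' @ t' # X2' @ [s'], Y1' @ s' # Y2' @ [t'])"
    for X1' t' X2' s' Y1' Y2'
  proof -
    have match: "matching (X1' @ t' # X2' @ [s'], Y1' @ s' # Y2' @ [t'])"
      using less.prems matching_mset[OF top bot] by blast
    obtain A A' Z where Z: "matching (A @ Z, A' @ rev Z)" "set A = set A'" "Z \<noteq> []"
      "set (A @ Z) = set (X1' @ t' # X2' @ [s'])" "ceq (X1' @ t' # X2' @ [s'], Y1' @ s' # Y2' @ [t']) (A @ Z, A' @ rev Z)"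
      using less.hyps[OF shorter match] by blast
    show ?thesis
      by (intro exI conjI, rule Z(1), rule Z(2), rule Z(3), simp only: Z(4) mset_eq_setD[OF top], rule ceq_trans[OF step Z(5)])
  qed
  consider (top) b where "b \<in> set X2" "b \<in> set Y1" | (bot) b where "b \<in> set Y2" "b \<in> set X1"
    | (same) "set X2 \<inter> set Y1 = {}" "set Y2 \<inter> set X1 = {}"
    by blast
  then show ?case
  proof cases
    case top
    then obtain P Q P' Q' where s: "X2 = P @ b # Q" "Y1 = P' @ b # Q'"
      by (meson split_list)
    show ?thesis
    proof (rule transfer[of P Y2 "Q @ s # X1" t b "Q' @ s # P'"])
      show "ceq (X1 @ t # X2 @ [s], Y1 @ s # Y2 @ [t]) ((Q @ s # X1) @ t # P @ [b], (Q' @ s # P') @ b # Y2 @ [t])"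
        using ceq_unit_swap_suffix[of "X1 @ t # P" b Q s "[]" P' Q' "Y2 @ [t]"] by (simp add: s)
    qed (simp_all add: s)
  next
    case bot
    then obtain P Q P' Q' where s: "Y2 = P @ b # Q" "X1 = P' @ b # Q'"
      by (meson split_list)
    show ?thesis
    proof (rule transfer[of X2 P "Q' @ t # P'" b s "Q @ t # Y1"])
      show "ceq (X1 @ t # X2 @ [s], Y1 @ s # Y2 @ [t]) ((Q' @ t # P') @ b # X2 @ [s], (Q @ t # Y1) @ s # P @ [b])"
        using ceq_unit_swap_suffix[of P' b Q' t "X2 @ [s]" "Y1 @ s # P" Q "[]"] by (simp add: s)
    qed (simp_all add: s)
  next
    case same
    have "set X2 \<subseteq> set Y2"
      using m same(1) by auto
    moreover have "set Y2 \<subseteq> set X2"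
      using m same(2) by auto
    ultimately have X2: "set X2 = set Y2" ..
    show ?thesis
    proof (cases "Y2 = rev X2")
      case True
      have "set X1 = set Y1"
        using m X2 by auto
      then show ?thesis
        using less.prems True
        by (intro exI[of _ X1] exI[of _ Y1] exI[of _ "t # X2 @ [s]"]) (simp add: ceq_refl)
    next
      case False
      then obtain P b Q c R P' Q' R' where s: "X2 = P @ b # Q @ c # R" "Y2 = P' @ b # Q' @ c # R'"
        using ex_same_order[of X2 Y2] m X2 by auto
      show ?thesis
      proof (rule transfer[of "P @ b # R" "P' @ b # R'" "Q @ c # X1" t s "Q' @ c # Y1"])
        \<comment> \<open>The frame swap puts \<open>Q\<close> and \<open>c\<close> behind
          \<open>s\<close> on top; the exchange of the units ending in \<open>s\<close> and
          \<open>c\<close> then carries them to the front.\<close>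
        have "ceq (X1 @ t # X2 @ [s], Y1 @ s # Y2 @ [t])
            (X1 @ t # P @ b # R @ s # Q @ [c], Y1 @ s # Q' @ c # P' @ b # R' @ [t])"
          using ceq_frame_swap[of X1 t P b Q c R s Y1 P' Q' R'] by (simp add: s)
        moreover have "ceq (X1 @ t # P @ b # R @ s # Q @ [c], Y1 @ s # Q' @ c # P' @ b # R' @ [t])
            ((Q @ c # X1) @ t # (P @ b # R) @ [s], (Q' @ c # Y1) @ s # (P' @ b # R') @ [t])"
          using ceq_unit_swap_suffix[of "X1 @ t # P @ b # R" s Q c "[]" Y1 Q' "P' @ b # R' @ [t]"] by simp
        ultimately show "ceq (X1 @ t # X2 @ [s], Y1 @ s # Y2 @ [t])
            ((Q @ c # X1) @ t # (P @ b # R) @ [s], (Q' @ c # Y1) @ s # (P' @ b # R') @ [t])"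
          by (rule ceq_trans)
      qed (simp_all add: s)
    qed
  qed
qed

lemma reversed_suffix:
  assumes "matching (X, Y)" and "X \<noteq> []"
  shows "\<exists>A A' Z. matching (A @ Z, A' @ rev Z) \<and> set A = set A' \<and> Z \<noteq> []
    \<and> set (A @ Z) = set X \<and> ceq (X, Y) (A @ Z, A' @ rev Z)"
proof -
  obtain X' s where X: "X = X' @ [s]"
    using assms(2) by (cases X rule: rev_cases) auto
  then have "Y \<noteq> []"
    using assms(1) by (auto simp: matching_iff)
  then obtain Y' t where Y: "Y = Y' @ [t]"
    by (cases Y rule: rev_cases) auto
  show ?thesis
  proof (cases "s = t")
    case True
    then have "set X' = set Y'"
      using assms(1) X Y by (auto simp: matching_iff)
    then show ?thesis
      using assms(1) X Y True by (intro exI[of _ X'] exI[of _ Y'] exI[of _ "[s]"]) (simp add: ceq_refl)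
  next
    case False
    then have "t \<in> set X'" "s \<in> set Y'"
      using assms(1) X Y by (auto simp: matching_iff)
    then obtain X1 X2 Y1 Y2 where "X' = X1 @ t # X2" "Y' = Y1 @ s # Y2"
      by (meson split_list)
    then show ?thesis
      using reversed_suffix_framed[of X1 t X2 s Y1 Y2] assms(1) X Y by simp
  qed
qed

lemma blocks_snoc:
  assumes "(U, V) \<in> blocks L"
  shows "(U @ Z, V @ rev Z) \<in> blocks (L @ [length Z])"
proof -
  have "(Z, rev Z) \<in> blk (length Z)"
    by (simp add: blk_def)
  from osumI[OF assms this] show ?thesis
    by (simp add: blocks_append)
qed

lemma blocks_ones: "(X, X) \<in> blocks (replicate (length X) 1)"
proof (induction X)
  case (Cons x X)
  then show ?case
    using osumI[OF blk_1I[of x], of X X] by simp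
qed (simp add: blk_0)

lemma lconv_witness:
  fixes p :: "nat list \<times> nat list"
  shows "L \<sim> M \<Longrightarrow> p \<in> blocks L \<Longrightarrow> \<exists>q\<in>blocks M. ceq p q"
  by (simp add: lconv_def conv_def)

lemma ceq_typed:
  fixes X Y :: "nat list"
  assumes "matching (X, Y)"
  shows "\<exists>L. typed L \<and> (\<exists>q\<in>blocks L. ceq (X, Y) q)"
  using assms
proof (induction "length X" arbitrary: X Y rule: less_induct)
  case less
  have small: "\<exists>L. typed L \<and> (\<exists>q\<in>blocks L. ceq (A @ Z, A' @ rev Z) q)"
    if "matching (A @ Z, A' @ rev Z)" "set A = set A'" "length A < length X" "Z \<noteq> []" "length Z \<le> 3" for A A' Z :: "nat list"
  proof -
    have "matching (A, A')"
      using that by (auto simp: matching_iff)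
    from less.hyps[OF that(3) this] obtain L q where L: "typed L" "q \<in> blocks L" "ceq (A, A') q"
      by (auto simp: Bex_def)
    obtain U V where q: "q = (U, V)" by fastforce
    have k: "length Z = 1 \<or> length Z = 2 \<or> length Z = 3"
    proof -
      have "0 < length Z" using that(4) by simp
      then show ?thesis using that(5) by arith
    qed
    have "\<exists>N. L @ [length Z] \<sim> N \<and> typed N"
    proof -
      have "\<exists>N. L @ [1] \<sim> N \<and> typed N"
        using typed_append_one[OF L(1)] lconv_refl by blast
      then show ?thesis
        using k append_two[OF L(1)] append_three[OF L(1)] by (elim disjE) simp_all
    qed
    then obtain N where N: "L @ [length Z] \<sim> N" "typed N" by blast
    have "ceq (A @ Z, A' @ rev Z) (U @ Z, V @ rev Z)"
      using ceq_suffix L(3) q by blast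
    moreover obtain r where "r \<in> blocks N" "ceq (U @ Z, V @ rev Z) r"
      using lconv_witness[OF N(1) blocks_snoc] L(2) q by blast
    ultimately show ?thesis
      using N(2) ceq_trans by blast
  qed
  show ?case
  proof (cases "X = []")
    case True
    then have "(X, Y) \<in> blocks []"
      using less.prems by (simp add: blk_0 matching_iff)
    moreover have "typed []"
      by (simp add: typed_def type1_iff)
    ultimately show ?thesis
      using ceq_refl by blast
  next
    case False
    obtain A A' Z where Z: "matching (A @ Z, A' @ rev Z)" "set A = set A'" "Z \<noteq> []"
      "set (A @ Z) = set X" "ceq (X, Y) (A @ Z, A' @ rev Z)"
      using reversed_suffix[OF less.prems False] by blast
    have len: "length X = length A + length Z"
      using less.prems Z(1,4) by (metis distinct_card fst_conv length_append matching_def)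
    have "\<exists>L. typed L \<and> (\<exists>q\<in>blocks L. ceq (A @ Z, A' @ rev Z) q)"
    proof (cases "length Z \<le> 3")
      case True
      then show ?thesis
        using small[OF Z(1,2)] Z(3) len by simp
    next
      case big: False
      show ?thesis
      proof (cases "A = A'")
        case True
        \<comment> \<open>Equal rows in front of the block are 1-blocks, so the core is already of
          Type 1.\<close>
        have "(A @ Z, A' @ rev Z) \<in> blocks (replicate (length A) 1 @ [length Z])"
          using blocks_snoc[OF blocks_ones[of A]] True by simp
        moreover have "typed (replicate (length A) 1 @ [length Z])"
          using big by (auto simp: typed_def type1_iff)
        ultimately show ?thesis
          using ceq_refl by blast
      next
        case False
        \<comment> \<open>\<open>f\<close> and \<open>g\<close> serve as the frame in
          \<open>ceq_frame_block_ge4\<close>.\<close>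
        obtain P f Q g R P' Q' R' where A: "A = P @ f # Q @ g # R" "A' = P' @ g # Q' @ f # R'"
          using ex_inverted[of A A'] Z(1,2) False by (auto simp: matching_iff)
        obtain x1 x2 M x3 x4 where M: "Z = x1 # x2 # M @ [x3, x4]"
        proof -
          obtain x1 x2 Z1 where "Z = x1 # x2 # Z1" "2 \<le> length Z1"
            using big by (cases Z; cases "tl Z") auto
          moreover from this obtain Z2 x4 where "Z1 = Z2 @ [x4]" "1 \<le> length Z2"
            by (cases Z1 rule: rev_cases) auto
          moreover from this obtain M x3 where "Z2 = M @ [x3]"
            by (cases Z2 rule: rev_cases) auto
          ultimately show thesis using that by simp
        qed
        let ?B = "P @ f # x4 # R @ x1 # Q @ g # M" and ?B' = "P' @ g # x1 # R' @ x4 # Q' @ f # rev M"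
        have 1: "ceq (A @ Z, A' @ rev Z) (?B @ [x3, x2], ?B' @ rev [x3, x2])"
          using ceq_frame_block_ge4[of P f Q g R x1 x2 M x3 x4 P' Q' R' "rev M"] by (simp add: A M)
        have "set ?B = set ?B'"
          using Z(2) A by auto
        moreover have "matching (?B @ [x3, x2], ?B' @ rev [x3, x2])"
        proof -
          have "mset (?B @ [x3, x2]) = mset (A @ Z)" "mset (?B' @ rev [x3, x2]) = mset (A' @ rev Z)"
            by (simp_all add: A M)
          then show ?thesis
            using Z(1) matching_mset by blast
        qed
        moreover have "length ?B < length X"
          by (simp add: len A M)
        ultimately obtain L q where "typed L" "q \<in> blocks L" "ceq (?B @ [x3, x2], ?B' @ rev [x3, x2]) q"
          using small[of ?B "[x3, x2]" ?B'] by auto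
        with 1 show ?thesis
          using ceq_trans by blast
      qed
    qed
    with Z(5) show ?thesis
      using ceq_trans by blast
  qed
qed

section \<open>Rauzy classes of pairs\<close>

lemma rz_swap: "rz p q \<Longrightarrow> rz (snd p, fst p) (snd q, fst q)"
  by (erule rz.cases) (auto intro: rz.intros)

lemma rz_rtranclp_swap: "rz\<^sup>*\<^sup>* (T, B) (T', B') \<Longrightarrow> rz\<^sup>*\<^sup>* (B, T) (B', T')"
proof -
  have "rz\<^sup>*\<^sup>* p q \<Longrightarrow> rz\<^sup>*\<^sup>* (snd p, fst p) (snd q, fst q)" for p q :: "'a list \<times> 'a list"
    by (induction rule: rtranclp_induct) (auto dest: rz_swap intro: rtranclp.rtrancl_into_rtrancl)
  from this[of "(T, B)" "(T', B')"] show "rz\<^sup>*\<^sup>* (T, B) (T', B') \<Longrightarrow> rz\<^sup>*\<^sup>* (B, T) (B', T')"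
    by simp
qed

definition irred_words :: "'a list \<Rightarrow> 'a list \<Rightarrow> bool" where
  "irred_words T B \<longleftrightarrow> (\<forall>k. 1 \<le> k \<and> k < length T \<longrightarrow> set (take k T) \<noteq> set (take k B))"

text \<open>
  Let the last letter \<open>z\<close> of one row have position \<open>i > 1\<close> in the other row. By irreducibility some letter to
  the right of \<open>z\<close> has a position smaller than \<open>i\<close> in the first row. Rotating it to the end and exchanging
  the rows decreases \<open>i\<close>.
\<close>

lemma standard_words:
  assumes "matching (T0 @ [z], B1 @ z # B2)" and "irred_words (T0 @ [z]) (B1 @ z # B2)" and "T0 \<noteq> []"
  shows "\<exists>a z' X Y. rz\<^sup>*\<^sup>* (T0 @ [z], B1 @ z # B2) (a # X @ [z'], z' # Y @ [a])"
  using assms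
proof (induction "length B1" arbitrary: T0 z B1 B2 rule: less_induct)
  case less
  let ?T = "T0 @ [z]" and ?B = "B1 @ z # B2"
  note m = less.prems(1)[unfolded matching_iff]
  have len: "length ?T = length ?B"
    using m by (metis distinct_card)
  show ?case
  proof (cases "B1 = []")
    case True
    obtain a X where T0: "T0 = a # X"
      using less.prems(3) by (cases T0) auto
    then have "a \<in> set B2"
      using m True by auto
    then obtain V1 V2 where "B2 = V1 @ a # V2"
      by (meson split_list)
    then have "rz\<^sup>*\<^sup>* (?T, ?B) (a # X @ [z], z # (V2 @ V1) @ [a])"
      using rz_bot[of T0 z "[]" "V1 @ [a]" V2] by (simp add: True T0 r_into_rtranclp)
    then show ?thesis by blast
  next
    case False
    let ?k = "length B1"
    have k: "1 \<le> ?k" "?k < length ?T"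
      using False len by (auto simp: Suc_le_eq)
    then have "set (take ?k ?T) \<noteq> set B1"
      using less.prems(2) by (auto simp: irred_words_def)
    moreover have "card (set (take ?k ?T)) = card (set B1)"
      using m k by (metis distinct_append distinct_card distinct_take length_take less_imp_le min.absorb2)
    ultimately have "\<not> set (take ?k ?T) \<subseteq> set B1"
      using card_subset_eq[of "set B1" "set (take ?k ?T)"] by auto
    then obtain x where x: "x \<in> set (take ?k T0)" "x \<notin> set B1"
      using k by (auto simp: take_append)
    have "x \<in> set T0"
      using x(1) by (rule in_set_takeD)
    then have "x \<noteq> z" "x \<in> set B2"
      using m x(2) by auto
    then obtain V1 V2 where B2: "B2 = V1 @ x # V2"
      by (meson split_list)
    obtain T1 T1' where T1: "take ?k T0 = T1 @ x # T1'"
      using x(1) by (meson split_list)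
    define T2 where "T2 = T1' @ drop ?k T0 @ [z]"
    have T: "?T = T1 @ x # T2"
      using append_take_drop_id[of ?k T0] unfolding T1 T2_def by (metis append.assoc append_Cons)
    have "length T1 < ?k"
      using arg_cong[OF T1, of length] by simp
    let ?C = "B1 @ z # V2 @ V1"
    have step: "rz (?T, ?B) (?T, ?C @ [x])"
      using rz_bot[of T0 z B1 "V1 @ [x]" V2] by (simp add: B2)
    have "mset (?C @ [x]) = mset ?B"
      by (simp add: B2)
    then have "matching (?C @ [x], T1 @ x # T2)"
      using less.prems(1) unfolding T matching_iff by (metis mset_eq_imp_distinct_iff mset_eq_setD)
    moreover have "irred_words (?C @ [x]) (T1 @ x # T2)"
      unfolding irred_words_def
    proof (intro allI impI)
      fix j assume j: "1 \<le> j \<and> j < length (?C @ [x])"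
      then have "j < length ?T"
        using len by (simp add: B2)
      show "set (take j (?C @ [x])) \<noteq> set (take j (T1 @ x # T2))"
      \<comment> \<open>Up to and including \<open>z\<close> the bottom row is unchanged; a longer
        prefix contains \<open>z\<close>, which is the last letter on top.\<close>
      proof (cases "j \<le> Suc ?k")
        case True
        then have "take j (?C @ [x]) = take j ?B"
          by (auto simp: take_append take_Cons')
        then show ?thesis
          using less.prems(2) j \<open>j < length ?T\<close> unfolding irred_words_def T by metis
      next
        case False
        then have "z \<in> set (take j (?C @ [x]))"
          by (auto simp: take_append take_Cons')
        moreover have "z \<notin> set (take j ?T)"
          using m \<open>j < length ?T\<close> by (auto dest: in_set_takeD)
        ultimately show ?thesis
          unfolding T by blast
      qed
    qed
    ultimately obtain a z' X Y where "rz\<^sup>*\<^sup>* (?C @ [x], T1 @ x # T2) (a # X @ [z'], z' # Y @ [a])"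
      using less.hyps[OF \<open>length T1 < ?k\<close>, of ?C x T2] by auto
    then have "rz\<^sup>*\<^sup>* (?T, ?C @ [x]) (z' # Y @ [a], a # X @ [z'])"
      unfolding T by (rule rz_rtranclp_swap)
    then show ?thesis
      using converse_rtranclp_into_rtranclp[of rz, OF step] by blast
  qed
qed

text \<open>Positions are counted from 0 within the core; a reversed block reflects its range of
  positions.\<close>

lemma block_position:
  assumes "(X, Y) \<in> blocks L" and "i < length L"
    and "sum_list (take i L) \<le> j" and "j < sum_list (take (Suc i) L)"
  shows "j < length X \<and> length Y = length X \<and> X ! j = Y ! (sum_list (take i L) + sum_list (take (Suc i) L) - 1 - j)"
  using assms
proof (induction L arbitrary: X Y i j)
  case (Cons k L)
  then obtain Z X' Y' where Z: "X = Z @ X'" "Y = rev Z @ Y'" "length Z = k" "(X', Y') \<in> blocks L"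
    by (auto simp: osum_def blk_def)
  have len: "length U = length V" if "(U, V) \<in> blocks L" for U V :: "'a list" and L
    using that by (induction L arbitrary: U V) (auto simp: blk_0 osum_def, auto simp: blk_def)
  show ?case
  proof (cases i)
    case 0
    then have "j < k" using Cons.prems by simp
    then show ?thesis
      using Z len[OF Z(4)] 0 by (simp add: nth_append rev_nth)
  next
    case (Suc i')
    let ?s = "sum_list (take i' L)" and ?s' = "sum_list (take (Suc i') L)"
    have j: "k \<le> j" "?s \<le> j - k" "j - k < ?s'"
      using Cons.prems(3,4) by (simp_all add: Suc)
    from Cons.IH[OF Z(4) _ j(2,3)] Cons.prems(2) Suc
    have IH: "j - k < length X'" "X' ! (j - k) = Y' ! (?s + ?s' - 1 - (j - k))"
      by simp_all
    have "\<not> k + ?s + (k + ?s') - 1 - j < k" "k + ?s + (k + ?s') - 1 - j - k = ?s + ?s' - 1 - (j - k)"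
      using j by linarith+
    then show ?thesis
      using IH j(1) Z len[OF Z(4)] by (simp add: Suc nth_append)
  qed
qed simp

text \<open>\<open>g\<close> names the letters by naturals, the letters used for
  \<open>\<sim>\<close>. Rows count from 1 and words from 0, hence the shift.\<close>

definition row_word :: "('a::finite \<Rightarrow> nat) \<Rightarrow> ('a \<Rightarrow> nat) \<Rightarrow> nat list \<Rightarrow> bool" where
  "row_word g r T \<longleftrightarrow> bij_betw r UNIV {1..CARD('a)} \<and> length T = CARD('a) \<and> (\<forall>a. T ! (r a - 1) = g a)"

lemma row_word_range:
  fixes r :: "'a::finite \<Rightarrow> nat"
  assumes "row_word g r T"
  shows "1 \<le> r a" "r a \<le> CARD('a)"
  using assms bij_betwE[of r UNIV "{1..CARD('a)}"] by (auto simp: row_word_def)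

lemma row_word_exists:
  fixes r :: "'a::finite \<Rightarrow> nat"
  assumes "bij_betw r UNIV {1..CARD('a)}"
  shows "\<exists>T. row_word g r T"
proof -
  let ?T = "map (\<lambda>i. g (inv r (Suc i))) [0..<CARD('a)]"
  have "?T ! (r a - 1) = g a" for a
  proof -
    have "1 \<le> r a" "r a \<le> CARD('a)"
      using assms bij_betwE[of r UNIV "{1..CARD('a)}"] by auto
    then have "r a - 1 < CARD('a)" "Suc (r a - 1) = r a"
      by simp_all
    then show ?thesis
      using bij_betw_imp_inj_on[OF assms] by simp
  qed
  with assms show ?thesis
    unfolding row_word_def by (intro exI[of _ ?T]) simp
qed

lemma row_word_preimage:
  fixes r :: "'a::finite \<Rightarrow> nat"
  assumes "row_word g r T" and "i < CARD('a)"
  obtains b where "r b = Suc i" "T ! i = g b"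
proof -
  have "Suc i \<in> r ` UNIV"
    using assms by (auto simp: row_word_def bij_betw_def)
  then obtain b where "r b = Suc i" by auto
  with that assms(1) show thesis
    unfolding row_word_def by (metis diff_Suc_1)
qed

lemma row_word_nth_iff:
  fixes r :: "'a::finite \<Rightarrow> nat"
  assumes "inj g" and "row_word g r T" and "i < CARD('a)"
  shows "T ! i = g a \<longleftrightarrow> r a = Suc i"
proof -
  obtain b where b: "r b = Suc i" "T ! i = g b"
    using row_word_preimage[OF assms(2,3)] .
  have "inj r"
    using assms(2) by (simp add: row_word_def bij_betw_def)
  with b assms(1) show ?thesis
    by (metis injD)
qed

lemma row_word_set: "row_word g r T \<Longrightarrow> set T = range g"
proof (intro equalityI subsetI)
  fix x assume r: "row_word g r T" and "x \<in> set T"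
  then obtain i where "i < CARD('a)" "x = T ! i"
    by (auto simp: in_set_conv_nth row_word_def)
  with row_word_preimage[OF r] show "x \<in> range g" by blast
next
  fix x assume r: "row_word g r T" and "x \<in> range g"
  then obtain a where a: "x = g a" by blast
  have "r a - 1 < length T"
    using row_word_range[OF r, of a] r by (auto simp: row_word_def)
  with a r show "x \<in> set T"
    unfolding row_word_def by (metis nth_mem)
qed

lemma row_word_distinct:
  fixes r :: "'a::finite \<Rightarrow> nat"
  assumes "inj g" and "row_word g r T"
  shows "distinct T"
  using row_word_set[OF assms(2)] assms
  by (metis card_distinct card_image row_word_def)

lemma letter_at_row_word:
  assumes "inj g" and "row_word g r T" and "i < length T" and "T ! i = g a"
  shows "letter_at r (Suc i) = a"
  unfolding letter_at_def
proof (rule the_equality)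
  have "i < CARD('a)"
    using assms(2,3) by (simp add: row_word_def)
  note iff = row_word_nth_iff[OF assms(1,2) this]
  show "r a = Suc i" using iff[of a] assms(4) by simp
  show "b = a" if "r b = Suc i" for b
    using iff[of b] that assms(1,4) by (metis injD)
qed

text \<open>The form of the second word says that the winner \<open>e\<close> is not its last
  letter; in this case a Rauzy move puts the last letter right behind \<open>e\<close>.\<close>

lemma row_word_rauzy_aux:
  fixes q r :: "'a::finite \<Rightarrow> nat"
  assumes g: "inj g" and q: "row_word g q (Q @ [e])" and r: "row_word g r (P @ e # U @ [x])"
  shows "row_word g (rauzy_aux q r) (P @ e # x # U)"
proof -
  let ?n = "CARD('a)" and ?T = "P @ e # U @ [x]" and ?T' = "P @ e # x # U"
  have n: "length ?T = ?n" "length (Q @ [e]) = ?n"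
    using q r by (auto simp: row_word_def)
  then have len: "length P + length U + 2 = ?n" by simp
  obtain z where z: "g z = e"
    using row_word_set[OF r] by (metis in_set_conv_decomp rangeE)
  have "letter_at q ?n = z"
    using letter_at_row_word[OF g q, of "length Q" z] n z by simp
  moreover have rz: "r z = Suc (length P)"
    using row_word_nth_iff[OF g r, of "length P" z] n z by simp
  ultimately have aux: "rauzy_aux q r b =
      (if r b \<le> Suc (length P) then r b else if r b < ?n then r b + 1 else length P + 2)" for b
    by (simp add: rauzy_aux_def Let_def)
  have range: "1 \<le> rauzy_aux q r b \<and> rauzy_aux q r b \<le> ?n" for b
    using row_word_range[OF r, of b] len by (auto simp: aux)
  have val: "?T' ! (rauzy_aux q r b - 1) = g b" for b
  proof -
    have b: "?T ! (r b - 1) = g b" "1 \<le> r b" "r b \<le> ?n"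
      using r row_word_range[OF r, of b] by (auto simp: row_word_def)
    consider "r b \<le> Suc (length P)" | "Suc (length P) < r b" "r b < ?n" | "r b = ?n"
      using b(3) by linarith
    then show ?thesis
    proof cases
      case 1
      then show ?thesis
        using b(1,2) by (cases "r b - 1 = length P") (auto simp: aux nth_append)
    next
      case 2
      define d where "d = r b - (length P + 2)"
      have d: "r b = length P + 2 + d" "d < length U"
        using 2 len by (simp_all add: d_def)
      then show ?thesis
        using b(1) len by (simp add: aux nth_append)
    next
      case 3
      then have "r b - 1 = length P + Suc (length U)"
        using len by simp
      then show ?thesis
        using b(1) 3 len by (simp add: aux nth_append)
    qed
  qed
  \<comment> \<open>The word read at the new position returns the name of the letter, so positions
    are distinct; counting gives surjectivity.\<close>
  have "inj (rauzy_aux q r)"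
    using val g by (metis injI injD)
  then have "card (range (rauzy_aux q r)) = card {1..?n}"
    by (simp add: card_image)
  moreover have "range (rauzy_aux q r) \<subseteq> {1..?n}"
    using range by auto
  ultimately have "range (rauzy_aux q r) = {1..?n}"
    by (simp add: card_subset_eq)
  then show ?thesis
    using \<open>inj (rauzy_aux q r)\<close> val n(1) by (simp add: row_word_def bij_betw_def)
qed

definition pair_words :: "('a::finite \<Rightarrow> nat) \<Rightarrow> 'a lpair \<Rightarrow> nat list \<times> nat list \<Rightarrow> bool" where
  "pair_words g p w \<longleftrightarrow> row_word g (fst p) (fst w) \<and> row_word g (snd p) (snd w)"

lemma in_rauzy_class_refl: "in_rauzy_class p p"
  by (simp add: in_rauzy_class_def)

lemma in_rauzy_class_step: "e \<in> {0, 1} \<Longrightarrow> in_rauzy_class (rauzy_move e p) q \<Longrightarrow> in_rauzy_class p q"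
  unfolding in_rauzy_class_def
  by (rule converse_rtranclp_into_rtranclp[where b = "rauzy_move e p"]) blast+

lemma in_rauzy_class_trans: "in_rauzy_class p q \<Longrightarrow> in_rauzy_class q r \<Longrightarrow> in_rauzy_class p r"
  unfolding in_rauzy_class_def by (rule rtranclp_trans)

text \<open>Each move of type 1 carries one letter of \<open>V\<close>, from the last to the first,
  to the place behind \<open>e\<close>.\<close>

lemma rotate_top_in_class:
  assumes "inj g" and "pair_words g p (P @ e # U @ V, Q @ [e])"
  shows "\<exists>q. in_rauzy_class p q \<and> pair_words g q (P @ e # V @ U, Q @ [e])"
  using assms(2)
proof (induction V arbitrary: U p rule: rev_induct)
  case Nil
  then show ?case
    by (intro exI[of _ p]) (simp add: in_rauzy_class_refl)
next
  case (snoc x V)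
  have "pair_words g (rauzy_move 1 p) (P @ e # (x # U) @ V, Q @ [e])"
    using snoc.prems row_word_rauzy_aux[OF assms(1), of "snd p" Q e "fst p" P "U @ V" x]
    by (simp add: pair_words_def rauzy_move_def)
  from snoc.IH[OF this] show ?case
    using in_rauzy_class_step[of 1 p] by auto
qed

lemma rotate_bot_in_class:
  assumes "inj g" and "pair_words g p (Q @ [e], P @ e # U @ V)"
  shows "\<exists>q. in_rauzy_class p q \<and> pair_words g q (Q @ [e], P @ e # V @ U)"
  using assms(2)
proof (induction V arbitrary: U p rule: rev_induct)
  case Nil
  then show ?case
    by (intro exI[of _ p]) (simp add: in_rauzy_class_refl)
next
  case (snoc x V)
  have "pair_words g (rauzy_move 0 p) (Q @ [e], P @ e # (x # U) @ V)"
    using snoc.prems row_word_rauzy_aux[OF assms(1), of "fst p" Q e "snd p" P "U @ V" x]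
    by (simp add: pair_words_def rauzy_move_def)
  from snoc.IH[OF this] show ?case
    using in_rauzy_class_step[of 0 p] by auto
qed

lemma rz_in_class:
  assumes "inj g" and "rz\<^sup>*\<^sup>* w w'" and "pair_words g p w"
  shows "\<exists>q. in_rauzy_class p q \<and> pair_words g q w'"
  using assms(2)
proof (induction rule: rtranclp_induct)
  case base
  then show ?case using assms(3) in_rauzy_class_refl by blast
next
  case (step v w)
  then obtain q where q: "in_rauzy_class p q" "pair_words g q v"
    by blast
  from step(2) have "\<exists>r. in_rauzy_class q r \<and> pair_words g r w"
  proof cases
    case (rz_top P e U V Q)
    then show ?thesis using rotate_top_in_class[OF assms(1)] q(2) by simp
  next
    case (rz_bot Q e P U V)
    then show ?thesis using rotate_bot_in_class[OF assms(1)] q(2) by simp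
  qed
  with q(1) show ?case using in_rauzy_class_trans by blast
qed

lemma irreducible_words:
  fixes p :: "'a::finite lpair"
  assumes "inj g" and "irreducible_pair p" and "pair_words g p (T, B)"
  shows "irred_words T B"
  unfolding irred_words_def
proof (intro allI impI notI)
  fix k assume k: "1 \<le> k \<and> k < length T" and eq: "set (take k T) = set (take k B)"
  have *: "g b \<in> set (take k W) \<longleftrightarrow> r b \<in> {1..k}" if "row_word g r W" for r W b
  proof
    assume "g b \<in> set (take k W)"
    then obtain i where "i < k" "i < length W" "W ! i = g b"
      by (auto simp: in_set_conv_nth)
    then show "r b \<in> {1..k}"
      using row_word_nth_iff[OF assms(1) that, of i b] that by (auto simp: row_word_def)
  next
    assume "r b \<in> {1..k}"
    then have "r b - 1 < length (take k W)" "take k W ! (r b - 1) = g b"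
      using that row_word_range[OF that, of b] by (auto simp: row_word_def)
    then show "g b \<in> set (take k W)" by (metis nth_mem)
  qed
  have "fst p -` {1..k} = snd p -` {1..k}"
    using assms(3) *[of "fst p" T] *[of "snd p" B] eq by (auto simp: pair_words_def)
  moreover have "k < CARD('a)"
    using k assms(3) by (simp add: pair_words_def row_word_def)
  ultimately show False
    using assms(2) k by (auto simp: irreducible_pair_def)
qed

text \<open>The offset 2 of the cut points comes from the first letter of each row and from counting
  positions from 1.\<close>

lemma por_decomp_words:
  fixes q :: "'a::finite lpair"
  assumes g: "inj g" and q: "pair_words g q (a # X @ [z], z # Y @ [a])"
    and XY: "(X, Y) \<in> blocks L" and "0 \<notin> set L"
  shows "por_decomp q (\<lambda>i. 2 + sum_list (take i L)) (length L)"
proof -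
  let ?T = "a # X @ [z]" and ?B = "z # Y @ [a]" and ?n = "CARD('a)"
  let ?s = "\<lambda>i. sum_list (take i L)"
  have T: "row_word g (fst q) ?T" and B: "row_word g (snd q) ?B"
    using q by (simp_all add: pair_words_def)
  have len: "length X + 2 = ?n" "length Y + 2 = ?n"
    using T B by (simp_all add: row_word_def)
  have lenX: "length X = sum_list L"
    using XY by (induction L arbitrary: X Y) (auto simp: blk_0 osum_def, auto simp: blk_def)
  obtain a' z' where az: "g a' = a" "g z' = z"
    using row_word_set[OF T] by (metis list.set_intros(1) in_set_conv_decomp rangeE append_Cons)
  have "standard_pair q"
    unfolding standard_pair_def
    using letter_at_row_word[OF g T, of 0 a'] letter_at_row_word[OF g T, of "Suc (length X)" z']
      letter_at_row_word[OF g B, of 0 z'] letter_at_row_word[OF g B, of "Suc (length Y)" a'] az len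
    by (simp add: nth_append flip: len)
  moreover have "2 + ?s (length L) = ?n"
    using len lenX by simp
  moreover have "2 + ?s i < 2 + ?s (Suc i)" if "i < length L" for i
    using that assms(4) by (simp add: take_Suc_conv_app_nth) (metis nth_mem gr0I)
  moreover have "fst q -` {2 + ?s (i - 1)..<2 + ?s i} = snd q -` {2 + ?s (i - 1)..<2 + ?s i} \<and>
      (\<forall>b\<in>fst q -` {2 + ?s (i - 1)..<2 + ?s i}. fst q b + snd q b = 2 + ?s (i - 1) + (2 + ?s i) - 1)"
    if i: "i \<in> {1..length L}" for i
  proof -
    let ?u = "?s (i - 1)" and ?v = "?s i"
    have pos: "j < length X \<and> X ! j = Y ! (?u + ?v - 1 - j)" if "?u \<le> j" "j < ?v" for j
    proof -
      have "i - 1 < length L" "Suc (i - 1) = i"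
        using i by auto
      then show ?thesis
        using block_position[OF XY, of "i - 1" j] that by simp
    qed
    have top: "snd q b = 2 + ?u + (2 + ?v) - 1 - fst q b" if b: "fst q b \<in> {2 + ?u..<2 + ?v}" for b
    proof -
      define j where "j = fst q b - 2"
      have j: "?u \<le> j" "j < ?v" "fst q b = Suc (Suc j)"
        using b by (auto simp: j_def)
      have "?T ! Suc j = g b"
        using T j(3) by (metis diff_Suc_1 row_word_def)
      then have "Y ! (?u + ?v - 1 - j) = g b"
        using pos[OF j(1,2)] by (simp add: nth_append)
      moreover have "?u + ?v - 1 - j < length Y"
      proof -
        have "?u \<le> ?u + ?v - 1 - j" "?u + ?v - 1 - j < ?v"
          using j(1,2) by linarith+
        from pos[OF this] show ?thesis
          using len by simp
      qed
      ultimately have "?B ! Suc (?u + ?v - 1 - j) = g b"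
        by (simp add: nth_append)
      then have "snd q b = Suc (Suc (?u + ?v - 1 - j))"
        using row_word_nth_iff[OF g B, of "Suc (?u + ?v - 1 - j)" b] \<open>?u + ?v - 1 - j < length Y\<close> len by simp
      then show ?thesis
        using j by linarith
    qed
    \<comment> \<open>Reflection is an involution of the range, so the argument for
      \<open>top\<close> also runs from the bottom row to the top row.\<close>
    have bot: "fst q b = 2 + ?u + (2 + ?v) - 1 - snd q b" if b: "snd q b \<in> {2 + ?u..<2 + ?v}" for b
    proof -
      define j where "j = ?u + ?v - 1 - (snd q b - 2)"
      have j: "?u \<le> j" "j < ?v" "snd q b = Suc (Suc (?u + ?v - 1 - j))"
        using b by (auto simp: j_def)
      have "?B ! Suc (?u + ?v - 1 - j) = g b"
        using B j(3) by (metis diff_Suc_1 row_word_def)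
      moreover have "?u + ?v - 1 - j < length Y"
      proof -
        have "?u \<le> ?u + ?v - 1 - j" "?u + ?v - 1 - j < ?v"
          using j(1,2) by linarith+
        from pos[OF this] show ?thesis
          using len by simp
      qed
      ultimately have "?T ! Suc j = g b"
        using pos[OF j(1,2)] by (simp add: nth_append)
      then have "fst q b = Suc (Suc j)"
        using row_word_nth_iff[OF g T, of "Suc j" b] pos[OF j(1,2)] len by simp
      then show ?thesis
        using j by linarith
    qed
    have "fst q b \<in> {2 + ?u..<2 + ?v} \<longleftrightarrow> snd q b \<in> {2 + ?u..<2 + ?v}" for b
    proof
      assume "fst q b \<in> {2 + ?u..<2 + ?v}"
      then show "snd q b \<in> {2 + ?u..<2 + ?v}"
        using top[of b] by auto
    next
      assume "snd q b \<in> {2 + ?u..<2 + ?v}"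
      then show "fst q b \<in> {2 + ?u..<2 + ?v}"
        using bot[of b] by auto
    qed
    moreover have "fst q b + snd q b = 2 + ?u + (2 + ?v) - 1" if "fst q b \<in> {2 + ?u..<2 + ?v}" for b
      using top[OF that] that by auto
    ultimately show ?thesis by auto
  qed
  ultimately show ?thesis
    unfolding por_decomp_def by auto
qed

lemma block_sizes_sum_list: "block_sizes (\<lambda>i. 2 + sum_list (take i L)) (length L) = L"
  unfolding block_sizes_def by (rule nth_equalityI) (simp_all add: take_Suc_conv_app_nth)

theorem theorem4p4:
  fixes p :: "('a::finite \<Rightarrow> nat) \<times> ('a \<Rightarrow> nat)"
  assumes "CARD('a) \<ge> 2"
    and "irreducible_pair p"
  shows "\<exists>q k l. in_rauzy_class p q \<and> por_decomp q k l \<and>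
           (type1 (block_sizes k l) \<or> type2 (block_sizes k l) \<or> type3 (block_sizes k l) \<or>
            type4 (block_sizes k l) \<or> type5 (block_sizes k l))"
proof -
  have "is_pair p"
    using assms(2) by (simp add: irreducible_pair_def)
  then have bij: "bij_betw (fst p) UNIV {1..CARD('a)}" "bij_betw (snd p) UNIV {1..CARD('a)}"
    by (simp_all add: is_pair_def)
  \<comment> \<open>The top row of \<open>p\<close> itself serves as an injective naming of the
    letters by naturals.\<close>
  define g where "g = fst p"
  have g: "inj g"
    using bij(1) by (simp add: g_def bij_betw_def)
  obtain T B where TB: "row_word g (fst p) T" "row_word g (snd p) B"
    using row_word_exists bij by metis
  then have words: "pair_words g p (T, B)"
    by (simp add: pair_words_def)
  have match: "matching (T, B)"
    using TB row_word_distinct[OF g] row_word_set by (metis matching_iff)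
  have lenT: "2 \<le> length T"
    using TB(1) assms(1) by (simp add: row_word_def)
  then obtain T0 z where T: "T = T0 @ [z]"
    by (cases T rule: rev_cases) auto
  with lenT have "T0 \<noteq> []"
    by auto
  from T obtain B1 B2 where B: "B = B1 @ z # B2"
    using match by (metis in_set_conv_decomp matching_iff)
  obtain a z' X Y where std: "rz\<^sup>*\<^sup>* (T, B) (a # X @ [z'], z' # Y @ [a])"
    using standard_words[of T0 z B1 B2] match irreducible_words[OF g assms(2) words] T B \<open>T0 \<noteq> []\<close> by auto
  obtain p1 where p1: "in_rauzy_class p p1" "pair_words g p1 (a # X @ [z'], z' # Y @ [a])"
    using rz_in_class[OF g std words] by blast
  have r: "row_word g (fst p1) (a # X @ [z'])" "row_word g (snd p1) (z' # Y @ [a])"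
    using p1(2) by (simp_all add: pair_words_def)
  have "distinct (a # X @ [z'])" "distinct (z' # Y @ [a])" "set (a # X @ [z']) = set (z' # Y @ [a])"
    using row_word_distinct[OF g r(1)] row_word_distinct[OF g r(2)] row_word_set[OF r(1)] row_word_set[OF r(2)]
    by simp_all
  then have "matching (X, Y)"
    unfolding matching_iff by auto
  then obtain L X' Y' where L: "typed L" "(X', Y') \<in> blocks L" "ceq (X, Y) (X', Y')"
    using ceq_typed by (metis surj_pair)
  \<comment> \<open>The instance of \<open>ceq\<close> with empty \<open>W\<close> and
    \<open>W'\<close>.\<close>
  have "rz\<^sup>*\<^sup>* (a # X @ [z'], z' # Y @ [a]) (a # X' @ [z'], z' # Y' @ [a])"
    using L(3) unfolding ceq_def by (metis append_Nil fst_conv snd_conv)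
  from rz_in_class[OF g this p1(2)] obtain q where q: "in_rauzy_class p1 q"
    "pair_words g q (a # X' @ [z'], z' # Y' @ [a])"
    by blast
  have "por_decomp q (\<lambda>i. 2 + sum_list (take i L)) (length L)"
    using por_decomp_words[OF g q(2) L(2)] L(1) by (simp add: typed_def)
  moreover have "in_rauzy_class p q"
    using p1(1) q(1) by (rule in_rauzy_class_trans)
  ultimately show ?thesis
    using L(1) block_sizes_sum_list[of L] unfolding typed_def by metis
qed

end
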